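(* Let $\mathscr{X}=(\mathcal{X},d,\mu)$ be a metric measure space with $\mathcal{X}=\mathrm{supp}(\mu)$, and let $(X_n)_{n\geq1}$, $(X_n')_{n\geq1}$ be two independent sequences of i.i.d. random variables with law $\mu$. The following assertions are equivalent: (1) For all $p\geq1$ and all $\varphi\in\mathscr{C}_b(\mathbb{R}^{\binom p2})$, $\mathrm{cov}\big(\varphi(d(X_1,X_2,\dots,X_p)),\varphi(d(X_1,X_2',\dots,X_p'))\big)=0$. (2) The map $\nu:x\mapsto\nu^x$ is constant on $\mathcal{X}$. (3) The action of $\mathrm{Isomp}(\mathscr{X})$ on $\mathcal{X}$ is transitive. (4) There exist a compact topological group $G$ and a closed subgroup $K$ of $G$ such that $$(\mathcal{X},d,\mu)=(G/K,d_{G/K},\mu_{G/K}),$$ where $d_{G/K}$ is a distance on $G/K$ invariant under the action of $G$, that is $d_{G/K}(\overline{gg_1},\overline{gg_2})=d_{G/K}(\overline{g_1},\overline{g_2})$ for all $g,g_1,g_2\in G$, and $\mu_{G/K}=\pi_*(\mathrm{Haar}_G)$ is the push-forward of the Haar probability measure of $G$ by the canonical projection $\pi:G\to G/K$.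
   Context: A metric measure space (mm-space) is a complete separable metric space $(\mathcal{X},d)$ endowed with a Borel probability measure $\mu$; one always assumes that $\mathcal{X}$ is the support of $\mu$. Two mm-spaces are measure-preserving isometric if there is an isometry between the supports of their measures pushing one measure to the other; the space of mm-spaces is considered modulo this relation. The equality in (4) is between mm-spaces (so $(G/K,d_{G/K},\mu_{G/K})$ is an mm-space) and is understood modulo measure-preserving isometries. $\mathscr{C}_b$ denotes bounded continuous real functions, and $\varphi(d(x_1,\dots,x_p))=\varphi((d(x_a,x_b))_{1\leq a<b\leq p})$. $\mathbb{R}^{\mathrm{met}}$ is the space of infinite pseudo-distance matrices $(d_{i,j})_{1\leq i<j<\infty}$ (with $d_{i,j}+d_{j,k}\geq d_{i,k}$ for $i<j<k$). For $x\in\mathcal{X}$, the pointed distance matrix distribution $\nu^x$ is the law on $\mathbb{R}^{\mathrm{met}}$ of the infinite matrix of mutual distances of the sequence $(x,X_1,X_2,X_3,\dots)$. $\mathrm{Isomp}(\mathscr{X})$ is the group of isometries $i:\mathcal{X}\to\mathcal{X}$ which preserve the measure, $i_*\mu=\mu$; it acts on $\mathcal{X}$ by $g\cdot x=g(x)$. $\overline{g}=gK$ denotes the class of $g$ in the space of left cosets $G/K$. *)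

theory Defs
  imports "HOL-Probability.Probability" "HOL-Algebra.Group_Action" "HOL-Algebra.Left_Coset"
begin

section \<open>Metric measure spaces\<close>

definition borel_sigma :: "'a topology \<Rightarrow> 'a measure" where
  "borel_sigma T = sigma (topspace T) {U. openin T U}"

text \<open>The last conjunct says that the support of the measure is the whole space.\<close>

definition mm_space :: "'a set \<Rightarrow> ('a \<Rightarrow> 'a \<Rightarrow> real) \<Rightarrow> 'a measure \<Rightarrow> bool" where
  "mm_space M d \<mu> \<longleftrightarrow>
     Metric_space M d \<and>
     Metric_space.mcomplete M d \<and>
     separable_space (Metric_space.mtopology M d) \<and>
     sets \<mu> = sets (borel_sigma (Metric_space.mtopology M d)) \<and>
     prob_space \<mu> \<and>
     (\<forall>U. openin (Metric_space.mtopology M d) U \<and> U \<noteq> {} \<longrightarrow> emeasure \<mu> U > 0)"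

text \<open>Equality of mm-spaces modulo measure-preserving isometry. For spaces of full support the
  isometry between the supports is a bijection between the underlying sets.\<close>

definition mm_isometric ::
  "'a set \<Rightarrow> ('a \<Rightarrow> 'a \<Rightarrow> real) \<Rightarrow> 'a measure \<Rightarrow> 'b set \<Rightarrow> ('b \<Rightarrow> 'b \<Rightarrow> real) \<Rightarrow> 'b measure \<Rightarrow> bool" where
  "mm_isometric M d \<mu> N e \<nu> \<longleftrightarrow>
     (\<exists>f. bij_betw f M N \<and> (\<forall>x\<in>M. \<forall>y\<in>M. e (f x) (f y) = d x y) \<and>
          f \<in> measurable \<mu> \<nu> \<and> distr \<mu> \<nu> f = \<nu>)"

text \<open>Elements of \<open>Bij UNIV\<close> are the bijections of the whole type; the group law inherited from
  \<open>BijGroup UNIV\<close> is composition.\<close>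

definition Isomp :: "'a::metric_space measure \<Rightarrow> ('a \<Rightarrow> 'a) monoid" where
  "Isomp \<mu> = (BijGroup UNIV)
     \<lparr>carrier := {i \<in> Bij UNIV. (\<forall>x y. dist (i x) (i y) = dist x y) \<and>
                               i \<in> measurable \<mu> \<mu> \<and> distr \<mu> \<mu> i = \<mu>}\<rparr>"

section \<open>Distance matrices\<close>

text \<open>A matrix \<open>(D\<^sub>i\<^sub>j)\<close> with indices \<open>1 \<le> i < j\<close> is a function on a set of pairs, extended by
  \<^const>\<open>undefined\<close>. The finite matrices with index set \<open>index_pairs p\<close> form
  the space \<open>\<real>\<close> to the power \<open>p choose 2\<close>, with topology \<open>powertop_real (index_pairs p)\<close>.\<close>

definition index_pairs :: "nat \<Rightarrow> (nat \<times> nat) set" where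
  "index_pairs p = {(a, b). 1 \<le> a \<and> a < b \<and> b \<le> p}"

definition index_pairs_inf :: "(nat \<times> nat) set" where
  "index_pairs_inf = {(a, b). 1 \<le> a \<and> a < b}"

definition dist_matrix :: "(nat \<times> nat) set \<Rightarrow> (nat \<Rightarrow> 'a::metric_space) \<Rightarrow> nat \<times> nat \<Rightarrow> real" where
  "dist_matrix I x = (\<lambda>(a, b)\<in>I. dist (x a) (x b))"

definition Rmet :: "(nat \<times> nat \<Rightarrow> real) set" where
  "Rmet = {D \<in> extensional index_pairs_inf.
     (\<forall>i j. 1 \<le> i \<and> i < j \<longrightarrow> 0 \<le> D (i, j)) \<and>
     (\<forall>i j k. 1 \<le> i \<and> i < j \<and> j < k \<longrightarrow>
        D (i, k) \<le> D (i, j) + D (j, k) \<and>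
        D (i, j) \<le> D (i, k) + D (j, k) \<and>
        D (j, k) \<le> D (i, j) + D (i, k))}"

text \<open>Since the index set is countable, the product sigma-algebra is the Borel sigma-algebra of
  the product topology.\<close>

definition Rmet_sigma :: "(nat \<times> nat \<Rightarrow> real) measure" where
  "Rmet_sigma = restrict_space (PiM index_pairs_inf (\<lambda>_. borel)) Rmet"

text \<open>The law of the matrix of the mutual distances of \<open>(x, X\<^sub>1, X\<^sub>2, \<dots>)\<close>.\<close>

definition pointed_matrix_distribution ::
  "'w measure \<Rightarrow> (nat \<Rightarrow> 'w \<Rightarrow> 'a::metric_space) \<Rightarrow> 'a \<Rightarrow> (nat \<times> nat \<Rightarrow> real) measure" where
  "pointed_matrix_distribution \<Omega> X x =
     distr \<Omega> Rmet_sigma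
       (\<lambda>\<omega>. dist_matrix index_pairs_inf (\<lambda>i. if i = 1 then x else X (i - 1) \<omega>))"

definition covariance :: "'w measure \<Rightarrow> ('w \<Rightarrow> real) \<Rightarrow> ('w \<Rightarrow> real) \<Rightarrow> real" where
  "covariance \<Omega> U V =
     (\<integral>\<omega>. (U \<omega> - (\<integral>\<eta>. U \<eta> \<partial>\<Omega>)) * (V \<omega> - (\<integral>\<eta>. V \<eta> \<partial>\<Omega>)) \<partial>\<Omega>)"

section \<open>Quotients of compact groups\<close>

text \<open>Compact includes the Hausdorff property.\<close>

definition compact_topological_group :: "('g, 'r) monoid_scheme \<Rightarrow> 'g topology \<Rightarrow> bool" where
  "compact_topological_group G T \<longleftrightarrow>
     group G \<and> topspace T = carrier G \<and>
     continuous_map (prod_topology T T) T (\<lambda>(x, y). x \<otimes>\<^bsub>G\<^esub> y) \<and>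
     continuous_map T T (\<lambda>x. inv\<^bsub>G\<^esub> x) \<and>
     compact_space T \<and> Hausdorff_space T"

text \<open>Left-invariant regular Borel probability measures. Regularity is what makes the measure
  unique when the group is not metrizable.\<close>

definition haar_probability ::
  "('g, 'r) monoid_scheme \<Rightarrow> 'g topology \<Rightarrow> 'g measure \<Rightarrow> bool" where
  "haar_probability G T h \<longleftrightarrow>
     sets h = sets (borel_sigma T) \<and> prob_space h \<and>
     (\<forall>g\<in>carrier G. \<forall>A\<in>sets h. emeasure h (g <#\<^bsub>G\<^esub> A) = emeasure h A) \<and>
     (\<forall>A\<in>sets h. emeasure h A = (INF U\<in>{U. openin T U \<and> A \<subseteq> U}. emeasure h U)) \<and>
     (\<forall>U. openin T U \<longrightarrow> emeasure h U = (SUP C\<in>{C. compactin T C \<and> C \<subseteq> U}. emeasure h C))"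

text \<open>\<open>compact_group_quotient TYPE('g) M d \<mu>\<close>: the mm-space \<open>(M, d, \<mu>)\<close> is isomorphic to some
  \<open>G/K\<close>, where the elements of \<open>G\<close> have type \<open>'g\<close>. The only compatibility of \<open>\<delta>\<close> with the
  topology of \<open>G\<close> is that the projection is Borel, so that the push-forward of the Haar measure is
  a Borel measure for \<open>\<delta>\<close>.\<close>

definition compact_group_quotient ::
  "'g itself \<Rightarrow> 'a set \<Rightarrow> ('a \<Rightarrow> 'a \<Rightarrow> real) \<Rightarrow> 'a measure \<Rightarrow> bool" where
  "compact_group_quotient (t :: 'g itself) M d \<mu> \<longleftrightarrow>
     (\<exists>(G :: 'g monoid) T K h \<delta>.
        compact_topological_group G T \<and> subgroup K G \<and> closedin T K \<and>
        haar_probability G T h \<and>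
        Metric_space (lcosets\<^bsub>G\<^esub> K) \<delta> \<and>
        (\<forall>g\<in>carrier G. \<forall>g\<^sub>1\<in>carrier G. \<forall>g\<^sub>2\<in>carrier G.
           \<delta> ((g \<otimes>\<^bsub>G\<^esub> g\<^sub>1) <#\<^bsub>G\<^esub> K) ((g \<otimes>\<^bsub>G\<^esub> g\<^sub>2) <#\<^bsub>G\<^esub> K) = \<delta> (g\<^sub>1 <#\<^bsub>G\<^esub> K) (g\<^sub>2 <#\<^bsub>G\<^esub> K)) \<and>
        (let B = borel_sigma (Metric_space.mtopology (lcosets\<^bsub>G\<^esub> K) \<delta>);
             \<pi> = (\<lambda>g. g <#\<^bsub>G\<^esub> K)
         in \<pi> \<in> measurable h B \<and>
            mm_space (lcosets\<^bsub>G\<^esub> K) \<delta> (distr h B \<pi>) \<and>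
            mm_isometric M d \<mu> (lcosets\<^bsub>G\<^esub> K) \<delta> (distr h B \<pi>)))"

end

theory Submission
  imports Defs
begin

text \<open>Constancy of \<open>\<nu>\<close> and vanishing of the covariances are equivalent because the covariance is the
  variance of the conditional mean \<open>x \<mapsto> E \<phi>(d(x, X\<^sub>2, \<dots>, X\<^sub>p))\<close>, a continuous function of \<open>x\<close>, and
  because \<open>\<mu>\<close> has full support.

  If \<open>\<nu>\<^sup>x = \<nu>\<^sup>y\<close>, there are two sequences with the same distances, to each other and to \<open>x\<close> and \<open>y\<close>
  respectively, whose empirical measures both converge to \<open>\<mu>\<close>. They are dense, so matching them
  defines an isometry of the space; it sends \<open>x\<close> to \<open>y\<close> and preserves \<open>\<mu>\<close>.

  If the isomorphisms act transitively, all balls of a given radius have the same mass, so the space is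
  compact, and the group of isomorphisms is compact for the uniform distance, which is bi-invariant.
  Every compact metric space carries a regular Borel probability measure invariant under all of its
  isometries (a limit of normalised covering numbers); on the group this is a Haar measure, and its
  image under \<open>g \<mapsto> g x\<^sub>0\<close> is \<open>\<mu>\<close>.\<close>

section \<open>Borel measures on topological and metric spaces\<close>

text \<open>The way back from a quotient of a compact group is direct: left translations of the
  cosets are isometries because the distance is invariant, and they preserve the image of the Haar
  measure because that measure is left-invariant. Conjugated with the given isometry they act
  transitively on the space. The forward direction uses invariance on both sides: left invariance is
  part of being a Haar measure, while right invariance identifies the image of the measure under
  evaluation. A measure invariant under all isometries of a bi-invariant distance has both
  properties at once. Limits of covering numbers are only finitely additive, and only on closed
  sets, so they yield a content, from which a measure is obtained by Caratheodory's construction.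
  Arguments about random matrices take place on the sequence space \<open>S\<close>, with full
  square matrices indexed from 0, so that the product topology of the type is available. The
  triangular matrices indexed from 1, and the arbitrary probability space carrying the two
  sequences, are reduced to this case at the end.\<close>

lemma space_borel_sigma: "space (borel_sigma T) = topspace T"
  unfolding borel_sigma_def by (rule space_measure_of) (auto dest: openin_subset)

lemma openin_borel_sigma: "openin T U \<Longrightarrow> U \<in> sets (borel_sigma T)"
  unfolding borel_sigma_def by (auto dest: openin_subset)

lemma closedin_borel_sigma:
  assumes "closedin T C"
  shows "C \<in> sets (borel_sigma T)"
proof -
  have "space (borel_sigma T) - (topspace T - C) \<in> sets (borel_sigma T)"
    using assms by (intro sets.compl_sets openin_borel_sigma) (simp add: closedin_def)
  moreover have "space (borel_sigma T) - (topspace T - C) = C"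
    using closedin_subset[OF assms] by (auto simp: space_borel_sigma)
  ultimately show ?thesis by simp
qed

lemma measurable_borel_sigma_continuous_map:
  assumes "continuous_map T T' f"
  shows "f \<in> measurable (borel_sigma T) (borel_sigma T')"
  unfolding borel_sigma_def[of T']
proof (rule measurable_measure_of)
  show "f \<in> space (borel_sigma T) \<rightarrow> topspace T'"
    using assms by (simp add: space_borel_sigma continuous_map_funspace)
next
  fix U assume "U \<in> {U. openin T' U}"
  then have "openin T {x \<in> topspace T. f x \<in> U}"
    using assms openin_continuous_map_preimage by blast
  moreover have "f -` U \<inter> space (borel_sigma T) = {x \<in> topspace T. f x \<in> U}"
    by (auto simp: space_borel_sigma)
  ultimately show "f -` U \<inter> space (borel_sigma T) \<in> sets (borel_sigma T)"
    by (simp add: openin_borel_sigma)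
qed (auto dest: openin_subset)

lemma borel_sigma_euclidean: "borel_sigma euclidean = borel"
  by (simp add: borel_sigma_def borel_def)

text \<open>Brings estimates for thickened closed sets back to the sets themselves. The empty set
  has to be excluded: \<open>infdist x {}\<close> is 0, so its neighbourhoods would be the whole
  space.\<close>

lemma measure_closed_neighbourhoods_tendsto:
  fixes M :: "'a::metric_space measure"
  assumes "finite_measure M" and sets: "sets M = sets borel" and C: "closed C" "C \<noteq> {}"
  shows "(\<lambda>n. measure M {x. infdist x C \<le> 1 / real (Suc n)}) \<longlonglongrightarrow> measure M C"
proof -
  interpret finite_measure M by fact
  define U where "U n = {x. infdist x C \<le> 1 / real (Suc n)}" for n
  have U: "closed (U n)" for n
    unfolding U_def by (intro closed_Collect_le continuous_intros)
  have "(\<lambda>n. measure M (U n)) \<longlonglongrightarrow> measure M (\<Inter>n. U n)"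
  proof (rule finite_Lim_measure_decseq)
    show "range U \<subseteq> sets M" using U by (auto simp: sets)
    show "decseq U"
      by (rule decseq_SucI) (auto simp: U_def elim!: order_trans intro!: divide_left_mono)
  qed
  moreover have "(\<Inter>n. U n) = C"
  proof (intro equalityI subsetI)
    fix x assume x: "x \<in> (\<Inter>n. U n)"
    have "infdist x C \<le> 0"
    proof (rule field_le_epsilon)
      fix e :: real assume "e > 0"
      then obtain n where "1 / real (Suc n) < e" using nat_approx_posE by blast
      then show "infdist x C \<le> 0 + e" using x by (auto simp: U_def dest: spec[of _ n])
    qed
    then show "x \<in> C"
      using C infdist_nonneg[of x C] by (simp add: in_closed_iff_infdist_zero)
  qed (auto simp: U_def)
  ultimately show ?thesis by (simp add: U_def)
qed

lemma open_Union_incseq_closed: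
  fixes U :: "'a::metric_space set"
  assumes U: "open U"
  obtains F where "\<And>n::nat. closed (F n)" "incseq F" "(\<Union>n. F n) = U"
\<comment> \<open>The distance to the empty complement is 0 by convention, which would make every
  \<open>F n\<close> empty.\<close>
proof (cases "U = UNIV")
  case True
  show ?thesis by (rule that[of "\<lambda>_. UNIV"]) (auto simp: True)
next
  case False
  define F where "F n = {x. 1 / real (Suc n) \<le> infdist x (- U)}" for n
  have "closed (F n)" for n unfolding F_def by (intro closed_Collect_le continuous_intros)
  moreover have "incseq F"
    by (rule incseq_SucI) (auto simp: F_def elim!: order_trans[rotated] intro!: divide_left_mono)
  moreover have "(\<Union>n. F n) = U"
  proof (intro equalityI subsetI)
    fix x assume "x \<in> (\<Union>n. F n)"
    then obtain n where "1 / real (Suc n) \<le> infdist x (- U)" by (auto simp: F_def)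
    then have "infdist x (- U) \<noteq> 0" by (smt (verit) of_nat_0_less_iff zero_less_Suc zero_less_divide_1_iff)
    then show "x \<in> U" by (metis ComplI infdist_zero)
  next
    fix x assume "x \<in> U"
    then have "infdist x (- U) \<noteq> 0"
      using U False by (subst in_closed_iff_infdist_zero[symmetric]) auto
    then have "infdist x (- U) > 0" using infdist_nonneg[of x "- U"] by linarith
    then obtain n where "1 / real (Suc n) < infdist x (- U)" using nat_approx_posE by blast
    then show "x \<in> (\<Union>n. F n)" by (auto simp: F_def intro: less_imp_le)
  qed
  ultimately show ?thesis by (rule that)
qed

text \<open>One inequality on closed sets is enough because both total masses are 1: complements
  give the reverse inequality on open sets, and exhausting an open set by closed sets gives the
  other one.\<close>

lemma measure_eqI_closed_le:
  fixes M N :: "'a::metric_space measure"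
  assumes "prob_space M" "prob_space N" and sets: "sets M = sets borel" "sets N = sets borel"
    and closed_le: "\<And>C. closed C \<Longrightarrow> measure M C \<le> measure N C"
  shows "M = N"
proof -
  interpret M: prob_space M by fact
  interpret N: prob_space N by fact
  have space: "space M = UNIV" "space N = UNIV"
    using sets_eq_imp_space_eq[OF sets(1)] sets_eq_imp_space_eq[OF sets(2)] by simp_all
  have open_eq: "measure M U = measure N U" if U: "open U" for U
  proof (rule antisym)
    have "measure M (UNIV - U) \<le> measure N (UNIV - U)"
      using U by (intro closed_le) auto
    then show "measure N U \<le> measure M U"
      using M.prob_compl[of U] N.prob_compl[of U] U by (simp add: sets space)
    obtain F where F: "\<And>n. closed (F n)" "incseq F" "(\<Union>n. F n) = U"
      using open_Union_incseq_closed[OF U] by metis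
    have "(\<lambda>n. measure M (F n)) \<longlonglongrightarrow> measure M U"
      unfolding F(3)[symmetric] using F by (intro M.finite_Lim_measure_incseq) (auto simp: sets)
    moreover have "measure M (F n) \<le> measure N U" for n
    proof -
      have "measure M (F n) \<le> measure N (F n)" by (intro closed_le F)
      also have "\<dots> \<le> measure N U"
        using F U by (intro N.finite_measure_mono) (auto simp: sets)
      finally show ?thesis .
    qed
    ultimately show "measure M U \<le> measure N U"
      by (intro LIMSEQ_le_const2[of _ "measure M U"]) auto
  qed
  show ?thesis
  proof (rule measure_eqI_generator_eq[where E = "{U. open U}" and \<Omega> = UNIV and A = "\<lambda>_. UNIV"])
    show "Int_stable {U :: 'a set. open U}" by (auto simp: Int_stable_def)
    show "sets M = sigma_sets UNIV {U. open U}" "sets N = sigma_sets UNIV {U. open U}"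
      by (simp_all add: sets borel_def)
    show "emeasure M U = emeasure N U" if "U \<in> {U. open U}" for U
      using open_eq[of U] that by (simp add: M.emeasure_eq_measure N.emeasure_eq_measure)
  qed auto
qed

lemma measure_eqI_integral_bounded_continuous:
  fixes M N :: "'a::metric_space measure"
  assumes "prob_space M" "prob_space N" and sets: "sets M = sets borel" "sets N = sets borel"
    and eq: "\<And>f :: 'a \<Rightarrow> real. continuous_on UNIV f \<Longrightarrow> (\<And>x. \<bar>f x\<bar> \<le> 1) \<Longrightarrow>
      integral\<^sup>L M f = integral\<^sup>L N f"
  shows "M = N"
proof -
  interpret M: prob_space M by fact
  interpret N: prob_space N by fact
  have space: "space M = UNIV" "space N = UNIV"
    using sets_eq_imp_space_eq[OF sets(1)] sets_eq_imp_space_eq[OF sets(2)] by simp_all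
  show ?thesis
  proof (rule measure_eqI_closed_le[OF assms(1,2) sets])
    fix C :: "'a set" assume C: "closed C"
    show "measure M C \<le> measure N C"
    proof (cases "C = {}")
      case False
      have "measure M C \<le> measure N {x. infdist x C \<le> 1 / real (Suc n)}" for n
      proof -
        let ?D = "{x. infdist x C \<le> 1 / real (Suc n)}"
        \<comment> \<open>A continuous function squeezed between the indicators of \<open>C\<close>
          and of its closed neighbourhood \<open>?D\<close>; the slope is chosen so that it reaches
          0 at the boundary of \<open>?D\<close>.\<close>
        define f where "f x = max 0 (1 - real (Suc n) * infdist x C)" for x
        have f: "continuous_on UNIV f" unfolding f_def by (intro continuous_intros)
        have f01: "0 \<le> f x" "f x \<le> 1" for x
          using infdist_nonneg[of x C] by (auto simp: f_def)
        have fm: "f \<in> borel_measurable M" "f \<in> borel_measurable N"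
          using borel_measurable_continuous_onI[OF f] by (simp_all cong: measurable_cong_sets add: sets)
        have D: "closed ?D" by (intro closed_Collect_le continuous_intros)
        have int: "integrable M f" "integrable N f"
          using f01 fm by (auto intro!: M.integrable_const_bound[of _ 1] N.integrable_const_bound[of _ 1])
        have "measure M C = integral\<^sup>L M (indicator C)" using C by (simp add: sets space)
        also have "\<dots> \<le> integral\<^sup>L M f"
        proof (rule integral_mono)
          show "integrable M (indicator C :: 'a \<Rightarrow> real)"
            using C by (intro integrable_real_indicator) (auto simp: sets M.emeasure_eq_measure)
          show "indicator C x \<le> f x" for x using f01[of x] by (auto simp: indicator_def f_def)
        qed fact
        also have "\<dots> = integral\<^sup>L N f" using f01 by (intro eq f) (simp add: abs_of_nonneg)
        also have "\<dots> \<le> integral\<^sup>L N (indicator ?D)"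
        proof (rule integral_mono)
          show "integrable N (indicator ?D :: 'a \<Rightarrow> real)"
            using D by (intro integrable_real_indicator) (auto simp: sets N.emeasure_eq_measure)
          show "f x \<le> indicator ?D x" for x
          proof (cases "x \<in> ?D")
            case True then show ?thesis using f01[of x] by simp
          next
            case False
            then have "1 < real (Suc n) * infdist x C" by (simp add: field_simps)
            then show ?thesis using False by (simp add: f_def)
          qed
        qed fact
        also have "\<dots> = measure N ?D" using D by (simp add: sets space)
        finally show ?thesis .
      qed
      then show ?thesis
        using measure_closed_neighbourhoods_tendsto[OF N.finite_measure_axioms sets(2) C False]
        by (intro LIMSEQ_le_const[of _ "measure N C"]) auto
    qed simp
  qed
qed

section \<open>The regular measure induced by a content\<close>

text \<open>A content in the sense of Halmos, with closed sets in the role of compact ones. The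
  measure induced by it dominates \<open>L\<close> on closed sets and has the same total mass, but
  it need not agree with \<open>L\<close> on each closed set.\<close>

locale compact_content =
  fixes T :: "'a topology" and L :: "'a set \<Rightarrow> real"
  assumes compact: "compact_space T"
    and Hausdorff: "Hausdorff_space T"
    and nonneg: "closedin T C \<Longrightarrow> 0 \<le> L C"
    and mono: "closedin T C \<Longrightarrow> closedin T D \<Longrightarrow> C \<subseteq> D \<Longrightarrow> L C \<le> L D"
    and subadditive: "closedin T C \<Longrightarrow> closedin T D \<Longrightarrow> L (C \<union> D) \<le> L C + L D"
    and additive: "closedin T C \<Longrightarrow> closedin T D \<Longrightarrow> C \<inter> D = {} \<Longrightarrow> L (C \<union> D) = L C + L D"
begin

definition inner_content :: "'a set \<Rightarrow> ennreal" where
  "inner_content U = (SUP C\<in>{C. closedin T C \<and> C \<subseteq> U}. ennreal (L C))"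

definition outer_content :: "'a set \<Rightarrow> ennreal" where
  "outer_content A = (INF U\<in>{U. openin T U \<and> A \<subseteq> U}. inner_content U)"

definition induced_measure :: "'a measure" where
  "induced_measure = measure_of (topspace T) {U. openin T U} outer_content"

lemma empty: "L {} = 0"
  using additive[of "{}" "{}"] by simp

lemma inner_content_upper: "closedin T C \<Longrightarrow> C \<subseteq> U \<Longrightarrow> ennreal (L C) \<le> inner_content U"
  unfolding inner_content_def by (rule SUP_upper) simp

lemma inner_content_mono: "U \<subseteq> V \<Longrightarrow> inner_content U \<le> inner_content V"
  unfolding inner_content_def by (rule SUP_subset_mono) auto

lemma inner_content_empty: "inner_content {} = 0"
proof -
  have "{C. closedin T C \<and> C \<subseteq> {}} = {{}}" by auto
  then show ?thesis by (simp add: inner_content_def empty)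
qed

text \<open>By normality a closed subset of \<open>U \<union> V\<close> splits into a closed part in
  \<open>U\<close> and a closed part in \<open>V\<close>: separate \<open>C - V\<close> from
  \<open>C - U\<close> by disjoint open sets and remove each of these from \<open>C\<close>.\<close>

lemma inner_content_Un:
  assumes U: "openin T U" and V: "openin T V"
  shows "inner_content (U \<union> V) \<le> inner_content U + inner_content V"
  unfolding inner_content_def[of "U \<union> V"]
proof (rule SUP_least, clarify)
  fix C assume C: "closedin T C" "C \<subseteq> U \<union> V"
  have "normal_space T"
    using compact Hausdorff compact_Hausdorff_or_regular_imp_normal_space by blast
  moreover have "closedin T (C - V)" "closedin T (C - U)" "disjnt (C - V) (C - U)"
    using C U V by (auto simp: closedin_diff disjnt_def)
  ultimately obtain O1 O2 where O: "openin T O1" "openin T O2" "C - V \<subseteq> O1" "C - U \<subseteq> O2" "disjnt O1 O2"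
    unfolding normal_space_def by meson
  have cl: "closedin T (C - O2)" "closedin T (C - O1)"
    using C O by (auto simp: closedin_diff)
  have "C = (C - O2) \<union> (C - O1)"
    using O by (auto simp: disjnt_def)
  then have "L C \<le> L (C - O2) + L (C - O1)"
    using subadditive[OF cl] by simp
  then have "ennreal (L C) \<le> ennreal (L (C - O2)) + ennreal (L (C - O1))"
    by (metis cl ennreal_leI ennreal_plus nonneg)
  also have "\<dots> \<le> inner_content U + inner_content V"
    using C O cl by (intro add_mono inner_content_upper) auto
  finally show "ennreal (L C) \<le> inner_content U + inner_content V" .
qed

text \<open>Compactness of each closed set below the union turns the countable cover into a finite
  one, for which the binary bound is iterated.\<close>

lemma inner_content_UN:
  fixes U :: "nat \<Rightarrow> 'a set"
  assumes U: "\<And>i. openin T (U i)"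
  shows "inner_content (\<Union>i. U i) \<le> (\<Sum>i. inner_content (U i))"
  unfolding inner_content_def[of "\<Union>i. U i"]
proof (rule SUP_least, clarify)
  fix C assume C: "closedin T C" "C \<subseteq> (\<Union>i. U i)"
  have "compactin T C" using closedin_compact_space C compact by blast
  then obtain F where F: "finite F" "F \<subseteq> range U" "C \<subseteq> \<Union>F"
    using C U unfolding compactin_def by (metis (no_types, lifting) imageE)
  then obtain I where I: "finite I" "F = U ` I"
    using finite_subset_image by metis
  then obtain n where n: "I \<subseteq> {..<n}"
    using finite_nat_iff_bounded by blast
  have fin: "openin T (\<Union>i<n. U i) \<and> inner_content (\<Union>i<n. U i) \<le> (\<Sum>i<n. inner_content (U i))" for n
  proof (induction n)
    case 0 then show ?case by (simp add: inner_content_empty)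
  next
    case (Suc n)
    have "(\<Union>i<Suc n. U i) = (\<Union>i<n. U i) \<union> U n" by (auto simp: lessThan_Suc)
    then show ?case
      using Suc U inner_content_Un[of "\<Union>i<n. U i" "U n"]
      by (auto simp: openin_Un intro: order_trans add_right_mono)
  qed
  have "ennreal (L C) \<le> inner_content (\<Union>i<n. U i)"
    using C F I n by (intro inner_content_upper) fastforce+
  also have "\<dots> \<le> (\<Sum>i<n. inner_content (U i))" using fin by blast
  also have "\<dots> \<le> (\<Sum>i. inner_content (U i))"
    by (rule sum_le_suminf) auto
  finally show "ennreal (L C) \<le> (\<Sum>i. inner_content (U i))" .
qed

lemma outer_content_openin: "openin T U \<Longrightarrow> outer_content U = inner_content U"
  unfolding outer_content_def
  by (rule antisym) (auto intro!: INF_lower INF_greatest inner_content_mono)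

lemma outer_content_mono: "A \<subseteq> B \<Longrightarrow> outer_content A \<le> outer_content B"
  unfolding outer_content_def by (rule INF_superset_mono) auto

lemma inner_content_finite: "inner_content U < \<infinity>"
proof -
  have "inner_content U \<le> ennreal (L (topspace T))"
    unfolding inner_content_def
    by (rule SUP_least) (auto intro!: ennreal_leI mono dest: closedin_subset)
  then show ?thesis by (simp add: le_less_trans)
qed

lemma outer_content_approx:
  assumes "A \<subseteq> topspace T" "e > 0"
  obtains U where "openin T U" "A \<subseteq> U" "inner_content U \<le> outer_content A + ennreal e"
proof -
  have "outer_content A \<le> outer_content (topspace T)"
    using assms(1) by (rule outer_content_mono)
  also have "\<dots> < \<infinity>"
    using inner_content_finite[of "topspace T"] by (simp add: outer_content_openin)
  finally have "outer_content A < outer_content A + ennreal e"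
    using assms(2) by (simp add: ennreal_add_left_cancel_less[of _ 0, simplified])
  then have "\<exists>U\<in>{U. openin T U \<and> A \<subseteq> U}. inner_content U < outer_content A + ennreal e"
    unfolding outer_content_def[of A] INF_less_iff by blast
  then show thesis using that by (auto intro: less_imp_le)
qed

lemma inner_content_approx:
  assumes "openin T U" "e > 0"
  obtains C where "closedin T C" "C \<subseteq> U" "inner_content U \<le> ennreal (L C) + ennreal e"
\<comment> \<open>Truncated subtraction gives nothing strictly below 0; there the empty set is a
  witness.\<close>
proof (cases "inner_content U = 0")
  case True
  then show ?thesis using that[of "{}"] by simp
next
  case False
  have *: "inner_content U < \<infinity>" by (rule inner_content_finite)
  have "inner_content U - ennreal e < inner_content U"
    using False assms(2) * by (intro ennreal_between) (auto simp: zero_less_iff_neq_zero)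
  then obtain C where C: "closedin T C" "C \<subseteq> U" "inner_content U - ennreal e < ennreal (L C)"
    by (subst (asm) (2) inner_content_def) (auto simp: less_SUP_iff)
  then have "inner_content U \<le> ennreal (L C) + ennreal e"
    by (metis add.commute ennreal_minus_le_iff less_imp_le ennreal_neq_top)
  with C that show ?thesis by blast
qed

lemma outer_measure_space_outer_content:
  "outer_measure_space (Pow (topspace T)) outer_content"
  unfolding outer_measure_space_def
proof (intro conjI)
  show "positive (Pow (topspace T)) outer_content"
    by (simp add: positive_def outer_content_openin inner_content_empty)
  show "increasing (Pow (topspace T)) outer_content"
    by (simp add: increasing_def outer_content_mono)
  show "countably_subadditive (Pow (topspace T)) outer_content"
    unfolding countably_subadditive_def
  proof clarify
    fix A :: "nat \<Rightarrow> 'a set"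
    assume A: "range A \<subseteq> Pow (topspace T)"
    show "outer_content (\<Union>i. A i) \<le> (\<Sum>i. outer_content (A i))"
    proof (rule ennreal_le_epsilon)
      fix e :: real assume e: "0 < e"
      have "\<exists>U. openin T U \<and> A n \<subseteq> U \<and> inner_content U \<le> outer_content (A n) + ennreal (e * (1/2)^Suc n)" for n
      proof (rule outer_content_approx[of "A n" "e * (1/2)^Suc n"])
        show "A n \<subseteq> topspace T" using A by auto
      qed (use e in auto)
      then obtain U where U: "\<And>n. openin T (U n)" "\<And>n. A n \<subseteq> U n"
          "\<And>n. inner_content (U n) \<le> outer_content (A n) + ennreal (e * (1/2)^Suc n)"
        by metis
      have "outer_content (\<Union>i. A i) \<le> outer_content (\<Union>i. U i)"
        using U by (intro outer_content_mono) auto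
      also have "\<dots> = inner_content (\<Union>i. U i)"
        using U by (intro outer_content_openin) auto
      also have "\<dots> \<le> (\<Sum>i. inner_content (U i))"
        by (rule inner_content_UN) fact
      also have "\<dots> \<le> (\<Sum>i. outer_content (A i) + ennreal (e * (1/2)^Suc i))"
        using U by (intro suminf_le) auto
      also have "\<dots> = (\<Sum>i. outer_content (A i)) + (\<Sum>i. ennreal (e * (1/2)^Suc i))"
        by (rule suminf_add[symmetric]) auto
      also have "(\<Sum>i. ennreal (e * (1/2)^Suc i)) = ennreal e"
        using e sums_mult[OF power_half_series, of e]
        by (intro suminf_ennreal_eq) (auto simp: mult.assoc)
      finally show "outer_content (\<Union>i. A i) \<le> (\<Sum>i. outer_content (A i)) + ennreal e" .
    qed
  qed
qed

text \<open>Inside an open set containing \<open>A\<close>, exhaust first the part outside the closed set \<open>C\<close> by a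
  closed set, and then the complement of the latter.\<close>

lemma closedin_lambda_system:
  assumes C: "closedin T C"
  shows "C \<in> lambda_system (topspace T) (Pow (topspace T)) outer_content"
proof -
  interpret sigma_algebra "topspace T" "Pow (topspace T)" by (rule sigma_algebra_Pow)
  have "outer_content (A \<inter> C) + outer_content (A - C) = outer_content A" if A: "A \<subseteq> topspace T" for A
  proof (rule antisym)
    show "outer_content (A \<inter> C) + outer_content (A - C) \<le> outer_content A"
      unfolding outer_content_def[of A]
    proof (rule INF_greatest, clarify)
      fix V assume V: "openin T V" "A \<subseteq> V"
      show "outer_content (A \<inter> C) + outer_content (A - C) \<le> inner_content V"
      proof (rule ennreal_le_epsilon)
        fix e :: real assume e: "0 < e"
        have "openin T (V - C)" using V C by auto
        then obtain D where D: "closedin T D" "D \<subseteq> V - C"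
            "inner_content (V - C) \<le> ennreal (L D) + ennreal (e/2)"
          using inner_content_approx[of "V - C" "e/2"] e by auto
        have "openin T (V - D)" using V D by auto
        then obtain E where E: "closedin T E" "E \<subseteq> V - D"
            "inner_content (V - D) \<le> ennreal (L E) + ennreal (e/2)"
          using inner_content_approx[of "V - D" "e/2"] e by auto
        have "outer_content (A \<inter> C) + outer_content (A - C) \<le> outer_content (V - D) + outer_content (V - C)"
          using V D by (intro add_mono outer_content_mono) auto
        also have "\<dots> = inner_content (V - D) + inner_content (V - C)"
          using V C D by (simp add: outer_content_openin openin_diff)
        also have "\<dots> \<le> (ennreal (L E) + ennreal (e/2)) + (ennreal (L D) + ennreal (e/2))"
          by (intro add_mono D E)
        also have "\<dots> = (ennreal (L E) + ennreal (L D)) + (ennreal (e/2) + ennreal (e/2))"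
          by (simp add: algebra_simps)
        also have "ennreal (e/2) + ennreal (e/2) = ennreal e"
          using e by (simp flip: ennreal_plus)
        also have "ennreal (L E) + ennreal (L D) = ennreal (L (E \<union> D))"
          using D E by (subst additive) (auto simp: nonneg)
        also have "\<dots> \<le> inner_content V"
          using D E by (intro inner_content_upper) auto
        finally show "outer_content (A \<inter> C) + outer_content (A - C) \<le> inner_content V + ennreal e"
          by simp
      qed
    qed
    have sub: "subadditive (Pow (topspace T)) outer_content"
      using outer_measure_space_outer_content ring_of_sets.countably_subadditive_subadditive[OF ring_of_sets_axioms]
      unfolding outer_measure_space_def by blast
    have "outer_content ((A \<inter> C) \<union> (A - C)) \<le> outer_content (A \<inter> C) + outer_content (A - C)"
      using A by (intro subadditiveD[OF sub]) auto
    moreover have "(A \<inter> C) \<union> (A - C) = A" by blast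
    ultimately show "outer_content A \<le> outer_content (A \<inter> C) + outer_content (A - C)" by simp
  qed
  then show ?thesis
    using closedin_subset[OF C] by (auto simp: lambda_system_eq)
qed

text \<open>The Caratheodory sigma-algebra contains the closed sets and hence all Borel sets, so the
  outer measure restricts to a measure on these.\<close>

lemma measure_space_outer_content:
  "measure_space (topspace T) (sigma_sets (topspace T) {U. openin T U}) outer_content"
proof -
  interpret sigma_algebra "topspace T" "Pow (topspace T)" by (rule sigma_algebra_Pow)
  let ?L = "lambda_system (topspace T) (Pow (topspace T)) outer_content"
  have ms: "measure_space (topspace T) ?L outer_content"
    by (rule caratheodory_lemma[OF outer_measure_space_outer_content])
  then interpret L: sigma_algebra "topspace T" ?L by (simp add: measure_space_def)
  have "U \<in> ?L" if "openin T U" for U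
  proof -
    have "topspace T - (topspace T - U) \<in> ?L"
      using that by (intro L.compl_sets closedin_lambda_system) auto
    moreover have "topspace T - (topspace T - U) = U"
      using openin_subset[OF that] by blast
    ultimately show ?thesis by simp
  qed
  then have "sigma_sets (topspace T) {U. openin T U} \<subseteq> ?L"
    by (intro L.sigma_sets_subset) auto
  then show ?thesis
    by (intro measure_down[OF ms] sigma_algebra_sigma_sets) (auto dest: openin_subset)
qed

lemma sets_induced_measure: "sets induced_measure = sets (borel_sigma T)"
  and space_induced_measure: "space induced_measure = topspace T"
proof -
  have *: "{U. openin T U} \<subseteq> Pow (topspace T)" by (auto dest: openin_subset)
  show "sets induced_measure = sets (borel_sigma T)" "space induced_measure = topspace T"
    unfolding induced_measure_def borel_sigma_def by (simp_all only: sets_measure_of[OF *] space_measure_of[OF *])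
qed

lemma emeasure_induced_measure:
  assumes "A \<in> sets induced_measure"
  shows "emeasure induced_measure A = outer_content A"
proof -
  have *: "{U. openin T U} \<subseteq> Pow (topspace T)" by (auto dest: openin_subset)
  have "sets induced_measure = sigma_sets (topspace T) {U. openin T U}"
    unfolding induced_measure_def by (rule sets_measure_of[OF *])
  then show ?thesis
    using assms measure_space_outer_content
    by (intro emeasure_measure_of[OF induced_measure_def *]) (simp_all add: measure_space_def)
qed

lemma openin_sets_induced_measure: "openin T U \<Longrightarrow> U \<in> sets induced_measure"
  by (simp add: sets_induced_measure openin_borel_sigma)

lemma closedin_sets_induced_measure: "closedin T C \<Longrightarrow> C \<in> sets induced_measure"
  by (simp add: sets_induced_measure closedin_borel_sigma)

lemma emeasure_induced_measure_space: "emeasure induced_measure (topspace T) = ennreal (L (topspace T))"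
proof -
  have "inner_content (topspace T) \<le> ennreal (L (topspace T))"
    unfolding inner_content_def
    by (rule SUP_least) (auto intro!: ennreal_leI mono dest: closedin_subset)
  moreover have "ennreal (L (topspace T)) \<le> inner_content (topspace T)"
    by (intro inner_content_upper) auto
  ultimately show ?thesis
    by (simp add: emeasure_induced_measure openin_sets_induced_measure outer_content_openin)
qed

lemma outer_regular:
  assumes "A \<in> sets induced_measure"
  shows "emeasure induced_measure A = (INF U\<in>{U. openin T U \<and> A \<subseteq> U}. emeasure induced_measure U)"
  using assms
  by (auto simp: emeasure_induced_measure openin_sets_induced_measure outer_content_openin
      outer_content_def[of A] intro!: INF_cong)

text \<open>A supremum of values of \<open>L\<close> has to be replaced by a supremum of measures.
  Every open set above a closed \<open>C\<close> has inner content at least \<open>L C\<close>, so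
  the measure of \<open>C\<close> is at least \<open>L C\<close>, and this direction
  suffices.\<close>

lemma inner_regular:
  assumes U: "openin T U"
  shows "emeasure induced_measure U = (SUP C\<in>{C. compactin T C \<and> C \<subseteq> U}. emeasure induced_measure C)"
proof (rule antisym)
  have le: "ennreal (L C) \<le> emeasure induced_measure C" if "closedin T C" for C
    using that
    by (auto simp: emeasure_induced_measure closedin_sets_induced_measure outer_content_def
        intro!: INF_greatest inner_content_upper)
  have cc: "compactin T C \<longleftrightarrow> closedin T C" for C
    using compact Hausdorff closedin_compact_space compactin_imp_closedin by blast
  show "emeasure induced_measure U \<le> (SUP C\<in>{C. compactin T C \<and> C \<subseteq> U}. emeasure induced_measure C)"
    unfolding emeasure_induced_measure[OF openin_sets_induced_measure[OF U]]
      outer_content_openin[OF U] inner_content_def cc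
    by (intro SUP_mono) (auto intro: le)
  show "(SUP C\<in>{C. compactin T C \<and> C \<subseteq> U}. emeasure induced_measure C) \<le> emeasure induced_measure U"
    using U by (intro SUP_least emeasure_mono openin_sets_induced_measure) auto
qed

text \<open>The map permutes the closed sets and the open sets, so the supremum and the infimum that
  define the outer measure are merely reindexed.\<close>

lemma homeomorphic_invariant:
  assumes f: "homeomorphic_map T T f" and L: "\<And>C. closedin T C \<Longrightarrow> L (f ` C) = L C"
    and A: "A \<in> sets induced_measure" and fA: "f ` A \<in> sets induced_measure"
  shows "emeasure induced_measure (f ` A) = emeasure induced_measure A"
proof -
  have inj: "inj_on f (topspace T)" and surj: "f ` topspace T = topspace T"
    using f homeomorphic_imp_injective_map homeomorphic_imp_surjective_map by blast+
  have A': "A \<subseteq> topspace T"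
    using sets.sets_into_space[OF A] by (simp add: space_induced_measure)
  have closed_image: "{C. closedin T C \<and> C \<subseteq> f ` U} = (`) f ` {C. closedin T C \<and> C \<subseteq> U}"
    if U: "U \<subseteq> topspace T" for U
  proof (intro equalityI subsetI)
    fix C assume C: "C \<in> {C. closedin T C \<and> C \<subseteq> f ` U}"
    let ?D = "{x \<in> topspace T. f x \<in> C}"
    have "f ` ?D = C" using C U by blast
    moreover have "closedin T ?D"
      using C f closedin_continuous_map_preimage homeomorphic_imp_continuous_map by blast
    moreover have "?D \<subseteq> U"
    proof
      fix x assume x: "x \<in> ?D"
      then obtain u where "u \<in> U" "f x = f u" using C by blast
      with x U inj show "x \<in> U" unfolding inj_on_def by blast
    qed
    ultimately show "C \<in> (`) f ` {C. closedin T C \<and> C \<subseteq> U}" by blast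
  next
    fix D assume "D \<in> (`) f ` {C. closedin T C \<and> C \<subseteq> U}"
    then obtain C where "closedin T C" "C \<subseteq> U" "D = f ` C" by blast
    then show "D \<in> {C. closedin T C \<and> C \<subseteq> f ` U}"
      using homeomorphic_map_closedness_eq[OF f, of C] closedin_subset[of T C] by auto
  qed
  have inner: "inner_content (f ` U) = inner_content U" if "openin T U" for U
    unfolding inner_content_def closed_image[OF openin_subset[OF that]] image_image
    by (rule SUP_cong) (auto simp: L)
  have open_image: "{U. openin T U \<and> f ` A \<subseteq> U} = (`) f ` {U. openin T U \<and> A \<subseteq> U}"
  proof (intro equalityI subsetI)
    fix U assume U: "U \<in> {U. openin T U \<and> f ` A \<subseteq> U}"
    let ?D = "{x \<in> topspace T. f x \<in> U}"
    have "U \<subseteq> f ` topspace T" using U surj openin_subset[of T U] by simp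
    then have "f ` ?D = U" by blast
    moreover have "openin T ?D"
      using U f openin_continuous_map_preimage homeomorphic_imp_continuous_map by blast
    moreover have "A \<subseteq> ?D" using U A' by blast
    ultimately show "U \<in> (`) f ` {U. openin T U \<and> A \<subseteq> U}" by blast
  next
    fix V assume "V \<in> (`) f ` {U. openin T U \<and> A \<subseteq> U}"
    then obtain U where "openin T U" "A \<subseteq> U" "V = f ` U" by blast
    then show "V \<in> {U. openin T U \<and> f ` A \<subseteq> U}"
      using homeomorphic_map_openness_eq[OF f, of U] openin_subset[of T U] by auto
  qed
  show ?thesis
    unfolding emeasure_induced_measure[OF A] emeasure_induced_measure[OF fA]
      outer_content_def open_image image_image
    by (rule INF_cong) (auto simp: inner)
qed

end

section \<open>Isometry-invariant measures on compact metric spaces\<close>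

text \<open>A substitute for a Banach limit. By Tychonoff's theorem the functions \<open>r n\<close>
  have a cluster point in a product of unit intervals; this product need not be sequentially
  compact, so a filter finer than \<open>sequentially\<close> takes the place of a
  subsequence.\<close>

lemma bounded_sequence_cluster_filter:
  fixes r :: "nat \<Rightarrow> 'b \<Rightarrow> real"
  assumes "\<And>n A. 0 \<le> r n A" "\<And>n A. r n A \<le> 1"
  obtains F l where "F \<noteq> bot" "F \<le> sequentially" "\<And>A. ((\<lambda>n. r n A) \<longlongrightarrow> l A) F"
proof -
  have "compactin (product_topology (\<lambda>_. euclidean) UNIV) (PiE UNIV (\<lambda>_::'b. {0..1::real}))"
    by (subst compactin_PiE) auto
  then have "compact (PiE UNIV (\<lambda>_::'b. {0..1::real}))"
    by (simp add: euclidean_product_topology)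
  moreover have "eventually (\<lambda>f. f \<in> PiE UNIV (\<lambda>_. {0..1})) (filtermap r sequentially)"
    using assms by (simp add: eventually_filtermap PiE_iff)
  ultimately obtain l where l: "inf (nhds l) (filtermap r sequentially) \<noteq> bot"
    unfolding compact_filter by (metis filtermap_bot_iff sequentially_bot)
  \<comment> \<open>Large indices \<open>n\<close> at which \<open>r n\<close> is close to the
    cluster point; that there are always such indices is the properness of this filter.\<close>
  define F where "F = inf (filtercomap r (nhds l)) sequentially"
  have "F \<noteq> bot"
  proof
    assume "F = bot"
    then have "eventually (\<lambda>_. False) F" by simp
    then obtain P Q where P: "eventually P (nhds l)" and Q: "eventually Q sequentially"
      and PQ: "\<And>n. P (r n) \<Longrightarrow> Q n \<Longrightarrow> False"
      unfolding F_def eventually_inf eventually_filtercomap by metis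
    have "eventually (\<lambda>y. \<not> P y) (filtermap r sequentially)"
      unfolding eventually_filtermap using Q by (rule eventually_mono) (use PQ in blast)
    with P have "eventually (\<lambda>_. False) (inf (nhds l) (filtermap r sequentially))"
      unfolding eventually_inf by blast
    with l show False by (simp add: trivial_limit_def)
  qed
  moreover have "F \<le> sequentially" by (simp add: F_def)
  moreover have "((\<lambda>n. r n A) \<longlongrightarrow> l A) F" for A
  proof -
    have "(r \<longlongrightarrow> l) F"
      unfolding F_def filterlim_def by (rule order_trans[OF filtermap_mono[OF inf_le1]]) (rule filtermap_filtercomap)
    then show ?thesis
      by (rule continuous_on_tendsto_compose[OF continuous_on_product_coordinates]) simp_all
  qed
  ultimately show thesis using that by blast
qed

section \<open>Covering numbers and their limits\<close>

context Metric_space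
begin

definition covering_number :: "real \<Rightarrow> 'a set \<Rightarrow> nat" where
  "covering_number e A = Inf {card F |F. finite F \<and> F \<subseteq> M \<and> A \<subseteq> (\<Union>x\<in>F. mball x e)}"

lemma covering_number_le:
  "finite F \<Longrightarrow> F \<subseteq> M \<Longrightarrow> A \<subseteq> (\<Union>x\<in>F. mball x e) \<Longrightarrow> covering_number e A \<le> card F"
  unfolding covering_number_def by (intro wellorder_Inf_le1) blast

lemma covering_number_witness:
  assumes "mtotally_bounded M" "e > 0" "A \<subseteq> M"
  obtains F where "finite F" "F \<subseteq> M" "A \<subseteq> (\<Union>x\<in>F. mball x e)" "card F = covering_number e A"
proof -
  let ?S = "{card F |F. finite F \<and> F \<subseteq> M \<and> A \<subseteq> (\<Union>x\<in>F. mball x e)}"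
  obtain K where "finite K" "K \<subseteq> M" "M \<subseteq> (\<Union>x\<in>K. mball x e)"
    using assms(1,2) unfolding mtotally_bounded_def by metis
  then have "card K \<in> ?S" using assms(3) by (intro CollectI exI[of _ K]) simp
  then have "?S \<noteq> {}" by (metis empty_iff)
  then have "covering_number e A \<in> ?S" unfolding covering_number_def by (rule Inf_nat_def1)
  then show thesis using that by (elim CollectE exE conjE) metis
qed

lemma covering_number_mono:
  assumes "mtotally_bounded M" "e > 0" "A \<subseteq> B" "B \<subseteq> M"
  shows "covering_number e A \<le> covering_number e B"
proof -
  obtain F where "finite F" "F \<subseteq> M" "B \<subseteq> (\<Union>x\<in>F. mball x e)" "card F = covering_number e B"
    by (rule covering_number_witness[OF assms(1,2,4)])
  then show ?thesis using covering_number_le[of F A e] subset_trans[OF assms(3)] by simp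
qed

lemma covering_number_Un:
  assumes "mtotally_bounded M" "e > 0" "A \<subseteq> M" "B \<subseteq> M"
  shows "covering_number e (A \<union> B) \<le> covering_number e A + covering_number e B"
proof -
  obtain F where F: "finite F" "F \<subseteq> M" "A \<subseteq> (\<Union>x\<in>F. mball x e)" "card F = covering_number e A"
    by (rule covering_number_witness[OF assms(1-3)])
  obtain G where G: "finite G" "G \<subseteq> M" "B \<subseteq> (\<Union>x\<in>G. mball x e)" "card G = covering_number e B"
    by (rule covering_number_witness[OF assms(1,2,4)])
  have "covering_number e (A \<union> B) \<le> card (F \<union> G)"
  proof (rule covering_number_le)
    show "A \<union> B \<subseteq> (\<Union>x\<in>F \<union> G. mball x e)"
      unfolding UN_Un using F(3) G(3) by (rule Un_mono)
  qed (simp_all add: F G)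
  also have "\<dots> \<le> card F + card G" by (rule card_Un_le)
  finally show ?thesis using F G by simp
qed

text \<open>From a smallest cover of the union, extract the balls that meet \<open>A\<close> and
  those that meet \<open>B\<close>; by the separation hypothesis no ball is counted twice.\<close>

lemma covering_number_Un_separated:
  assumes "mtotally_bounded M" "e > 0" "A \<subseteq> M" "B \<subseteq> M"
    and sep: "\<And>x. x \<in> M \<Longrightarrow> mball x e \<inter> A = {} \<or> mball x e \<inter> B = {}"
  shows "covering_number e (A \<union> B) = covering_number e A + covering_number e B"
proof (rule antisym)
  obtain F where F: "finite F" "F \<subseteq> M" "A \<union> B \<subseteq> (\<Union>x\<in>F. mball x e)" "card F = covering_number e (A \<union> B)"
    by (rule covering_number_witness[OF assms(1,2) Un_least[OF assms(3,4)]])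
  let ?FA = "{x \<in> F. mball x e \<inter> A \<noteq> {}}" and ?FB = "{x \<in> F. mball x e \<inter> B \<noteq> {}}"
  have cover: "A \<subseteq> (\<Union>x\<in>?FA. mball x e)" "B \<subseteq> (\<Union>x\<in>?FB. mball x e)"
    using F(3) by fastforce+
  have "covering_number e A \<le> card ?FA" "covering_number e B \<le> card ?FB"
    by (rule covering_number_le; use F(1,2) cover in auto)+
  then have "covering_number e A + covering_number e B \<le> card ?FA + card ?FB" by simp
  also have "\<dots> = card (?FA \<union> ?FB)"
    using F sep by (intro card_Un_disjoint[symmetric]) auto
  also have "\<dots> \<le> card F"
    using F by (intro card_mono) auto
  finally show "covering_number e A + covering_number e B \<le> covering_number e (A \<union> B)"
    using F by simp
qed (rule covering_number_Un[OF assms(1-4)])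

lemma covering_number_isometry_le:
  assumes "mtotally_bounded M" "e > 0" "A \<subseteq> M"
    and f: "f ` M \<subseteq> M" "\<And>x y. x \<in> M \<Longrightarrow> y \<in> M \<Longrightarrow> d (f x) (f y) = d x y"
  shows "covering_number e (f ` A) \<le> covering_number e A"
proof -
  obtain F where F: "finite F" "F \<subseteq> M" "A \<subseteq> (\<Union>x\<in>F. mball x e)" "card F = covering_number e A"
    by (rule covering_number_witness[OF assms(1-3)])
  have "covering_number e (f ` A) \<le> card (f ` F)"
  proof (rule covering_number_le)
    show "f ` A \<subseteq> (\<Union>x\<in>f ` F. mball x e)"
    proof clarify
      fix a assume "a \<in> A"
      then obtain x where "x \<in> F" "a \<in> mball x e" using F by blast
      then have "f a \<in> mball (f x) e" using f by auto
      with \<open>x \<in> F\<close> show "f a \<in> (\<Union>x\<in>f ` F. mball x e)" by blast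
    qed
  qed (use F f in auto)
  also have "\<dots> \<le> card F" using F by (intro card_image_le)
  finally show ?thesis using F by simp
qed

lemma isometry_inv_into:
  assumes "f ` M = M" "\<And>x y. x \<in> M \<Longrightarrow> y \<in> M \<Longrightarrow> d (f x) (f y) = d x y" "x \<in> M" "y \<in> M"
  shows "d (inv_into M f x) (inv_into M f y) = d x y"
  using assms(1,3,4) assms(2)[OF inv_into_into[of x f M] inv_into_into[of y f M]]
  by (simp add: f_inv_into_f)

text \<open>The inequality for images is applied to \<open>f\<close> and to its inverse.\<close>

lemma covering_number_isometry:
  assumes "mtotally_bounded M" "e > 0" "A \<subseteq> M"
    and f: "bij_betw f M M" "\<And>x y. x \<in> M \<Longrightarrow> y \<in> M \<Longrightarrow> d (f x) (f y) = d x y"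
  shows "covering_number e (f ` A) = covering_number e A"
proof (rule antisym)
  let ?g = "inv_into M f"
  have fM: "f ` M = M" using f(1) by (simp add: bij_betw_def)
  have g: "?g ` M \<subseteq> M" "\<And>x y. x \<in> M \<Longrightarrow> y \<in> M \<Longrightarrow> d (?g x) (?g y) = d x y"
    by (auto simp: inv_into_into fM intro!: isometry_inv_into[OF fM] f(2))
  have "?g ` f ` A = A"
    using assms(3) f(1) by (force simp: bij_betw_def image_image inv_into_f_f)
  moreover have "covering_number e (?g ` f ` A) \<le> covering_number e (f ` A)"
    using assms(1-3) fM g by (intro covering_number_isometry_le) auto
  ultimately show "covering_number e A \<le> covering_number e (f ` A)" by simp
  show "covering_number e (f ` A) \<le> covering_number e A"
    using assms(1-3) fM f(2) by (intro covering_number_isometry_le) auto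
qed

text \<open>\<open>e\<close> is a Lebesgue number of the open cover formed by the two
  complements.\<close>

lemma closedin_disjoint_separated:
  assumes M: "compact_space mtopology"
    and A: "closedin mtopology A" and B: "closedin mtopology B" and AB: "A \<inter> B = {}"
  obtains e where "e > 0" "\<And>x. x \<in> M \<Longrightarrow> mball x e \<inter> A = {} \<or> mball x e \<inter> B = {}"
proof -
  have "compactin mtopology M" using M by (simp add: compact_space_def)
  moreover have "\<And>U. U \<in> {M - A, M - B} \<Longrightarrow> openin mtopology U"
    using A B by (auto simp: closedin_def)
  moreover have "M \<subseteq> \<Union>{M - A, M - B}" using AB by auto
  ultimately obtain e where e: "e > 0" "\<forall>x\<in>M. \<exists>U\<in>{M - A, M - B}. mball x e \<subseteq> U"
    using lebesgue_number[of M "{M - A, M - B}"] by metis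
  show thesis
  proof (rule that[OF e(1)])
    fix x assume "x \<in> M"
    then show "mball x e \<inter> A = {} \<or> mball x e \<inter> B = {}" using e(2) by blast
  qed
qed

text \<open>The measure comes from a cluster point of the normalised covering numbers, which are
  subadditive, invariant, and additive on sets that no ball of the given radius meets both.\<close>

theorem invariant_probability_exists:
  assumes cpt: "compact_space mtopology" and ne: "M \<noteq> {}"
  obtains h where "sets h = sets (borel_sigma mtopology)" "prob_space h"
    "\<And>f A. bij_betw f M M \<Longrightarrow> (\<And>x y. x \<in> M \<Longrightarrow> y \<in> M \<Longrightarrow> d (f x) (f y) = d x y) \<Longrightarrow> A \<in> sets h \<Longrightarrow>
       f ` A \<in> sets h \<and> emeasure h (f ` A) = emeasure h A"
    "\<And>A. A \<in> sets h \<Longrightarrow> emeasure h A = (INF U\<in>{U. openin mtopology U \<and> A \<subseteq> U}. emeasure h U)"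
    "\<And>U. openin mtopology U \<Longrightarrow>
       emeasure h U = (SUP C\<in>{C. compactin mtopology C \<and> C \<subseteq> U}. emeasure h C)"
proof -
  have tb: "mtotally_bounded M"
    using cpt compact_space_eq_mcomplete_mtotally_bounded by blast
  define e where "e n = 1 / real (Suc n)" for n
  have e: "e n > 0" for n by (simp add: e_def)
  \<comment> \<open>Intersecting with \<open>M\<close> keeps the ratio between 0 and 1 for every set
    \<open>A\<close> of the type, as the choice of the cluster filter requires.\<close>
  define r where "r n A = real (covering_number (e n) (A \<inter> M)) / real (covering_number (e n) M)" for n A
  have pos: "covering_number (e n) M > 0" for n
  proof -
    obtain F where F: "finite F" "M \<subseteq> (\<Union>x\<in>F. mball x (e n))" "card F = covering_number (e n) M"
      by (rule covering_number_witness[OF tb e order_refl])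
    then have "F \<noteq> {}" using ne by auto
    with F show ?thesis by (metis card_gt_0_iff)
  qed
  have r01: "0 \<le> r n A" "r n A \<le> 1" for n A
    using covering_number_mono[OF tb e[of n], of "A \<inter> M" M] pos[of n] by (auto simp: r_def)
  obtain F L where F: "F \<noteq> bot" "F \<le> sequentially" and L: "\<And>A. ((\<lambda>n. r n A) \<longlongrightarrow> L A) F"
    using bounded_sequence_cluster_filter[of r] r01 by metis
  have cM: "closedin mtopology C \<Longrightarrow> C \<subseteq> M" for C
    using closedin_subset by fastforce
  interpret compact_content mtopology L
  proof
    fix C D assume C: "closedin mtopology C"
    show "0 \<le> L C"
      by (rule tendsto_lowerbound[OF L _ F(1)]) (simp add: r01)
    assume D: "closedin mtopology D"
    show "L C \<le> L D" if "C \<subseteq> D"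
    proof (rule tendsto_le[OF F(1) L L])
      have "covering_number (e n) (C \<inter> M) \<le> covering_number (e n) (D \<inter> M)" for n
        using that by (intro covering_number_mono tb e) auto
      then show "\<forall>\<^sub>F n in F. r n C \<le> r n D"
        by (auto simp: r_def divide_right_mono)
    qed
    show "L (C \<union> D) \<le> L C + L D"
    proof (rule tendsto_le[OF F(1) tendsto_add[OF L L] L])
      have "covering_number (e n) ((C \<union> D) \<inter> M) \<le> covering_number (e n) (C \<inter> M) + covering_number (e n) (D \<inter> M)" for n
        unfolding Int_Un_distrib2 by (intro covering_number_Un tb e) auto
      then show "\<forall>\<^sub>F n in F. r n (C \<union> D) \<le> r n C + r n D"
        unfolding r_def add_divide_distrib[symmetric] of_nat_add[symmetric]
        by (intro always_eventually allI divide_right_mono) (simp_all only: of_nat_le_iff of_nat_0_le_iff)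
    qed
    assume CD: "C \<inter> D = {}"
    \<comment> \<open>Once the radius is below \<open>c\<close>, no ball meets both sets and the
      covering numbers are exactly additive; along \<open>F\<close>, which refines
      \<open>sequentially\<close>, this passes to the limit.\<close>
    obtain c where c: "c > 0" "\<And>x. x \<in> M \<Longrightarrow> mball x c \<inter> C = {} \<or> mball x c \<inter> D = {}"
      using closedin_disjoint_separated[OF cpt C D CD] by blast
    have "(\<lambda>n. 1 / real (Suc n)) \<longlonglongrightarrow> 0"
      by (rule LIMSEQ_inverse_real_of_nat[unfolded inverse_eq_divide])
    then have "\<forall>\<^sub>F n in sequentially. e n < c"
      using order_tendstoD(2)[OF _ c(1)] unfolding e_def by blast
    then have "\<forall>\<^sub>F n in sequentially. r n (C \<union> D) = r n C + r n D"
    proof (rule eventually_mono)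
      fix n assume n: "e n < c"
      have "mball x (e n) \<subseteq> mball x c" for x using n by auto
      then have "mball x (e n) \<inter> (C \<inter> M) = {} \<or> mball x (e n) \<inter> (D \<inter> M) = {}" if "x \<in> M" for x
        using c(2)[OF that] by blast
      then have "covering_number (e n) ((C \<union> D) \<inter> M) = covering_number (e n) (C \<inter> M) + covering_number (e n) (D \<inter> M)"
        unfolding Int_Un_distrib2 by (intro covering_number_Un_separated tb e) auto
      then show "r n (C \<union> D) = r n C + r n D"
        unfolding r_def by (simp add: add_divide_distrib)
    qed
    then have "\<forall>\<^sub>F n in F. r n C + r n D = r n (C \<union> D)"
      using filter_leD[OF F(2)] by (simp add: eq_commute)
    then have "((\<lambda>n. r n (C \<union> D)) \<longlongrightarrow> L C + L D) F"
      using tendsto_add[OF L L] by (rule Lim_transform_eventually[rotated])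
    then show "L (C \<union> D) = L C + L D"
      using tendsto_unique[OF F(1)] L by blast
  qed (use cpt Hausdorff_space_mtopology in auto)
  have LM: "L M = 1"
  proof -
    have "r n M = 1" for n using pos[of n] by (simp add: r_def)
    then show ?thesis using L[of M] F(1) by (simp add: tendsto_const_iff)
  qed
  show thesis
  proof (rule that[of induced_measure])
    show "prob_space induced_measure"
      using emeasure_induced_measure_space LM
      by (intro prob_spaceI) (simp add: space_induced_measure)
    fix f A
    assume f: "bij_betw f M M" "\<And>x y. x \<in> M \<Longrightarrow> y \<in> M \<Longrightarrow> d (f x) (f y) = d x y"
      and A: "A \<in> sets induced_measure"
    \<comment> \<open>Stated for any surjective isometry, since it is applied to \<open>f\<close>
      and to its inverse.\<close>
    have isom: "homeomorphic_map mtopology mtopology g"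
      if "g ` M = M" "\<And>x y. x \<in> M \<Longrightarrow> y \<in> M \<Longrightarrow> d (g x) (g y) = d x y" for g
      by (rule Metric_space12.isometry_imp_homeomorphic_map)
        (use that in \<open>auto simp: Metric_space12_def Metric_space_axioms\<close>)
    have fh: "homeomorphic_map mtopology mtopology f"
      using f by (intro isom) (auto simp: bij_betw_def)
    let ?g = "inv_into M f"
    have "bij_betw ?g M M" using f(1) by (rule bij_betw_inv_into)
    moreover have "d (?g x) (?g y) = d x y" if "x \<in> M" "y \<in> M" for x y
      using f that by (intro isometry_inv_into) (auto simp: bij_betw_def)
    ultimately have g: "continuous_map mtopology mtopology ?g"
      by (intro homeomorphic_imp_continuous_map isom) (auto simp: bij_betw_def)
    \<comment> \<open>As a preimage under the continuous inverse, the image of a Borel set is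
      Borel.\<close>
    have "f ` A = ?g -` A \<inter> space (borel_sigma mtopology)"
    proof -
      have "A \<subseteq> M" using sets.sets_into_space[OF A] by (simp add: space_induced_measure)
      then show ?thesis
        using f(1) by (force simp: space_borel_sigma bij_betw_def f_inv_into_f inv_into_f_f)
    qed
    then have fA: "f ` A \<in> sets induced_measure"
      using measurable_sets[OF measurable_borel_sigma_continuous_map[OF g]] A
      by (simp add: sets_induced_measure)
    show "f ` A \<in> sets induced_measure \<and> emeasure induced_measure (f ` A) = emeasure induced_measure A"
    proof
      show "emeasure induced_measure (f ` A) = emeasure induced_measure A"
      proof (rule homeomorphic_invariant[OF fh _ A fA])
        fix C assume "closedin mtopology C"
        then have C: "C \<subseteq> M" by (rule cM)
        then have "f ` C \<inter> M = f ` C" "C \<inter> M = C" using f(1) by (auto simp: bij_betw_def)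
        then have "r n (f ` C) = r n C" for n
          using covering_number_isometry[OF tb e C f] by (simp add: r_def)
        then show "L (f ` C) = L C"
          using tendsto_unique[OF F(1)] L[of C] L[of "f ` C"] by simp
      qed
    qed fact
  qed (use sets_induced_measure outer_regular inner_regular in auto)
qed

end

section \<open>Measure-preserving isometries\<close>

lemma mm_spaceD:
  fixes \<mu> :: "'a::polish_space measure"
  assumes "mm_space UNIV dist \<mu>"
  shows "sets \<mu> = sets borel" "prob_space \<mu>" "\<And>U. open U \<Longrightarrow> U \<noteq> {} \<Longrightarrow> emeasure \<mu> U > 0"
  using assms by (auto simp: mm_space_def borel_sigma_euclidean)

lemma isometry_continuous:
  fixes g :: "'a::metric_space \<Rightarrow> 'b::metric_space"
  assumes "\<And>x y. dist (g x) (g y) = dist x y"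
  shows "continuous_on A g"
  using assms by (auto simp: continuous_on_iff)

lemma isometry_inj:
  fixes g :: "'a::metric_space \<Rightarrow> 'b::metric_space"
  assumes "\<And>x y. dist (g x) (g y) = dist x y"
  shows "inj g"
proof (rule injI)
  fix x y assume "g x = g y"
  then have "dist x y = 0" using assms[of x y] by simp
  then show "x = y" by simp
qed

text \<open>An isometry is injective and continuous, so of the bijectivity and measurability
  demanded by \<open>Isomp\<close> only surjectivity remains to be checked.\<close>

lemma carrier_Isomp_iff:
  fixes \<mu> :: "'a::polish_space measure"
  assumes "sets \<mu> = sets borel"
  shows "g \<in> carrier (Isomp \<mu>) \<longleftrightarrow> surj g \<and> (\<forall>x y. dist (g x) (g y) = dist x y) \<and> distr \<mu> \<mu> g = \<mu>"
proof -
  have "g \<in> measurable \<mu> \<mu>" if "\<forall>x y. dist (g x) (g y) = dist x y"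
  proof -
    have "g \<in> borel_measurable borel"
      using that by (intro borel_measurable_continuous_onI isometry_continuous) simp
    then show ?thesis by (simp cong: measurable_cong_sets add: assms)
  qed
  moreover have "inj g" if "\<forall>x y. dist (g x) (g y) = dist x y"
    using that by (intro isometry_inj) simp
  ultimately show ?thesis
    by (auto simp: Isomp_def Bij_def bij_betw_def extensional_def)
qed

lemma measurable_Isomp:
  "g \<in> carrier (Isomp \<mu>) \<Longrightarrow> g \<in> measurable \<mu> \<mu>"
  by (simp add: Isomp_def)

lemma mult_Isomp:
  assumes "g \<in> carrier (Isomp \<mu>)" "h \<in> carrier (Isomp \<mu>)"
  shows "g \<otimes>\<^bsub>Isomp \<mu>\<^esub> h = g \<circ> h"
  using assms by (auto simp: Isomp_def BijGroup_def compose_def fun_eq_iff)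

lemma one_Isomp: "\<one>\<^bsub>Isomp \<mu>\<^esub> = id"
  by (auto simp: Isomp_def BijGroup_def fun_eq_iff)

lemma inv_Isomp_mem:
  fixes \<mu> :: "'a::polish_space measure"
  assumes \<mu>: "sets \<mu> = sets borel" and g: "g \<in> carrier (Isomp \<mu>)"
  shows "inv_into UNIV g \<in> carrier (Isomp \<mu>)"
proof -
  have g': "surj g" "\<And>x y. dist (g x) (g y) = dist x y" "distr \<mu> \<mu> g = \<mu>" "g \<in> measurable \<mu> \<mu>"
    using g measurable_Isomp[OF g] by (simp_all add: carrier_Isomp_iff[OF \<mu>])
  have "inj g" by (rule isometry_inj) fact
  have dist_inv: "dist (inv_into UNIV g x) (inv_into UNIV g y) = dist x y" for x y
    using g'(2)[of "inv_into UNIV g x" "inv_into UNIV g y"] g'(1) by (simp add: surj_f_inv_f)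
  have "inv_into UNIV g \<in> borel_measurable borel"
    by (intro borel_measurable_continuous_onI isometry_continuous) fact
  then have m: "inv_into UNIV g \<in> measurable \<mu> \<mu>" by (simp cong: measurable_cong_sets add: \<mu>)
  have "distr \<mu> \<mu> (inv_into UNIV g) = distr (distr \<mu> \<mu> g) \<mu> (inv_into UNIV g)" by (simp add: g')
  also have "\<dots> = distr \<mu> \<mu> (inv_into UNIV g \<circ> g)" by (rule distr_distr[OF m g'(4)])
  also have "inv_into UNIV g \<circ> g = id" using \<open>inj g\<close> by simp
  finally have "distr \<mu> \<mu> (inv_into UNIV g) = \<mu>" by (simp add: id_def distr_id)
  moreover have "surj (inv_into UNIV g)" using \<open>inj g\<close> by (rule inj_imp_surj_inv)
  ultimately show ?thesis using dist_inv by (simp add: carrier_Isomp_iff[OF \<mu>])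
qed

lemma comp_Isomp_mem:
  fixes \<mu> :: "'a::polish_space measure"
  assumes \<mu>: "sets \<mu> = sets borel" and gh: "g \<in> carrier (Isomp \<mu>)" "h \<in> carrier (Isomp \<mu>)"
  shows "g \<circ> h \<in> carrier (Isomp \<mu>)"
proof -
  have "distr \<mu> \<mu> (g \<circ> h) = distr (distr \<mu> \<mu> h) \<mu> g"
    using gh by (intro distr_distr[symmetric] measurable_Isomp)
  moreover have "surj (g \<circ> h)"
    using gh by (intro comp_surj) (simp_all add: carrier_Isomp_iff[OF \<mu>])
  ultimately show ?thesis
    using gh by (simp add: carrier_Isomp_iff[OF \<mu>])
qed

lemma group_Isomp:
  fixes \<mu> :: "'a::polish_space measure"
  assumes \<mu>: "sets \<mu> = sets borel"
  shows "group (Isomp \<mu>)"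
proof (rule groupI)
  fix g h assume gh: "g \<in> carrier (Isomp \<mu>)" "h \<in> carrier (Isomp \<mu>)"
  then show "g \<otimes>\<^bsub>Isomp \<mu>\<^esub> h \<in> carrier (Isomp \<mu>)"
    by (simp add: mult_Isomp comp_Isomp_mem[OF \<mu>])
  fix k assume k: "k \<in> carrier (Isomp \<mu>)"
  then show "g \<otimes>\<^bsub>Isomp \<mu>\<^esub> h \<otimes>\<^bsub>Isomp \<mu>\<^esub> k = g \<otimes>\<^bsub>Isomp \<mu>\<^esub> (h \<otimes>\<^bsub>Isomp \<mu>\<^esub> k)"
    using gh by (simp add: mult_Isomp comp_Isomp_mem[OF \<mu>] comp_assoc)
next
  have "distr \<mu> \<mu> id = \<mu>" by (simp add: id_def distr_id)
  then show one: "\<one>\<^bsub>Isomp \<mu>\<^esub> \<in> carrier (Isomp \<mu>)"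
    unfolding one_Isomp by (simp add: carrier_Isomp_iff[OF \<mu>])
  fix g assume g: "g \<in> carrier (Isomp \<mu>)"
  then show "\<one>\<^bsub>Isomp \<mu>\<^esub> \<otimes>\<^bsub>Isomp \<mu>\<^esub> g = g"
    using one by (simp add: mult_Isomp) (simp add: one_Isomp)
  have "inj g" using g by (intro isometry_inj) (simp add: carrier_Isomp_iff[OF \<mu>])
  then show "\<exists>h\<in>carrier (Isomp \<mu>). h \<otimes>\<^bsub>Isomp \<mu>\<^esub> g = \<one>\<^bsub>Isomp \<mu>\<^esub>"
    using inv_Isomp_mem[OF \<mu> g] g by (intro bexI[of _ "inv_into UNIV g"]) (simp_all add: mult_Isomp one_Isomp)
qed

lemma inv_Isomp:
  fixes \<mu> :: "'a::polish_space measure"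
  assumes \<mu>: "sets \<mu> = sets borel" and g: "g \<in> carrier (Isomp \<mu>)"
  shows "inv\<^bsub>Isomp \<mu>\<^esub> g = inv_into UNIV g"
proof -
  have "inj g" using g by (intro isometry_inj) (simp add: carrier_Isomp_iff[OF \<mu>])
  then have "inv_into UNIV g \<otimes>\<^bsub>Isomp \<mu>\<^esub> g = \<one>\<^bsub>Isomp \<mu>\<^esub>"
    using g inv_Isomp_mem[OF \<mu> g] by (simp add: mult_Isomp one_Isomp)
  then show ?thesis
    using group.inv_equality[OF group_Isomp[OF \<mu>]] g inv_Isomp_mem[OF \<mu> g] by blast
qed

lemma transitive_action_Isomp_iff:
  fixes \<mu> :: "'a::polish_space measure"
  assumes \<mu>: "sets \<mu> = sets borel"
  shows "transitive_action (Isomp \<mu>) UNIV (\<lambda>g. g) \<longleftrightarrow> (\<forall>x y. \<exists>g\<in>carrier (Isomp \<mu>). g x = y)"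
proof -
  have "(\<lambda>g. g) \<in> hom (Isomp \<mu>) (BijGroup UNIV)"
    by (auto simp: hom_def Isomp_def BijGroup_def)
  then have "group_action (Isomp \<mu>) UNIV (\<lambda>g. g)"
    using group_Isomp[OF \<mu>] group_BijGroup
    by (simp add: group_action_def group_hom_def group_hom_axioms_def)
  then show ?thesis by (simp add: transitive_action_def transitive_action_axioms_def)
qed

text \<open>Left translation by a group element that moves the coset of \<open>x\<close> to that of
  \<open>y\<close>, carried back along the isometry \<open>f\<close>, is the required
  isomorphism.\<close>

lemma compact_group_quotient_imp_transitive:
  fixes \<mu> :: "'a::polish_space measure"
  assumes mm: "mm_space UNIV dist \<mu>"
    and cgq: "compact_group_quotient TYPE('g) UNIV dist \<mu>"
  shows "\<exists>i\<in>carrier (Isomp \<mu>). i x = y"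
proof -
  have \<mu>: "sets \<mu> = sets borel" using mm by (rule mm_spaceD)
  from cgq obtain G :: "'g monoid" and T K h \<delta> where
      G: "compact_topological_group G T" and K: "subgroup K G"
      and haar: "haar_probability G T h" and met: "Metric_space (lcosets\<^bsub>G\<^esub> K) \<delta>"
      and inv: "\<And>g g1 g2. g \<in> carrier G \<Longrightarrow> g1 \<in> carrier G \<Longrightarrow> g2 \<in> carrier G \<Longrightarrow>
         \<delta> ((g \<otimes>\<^bsub>G\<^esub> g1) <#\<^bsub>G\<^esub> K) ((g \<otimes>\<^bsub>G\<^esub> g2) <#\<^bsub>G\<^esub> K) = \<delta> (g1 <#\<^bsub>G\<^esub> K) (g2 <#\<^bsub>G\<^esub> K)"
      and meas: "(\<lambda>g. g <#\<^bsub>G\<^esub> K) \<in> measurable h (borel_sigma (Metric_space.mtopology (lcosets\<^bsub>G\<^esub> K) \<delta>))"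
      and isom: "mm_isometric UNIV dist \<mu> (lcosets\<^bsub>G\<^esub> K) \<delta>
          (distr h (borel_sigma (Metric_space.mtopology (lcosets\<^bsub>G\<^esub> K) \<delta>)) (\<lambda>g. g <#\<^bsub>G\<^esub> K))"
    unfolding compact_group_quotient_def Let_def by blast
  interpret group G using G by (simp add: compact_topological_group_def)
  interpret N: Metric_space "lcosets\<^bsub>G\<^esub> K" \<delta> by (rule met)
  define B where "B = borel_sigma N.mtopology"
  define \<pi> where "\<pi> = (\<lambda>g. g <#\<^bsub>G\<^esub> K)"
  define \<nu> where "\<nu> = distr h B \<pi>"
  have spB: "space B = lcosets\<^bsub>G\<^esub> K" by (simp add: B_def space_borel_sigma)
  have sets\<nu>: "sets \<nu> = sets B" by (simp add: \<nu>_def)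
  have \<pi>: "\<pi> \<in> measurable h B" using meas by (simp add: \<pi>_def B_def)
  have sph: "space h = carrier G"
    using haar G sets_eq_imp_space_eq[of h "borel_sigma T"]
    by (simp add: haar_probability_def compact_topological_group_def space_borel_sigma)
  have N: "lcosets\<^bsub>G\<^esub> K = \<pi> ` carrier G" by (auto simp: LCOSETS_def \<pi>_def)
  obtain f where f: "bij_betw f UNIV (lcosets\<^bsub>G\<^esub> K)" "\<And>x y. \<delta> (f x) (f y) = dist x y"
      "f \<in> measurable \<mu> \<nu>" "distr \<mu> \<nu> f = \<nu>"
    using isom unfolding mm_isometric_def \<nu>_def B_def \<pi>_def by auto
  have fN: "f x \<in> lcosets\<^bsub>G\<^esub> K" for x using f(1) by (auto simp: bij_betw_def)
  have injf: "inj f" and rf: "range f = lcosets\<^bsub>G\<^esub> K" using f(1) by (auto simp: bij_betw_def)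
  obtain g1 g2 where g12: "g1 \<in> carrier G" "g2 \<in> carrier G" "f x = \<pi> g1" "f y = \<pi> g2"
    using fN[of x] fN[of y] unfolding N by blast
  define g where "g = g2 \<otimes>\<^bsub>G\<^esub> inv\<^bsub>G\<^esub> g1"
  have g: "g \<in> carrier G" "g \<otimes>\<^bsub>G\<^esub> g1 = g2" using g12 by (auto simp: g_def m_assoc)
  define L where "L = (\<lambda>k C. k <#\<^bsub>G\<^esub> C)"
  have KG: "K \<subseteq> carrier G" using K by (rule subgroup.subset)
  have L\<pi>: "L k (\<pi> k') = \<pi> (k \<otimes>\<^bsub>G\<^esub> k')" if "k \<in> carrier G" "k' \<in> carrier G" for k k'
    using that KG by (simp add: L_def \<pi>_def lcos_m_assoc)
  have LN: "L k C \<in> lcosets\<^bsub>G\<^esub> K" if "k \<in> carrier G" "C \<in> lcosets\<^bsub>G\<^esub> K" for k C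
    using that unfolding N by (auto simp: L\<pi>)
  have L\<delta>: "\<delta> (L k C) (L k D) = \<delta> C D" if "k \<in> carrier G" "C \<in> lcosets\<^bsub>G\<^esub> K" "D \<in> lcosets\<^bsub>G\<^esub> K" for k C D
    using that inv unfolding N by (auto simp: L\<pi>) (simp add: \<pi>_def)
  have Linv: "L (inv\<^bsub>G\<^esub> k) (L k C) = C" "L k (L (inv\<^bsub>G\<^esub> k) C) = C" if "k \<in> carrier G" "C \<in> lcosets\<^bsub>G\<^esub> K" for k C
    using that unfolding N by (auto simp: L\<pi> m_assoc[symmetric])
  define F where "F = inv_into UNIV f"
  have F: "f (F C) = C" if "C \<in> lcosets\<^bsub>G\<^esub> K" for C
    using that rf by (simp add: F_def f_inv_into_f)
  have Ff: "F (f z) = z" for z using injf by (simp add: F_def)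
  define i where "i = (\<lambda>z. F (L g (f z)))"
  have fi: "f (i z) = L g (f z)" for z
    unfolding i_def by (rule F) (intro LN g fN)
  have isom_i: "dist (i u) (i v) = dist u v" for u v
    using f(2)[of "i u" "i v"] fi L\<delta>[OF g(1) fN fN] f(2) by simp
  have "surj i"
  proof (rule surjI)
    fix z
    have "f (i (F (L (inv\<^bsub>G\<^esub> g) (f z)))) = f z"
      unfolding fi using g fN by (simp add: F LN Linv)
    then show "i (F (L (inv\<^bsub>G\<^esub> g) (f z))) = z" using injf by (simp add: inj_eq)
  qed
  have ixy: "i x = y"
  proof -
    have "f (i x) = f y" unfolding fi using g12 g by (simp add: L\<pi>)
    then show ?thesis using injf by (simp add: inj_eq)
  qed
  \<comment> \<open>Measurability of \<open>f\<close> is given, but that of its inverse is needed as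
    well, to write a Borel set of the space as the preimage under \<open>f\<close> of a Borel set of
    cosets. The inverse is an isometry, hence continuous.\<close>
  have cF: "continuous_map N.mtopology euclidean F"
  proof -
    have "continuous_map N.mtopology Met_TC.mtopology F"
    proof (subst N.metric_continuous_map[OF Met_TC.Metric_space_axioms], intro conjI ballI allI impI)
      fix C and e :: real assume C: "C \<in> lcosets\<^bsub>G\<^esub> K" and e: "e > 0"
      have "dist (F C) (F D) = \<delta> C D" if "D \<in> lcosets\<^bsub>G\<^esub> K" for D
        using f(2)[of "F C" "F D"] C that by (simp add: F)
      with e show "\<exists>d>0. \<forall>D. D \<in> lcosets\<^bsub>G\<^esub> K \<and> \<delta> C D < d \<longrightarrow> dist (F C) (F D) < e"
        by auto
    qed simp
    then show ?thesis by simp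
  qed
  have FB: "F \<in> measurable B borel"
    using measurable_borel_sigma_continuous_map[OF cF] by (simp add: B_def borel_sigma_euclidean)
  have cL: "continuous_map N.mtopology N.mtopology (L k)" if "k \<in> carrier G" for k
  proof (subst N.metric_continuous_map[OF met], intro conjI ballI allI impI)
    fix C and e :: real assume C: "C \<in> lcosets\<^bsub>G\<^esub> K" and e: "e > 0"
    then show "\<exists>d>0. \<forall>D. D \<in> lcosets\<^bsub>G\<^esub> K \<and> \<delta> C D < d \<longrightarrow> \<delta> (L k C) (L k D) < e"
      using that by (intro exI[of _ e]) (auto simp: L\<delta>)
  qed (use that LN in auto)
  have LB: "L k \<in> measurable B B" if "k \<in> carrier G" for k
    unfolding B_def by (intro measurable_borel_sigma_continuous_map cL that)
  have \<nu>_inv: "emeasure \<nu> (L g -` D \<inter> space B) = emeasure \<nu> D" if D: "D \<in> sets B" for D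
  proof -
    have D': "L g -` D \<inter> space B \<in> sets B" using LB g D by (intro measurable_sets)
    let ?A = "\<pi> -` D \<inter> carrier G" and ?k = "inv\<^bsub>G\<^esub> g"
    have A: "?A \<in> sets h" using measurable_sets[OF \<pi> D] by (simp add: sph)
    \<comment> \<open>In the group, pulling a set of cosets back along a translation becomes a left
      translate of its preimage, to which the Haar property applies.\<close>
    have "\<pi> -` (L g -` D \<inter> space B) \<inter> carrier G = ?k <#\<^bsub>G\<^esub> ?A"
    proof (intro equalityI subsetI)
      fix a assume a: "a \<in> \<pi> -` (L g -` D \<inter> space B) \<inter> carrier G"
      then have "g \<otimes>\<^bsub>G\<^esub> a \<in> ?A" using g by (auto simp: L\<pi>)
      moreover have "a = ?k \<otimes>\<^bsub>G\<^esub> (g \<otimes>\<^bsub>G\<^esub> a)" using a g by (simp add: m_assoc[symmetric])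
      ultimately show "a \<in> ?k <#\<^bsub>G\<^esub> ?A" unfolding l_coset_def by blast
    next
      fix a assume "a \<in> ?k <#\<^bsub>G\<^esub> ?A"
      then obtain b where b: "b \<in> ?A" "a = ?k \<otimes>\<^bsub>G\<^esub> b" unfolding l_coset_def by blast
      then have "L g (\<pi> a) = \<pi> b" using g by (simp add: L\<pi> m_assoc[symmetric])
      then show "a \<in> \<pi> -` (L g -` D \<inter> space B) \<inter> carrier G"
        using b g by (auto simp: spB N)
    qed
    then have "emeasure \<nu> (L g -` D \<inter> space B) = emeasure h (?k <#\<^bsub>G\<^esub> ?A)"
      using D' by (simp add: \<nu>_def emeasure_distr[OF \<pi>] sph)
    also have "\<dots> = emeasure h ?A"
      using haar A g by (simp add: haar_probability_def)
    also have "\<dots> = emeasure \<nu> D" using D by (simp add: \<nu>_def emeasure_distr[OF \<pi>] sph)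
    finally show ?thesis .
  qed
  have f\<nu>: "emeasure \<mu> (f -` D) = emeasure \<nu> D" if "D \<in> sets B" for D
    using emeasure_distr[OF f(3), of D] that f(4) \<mu> sets_eq_imp_space_eq[OF \<mu>] by (simp add: sets\<nu>)
  have "distr \<mu> \<mu> i = \<mu>"
  proof (rule measure_eqI)
    fix A assume "A \<in> sets (distr \<mu> \<mu> i)"
    then have A: "A \<in> sets borel" using \<mu> by simp
    have "i \<in> borel_measurable borel"
      using isom_i by (intro borel_measurable_continuous_onI isometry_continuous)
    then have im: "i \<in> measurable \<mu> \<mu>" by (simp cong: measurable_cong_sets add: \<mu>)
    \<comment> \<open>The set of cosets that corresponds to \<open>A\<close>; the invariance of
      \<open>\<nu>\<close> is applied to it.\<close>
    let ?D = "F -` A \<inter> space B"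
    have D: "?D \<in> sets B" using FB A by (rule measurable_sets)
    have fD: "f -` ?D = A" using fN Ff by (auto simp: spB)
    have "i -` A = f -` (L g -` ?D \<inter> space B)"
      using fN LN[OF g(1) fN] by (auto simp: i_def spB)
    moreover have "L g -` ?D \<inter> space B \<in> sets B" using LB[OF g(1)] D by (rule measurable_sets)
    ultimately have "emeasure \<mu> (i -` A) = emeasure \<mu> (f -` ?D)"
      using \<nu>_inv[OF D] D by (simp only: f\<nu>)
    then show "emeasure (distr \<mu> \<mu> i) A = emeasure \<mu> A"
      using A im \<mu> sets_eq_imp_space_eq[OF \<mu>] fD by (simp add: emeasure_distr)
  qed simp
  then have "i \<in> carrier (Isomp \<mu>)"
    using \<open>surj i\<close> isom_i by (simp add: carrier_Isomp_iff[OF \<mu>])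
  with ixy show ?thesis by blast
qed

section \<open>Homogeneous spaces as quotients of compact groups\<close>

lemma open_pointwise_ball:
  "open {u :: 'a \<Rightarrow> 'b::metric_space. u z \<in> ball c e}"
proof -
  have "open ((\<lambda>u :: 'a \<Rightarrow> 'b. u z) -` ball c e)"
    by (intro open_vimage open_ball continuous_on_product_coordinates)
  then show ?thesis by (simp add: vimage_def)
qed

text \<open>A packing argument: around the points of an \<open>e\<close>-separated set the balls of
  radius \<open>e/2\<close> are disjoint and share one positive mass \<open>m\<close>, so such a set
  has at most \<open>1 / m\<close> points. One of maximal size is an \<open>e\<close>-net, and
  completeness turns total boundedness into compactness.\<close>

lemma compact_UNIV_if_homogeneous:
  fixes \<mu> :: "'a::polish_space measure"
  assumes mm: "mm_space UNIV dist \<mu>"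
    and trans: "\<And>x y. \<exists>g\<in>carrier (Isomp \<mu>). g x = y"
  shows "compact (UNIV :: 'a set)"
proof -
  note \<mu> = mm_spaceD(1)[OF mm]
  interpret prob_space \<mu> by (rule mm_spaceD(2)[OF mm])
  have sp: "space \<mu> = UNIV" using sets_eq_imp_space_eq[OF \<mu>] by simp
  have equal: "measure \<mu> (ball x r) = measure \<mu> (ball y r)" for x y r
  proof -
    obtain g where g: "g \<in> carrier (Isomp \<mu>)" "g x = y" using trans by blast
    have iso: "\<And>u v. dist (g u) (g v) = dist u v" "distr \<mu> \<mu> g = \<mu>" "g \<in> measurable \<mu> \<mu>"
      using g(1) measurable_Isomp[OF g(1)] by (simp_all add: carrier_Isomp_iff[OF \<mu>])
    have "measure \<mu> (ball y r) = measure (distr \<mu> \<mu> g) (ball y r)" by (simp only: iso)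
    also have "\<dots> = measure \<mu> (g -` ball y r \<inter> space \<mu>)"
      by (rule measure_distr[OF iso(3)]) (simp add: \<mu>)
    also have "g -` ball y r \<inter> space \<mu> = ball x r"
      using g(2) iso(1)[of x] by (auto simp: sp)
    finally show ?thesis by simp
  qed
  have "\<exists>k. finite k \<and> (UNIV :: 'a set) \<subseteq> (\<Union>x\<in>k. ball x e)" if e: "e > 0" for e
  proof -
    define P where "P S \<longleftrightarrow> finite S \<and> (\<forall>x\<in>S. \<forall>y\<in>S. x \<noteq> y \<longrightarrow> e \<le> dist x y)" for S :: "'a set"
    \<comment> \<open>By homogeneity the mass is the same at every centre; \<open>undefined\<close>
      just names some point. Full support makes it positive.\<close>
    define m where "m = measure \<mu> (ball undefined (e/2))"
    have "emeasure \<mu> (ball undefined (e/2)) > 0" using e by (intro mm_spaceD(3)[OF mm]) auto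
    then have m: "m > 0" by (simp add: m_def emeasure_eq_measure)
    have card_le: "real (card S) \<le> 1 / m" if "P S" for S
    proof -
      have disj: "disjoint_family_on (\<lambda>x. ball x (e/2)) S"
        unfolding disjoint_family_on_def
      proof (intro ballI impI)
        fix x y assume xy: "x \<in> S" "y \<in> S" "x \<noteq> y"
        then have "e \<le> dist x y" using that by (simp add: P_def)
        then show "ball x (e/2) \<inter> ball y (e/2) = {}" by (intro disjoint_ballI) simp
      qed
      have "real (card S) * m = (\<Sum>x\<in>S. measure \<mu> (ball x (e/2)))"
        unfolding m_def by (subst equal[of _ "e/2" undefined]) simp
      also have "\<dots> = measure \<mu> (\<Union>x\<in>S. ball x (e/2))"
        using that disj by (intro finite_measure_finite_Union[symmetric]) (auto simp: P_def \<mu>)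
      also have "\<dots> \<le> 1" by (rule prob_le_1)
      finally show ?thesis using m by (simp add: field_simps)
    qed
    have "\<exists>S. P S \<and> (\<forall>S'. P S' \<longrightarrow> card S' \<le> card S)"
    proof (rule Lattices_Big.ex_has_greatest_nat)
      show "P {}" by (simp add: P_def)
      show "\<forall>S. P S \<longrightarrow> card S < nat \<lceil>1 / m\<rceil> + 1"
        using card_le of_nat_ceiling[of "1 / m"] by (meson less_add_one le_less_trans of_nat_le_iff order_trans)
    qed
    then obtain S where S: "P S" "\<And>S'. P S' \<Longrightarrow> card S' \<le> card S" by metis
    have "\<exists>y\<in>S. x \<in> ball y e" for x
    proof (rule ccontr)
      assume "\<not> ?thesis"
      then have far: "\<And>y. y \<in> S \<Longrightarrow> e \<le> dist y x" by (auto simp: not_less)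
      then have "x \<notin> S" using e by fastforce
      moreover have "P (insert x S)" using S(1) far by (auto simp: P_def dist_commute)
      ultimately show False using S(2)[of "insert x S"] S(1) by (auto simp: P_def)
    qed
    then have "UNIV \<subseteq> (\<Union>x\<in>S. ball x e)" by auto
    moreover have "finite S" using S(1) by (simp add: P_def)
    ultimately show ?thesis by blast
  qed
  then show ?thesis by (simp add: compact_eq_totally_bounded complete_UNIV)
qed

text \<open>Copies the structure onto objects that label the points; in the application
  \<open>f x\<close> is a coset. Completeness of the copy is obtained from compactness.\<close>

lemma mm_space_isometric_image:
  fixes \<mu> :: "'a::polish_space measure" and f :: "'a \<Rightarrow> 'b"
  assumes mm: "mm_space UNIV dist \<mu>" and cpt: "compact (UNIV :: 'a set)"
    and met: "Metric_space (range f) \<delta>" and f: "\<And>x y. \<delta> (f x) (f y) = dist x y"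
  defines "B \<equiv> borel_sigma (Metric_space.mtopology (range f) \<delta>)"
  shows "f \<in> measurable \<mu> B" "mm_space (range f) \<delta> (distr \<mu> B f)"
    "mm_isometric UNIV dist \<mu> (range f) \<delta> (distr \<mu> B f)"
proof -
  interpret N: Metric_space "range f" \<delta> by (rule met)
  note \<mu> = mm_spaceD(1)[OF mm]
  interpret prob_space \<mu> by (rule mm_spaceD(2)[OF mm])
  have sp: "space \<mu> = UNIV" using sets_eq_imp_space_eq[OF \<mu>] by simp
  have hom: "homeomorphic_map euclidean N.mtopology f"
    using Metric_space12.isometry_imp_homeomorphic_map[of UNIV dist "range f" \<delta> f]
    by (simp add: Metric_space12_def Met_TC.Metric_space_axioms met f)
  then have cont: "continuous_map euclidean N.mtopology f"
    by (rule homeomorphic_imp_continuous_map)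
  have "f \<in> measurable borel B"
    using measurable_borel_sigma_continuous_map[OF cont] by (simp add: B_def borel_sigma_euclidean)
  then show fB: "f \<in> measurable \<mu> B" by (simp cong: measurable_cong_sets add: \<mu>)
  have "compact_space N.mtopology"
    using homeomorphic_compact_space[OF homeomorphic_map_imp_homeomorphic_space[OF hom]] cpt
    by (simp add: compact_space_def)
  moreover have "separable_space N.mtopology"
  proof -
    have "separable_space (euclidean :: 'a topology)"
      using mm by (simp add: mm_space_def)
    then show ?thesis
      using homeomorphic_separable_space[OF homeomorphic_map_imp_homeomorphic_space[OF hom]] by simp
  qed
  moreover have "emeasure (distr \<mu> B f) U > 0" if U: "openin N.mtopology U" "U \<noteq> {}" for U
  proof -
    have "open (f -` U)"
      using openin_continuous_map_preimage[OF cont U(1)] by (simp add: vimage_def)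
    moreover have "f -` U \<noteq> {}" using openin_subset[OF U(1)] U(2) by auto
    ultimately have "emeasure \<mu> (f -` U) > 0" by (intro mm_spaceD(3)[OF mm])
    moreover have "U \<in> sets B" using U(1) by (simp add: B_def openin_borel_sigma)
    ultimately show ?thesis by (simp add: emeasure_distr[OF fB] sp)
  qed
  ultimately show "mm_space (range f) \<delta> (distr \<mu> B f)"
    unfolding mm_space_def
    using met N.compact_space_imp_mcomplete prob_space_distr[OF fB] by (simp add: B_def)
  have "inj f"
  proof (rule injI)
    fix x y assume eq: "f x = f y"
    have "\<delta> (f x) (f y) = 0" unfolding eq by (rule N.zero[THEN iffD2]) simp_all
    then show "x = y" by (simp add: f)
  qed
  then show "mm_isometric UNIV dist \<mu> (range f) \<delta> (distr \<mu> B f)"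
    unfolding mm_isometric_def using f fB
    by (intro exI[of _ f]) (auto simp: bij_betw_def cong: distr_cong)
qed

section \<open>The compact group of isomorphisms and its Haar measure\<close>

locale homogeneous_mm_space =
  fixes \<mu> :: "'a::polish_space measure"
  assumes mm: "mm_space UNIV dist \<mu>"
    and trans: "\<And>x y. \<exists>g\<in>carrier (Isomp \<mu>). g x = y"
begin

lemmas sets_\<mu> = mm_spaceD(1)[OF mm]

lemma space_\<mu>: "space \<mu> = UNIV"
  using sets_eq_imp_space_eq[OF sets_\<mu>] by simp

lemma compact_UNIV: "compact (UNIV :: 'a set)"
  by (rule compact_UNIV_if_homogeneous[OF mm trans])

abbreviation Iso :: "('a \<Rightarrow> 'a) set" where "Iso \<equiv> carrier (Isomp \<mu>)"

lemma dist_Iso: "g \<in> Iso \<Longrightarrow> dist (g x) (g y) = dist x y"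
  by (simp add: carrier_Isomp_iff[OF sets_\<mu>])

lemma surj_Iso: "g \<in> Iso \<Longrightarrow> surj g"
  by (simp add: carrier_Isomp_iff[OF sets_\<mu>])

text \<open>The supremum is taken over a bounded set thanks to the compactness of the space.\<close>

definition \<rho> :: "('a \<Rightarrow> 'a) \<Rightarrow> ('a \<Rightarrow> 'a) \<Rightarrow> real" where
  "\<rho> g h = (SUP x. dist (g x) (h x))"

lemma dist_le_\<rho>: "dist (g x) (h x) \<le> \<rho> g h"
proof -
  have "bounded (UNIV :: 'a set)" using compact_UNIV by (rule compact_imp_bounded)
  then obtain B where "\<And>x y :: 'a. dist x y \<le> B"
    unfolding bounded_two_points by auto
  then have "bdd_above (range (\<lambda>x. dist (g x) (h x)))" by (intro bdd_aboveI2)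
  then show ?thesis unfolding \<rho>_def by (intro cSUP_upper) auto
qed

lemma \<rho>_le: "(\<And>x. dist (g x) (h x) \<le> c) \<Longrightarrow> \<rho> g h \<le> c"
  unfolding \<rho>_def by (intro cSUP_least) auto

sublocale Iso: Metric_space Iso \<rho>
proof
  fix g h k
  show "0 \<le> \<rho> g h" using dist_le_\<rho>[of g undefined h] zero_le_dist order_trans by blast
  show "\<rho> g h = \<rho> h g" by (simp add: \<rho>_def dist_commute)
  have "g = h" if "\<rho> g h = 0"
  proof
    show "g x = h x" for x using dist_le_\<rho>[of g x h] that by simp
  qed
  then show "\<rho> g h = 0 \<longleftrightarrow> g = h" by (auto simp: \<rho>_def)
  show "\<rho> g k \<le> \<rho> g h + \<rho> h k"
  proof (rule \<rho>_le)
    fix x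
    have "dist (g x) (k x) \<le> dist (g x) (h x) + dist (h x) (k x)" by (rule dist_triangle)
    also have "\<dots> \<le> \<rho> g h + \<rho> h k" by (intro add_mono dist_le_\<rho>)
    finally show "dist (g x) (k x) \<le> \<rho> g h + \<rho> h k" .
  qed
qed

lemma \<rho>_left: "k \<in> Iso \<Longrightarrow> \<rho> (k \<circ> g) (k \<circ> h) = \<rho> g h"
  by (simp add: \<rho>_def dist_Iso)

text \<open>Precomposition with a surjective map only reparametrises the supremum.\<close>

lemma \<rho>_right:
  assumes "k \<in> Iso" shows "\<rho> (g \<circ> k) (h \<circ> k) = \<rho> g h"
proof -
  have "range (\<lambda>x. dist (g (k x)) (h (k x))) = (\<lambda>x. dist (g x) (h x)) ` range k"
    by (simp add: image_image)
  then show ?thesis using surj_Iso[OF assms] by (simp add: \<rho>_def)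
qed

lemma pointwise_neighbourhood_uniform:
  assumes f: "\<And>x y. dist (f x) (f y) = dist x y" and e: "e > 0"
  shows "\<exists>W. open W \<and> f \<in> W \<and> (\<forall>u\<in>W \<inter> Iso. \<rho> u f < e)"
proof -
  have "\<exists>k. finite k \<and> (UNIV :: 'a set) \<subseteq> (\<Union>x\<in>k. ball x (e/4))"
    using compact_UNIV e unfolding compact_eq_totally_bounded by (metis zero_less_divide_iff zero_less_numeral)
  then obtain k :: "'a set" where k: "finite k" "UNIV \<subseteq> (\<Union>x\<in>k. ball x (e/4))" by blast
  define W where "W = (\<Inter>z\<in>k. {u. u z \<in> ball (f z) (e/4)})"
  have "open W" unfolding W_def using k(1) by (intro open_INT ballI open_pointwise_ball)
  moreover have "f \<in> W" using e by (simp add: W_def)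
  moreover have "\<rho> u f < e" if u: "u \<in> W" "u \<in> Iso" for u
  proof -
    \<comment> \<open>Three errors of at most \<open>e/4\<close> each; the slack up to
      \<open>e\<close> keeps the inequality strict after the supremum is taken.\<close>
    have "\<rho> u f \<le> 3 * (e/4)"
    proof (rule \<rho>_le)
      fix x
      obtain z where z: "z \<in> k" "dist z x < e/4" using k(2) by (auto simp: subset_iff)
      have "dist (u x) (f x) \<le> dist (u x) (u z) + dist (u z) (f z) + dist (f z) (f x)"
        using dist_triangle[of "u x" "f x" "u z"] dist_triangle[of "u z" "f x" "f z"] by simp
      also have "\<dots> \<le> e/4 + e/4 + e/4"
      proof (intro add_mono)
        show "dist (u x) (u z) \<le> e/4" using z u(2) by (simp add: dist_Iso dist_commute)
        show "dist (u z) (f z) \<le> e/4" using z u(1) by (auto simp: W_def dist_commute less_imp_le)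
        show "dist (f z) (f x) \<le> e/4" using z by (simp add: f)
      qed
      finally show "dist (u x) (f x) \<le> 3 * (e/4)" by simp
    qed
    then show ?thesis using e by simp
  qed
  ultimately show ?thesis by blast
qed

text \<open>If \<open>g\<close> is uniformly close to \<open>f\<close>, the preimage of
  \<open>C\<close> under \<open>f\<close> lies in the preimage under \<open>g\<close> of a closed
  neighbourhood of \<open>C\<close>, whose mass is known. Letting the neighbourhood shrink gives an
  inequality on closed sets, which determines the measure.\<close>

lemma distr_eq_if_uniform_limit:
  assumes f: "\<And>x y. dist (f x) (f y) = dist x y"
    and lim: "\<And>e. e > 0 \<Longrightarrow> \<exists>g\<in>Iso. \<rho> g f < e"
  shows "distr \<mu> \<mu> f = \<mu>"
proof -
  interpret prob_space \<mu> by (rule mm_spaceD(2)[OF mm])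
  have "f \<in> borel_measurable borel"
    by (intro borel_measurable_continuous_onI isometry_continuous f)
  then have fm: "f \<in> measurable \<mu> \<mu>" by (simp cong: measurable_cong_sets add: sets_\<mu>)
  interpret f: prob_space "distr \<mu> \<mu> f" by (rule prob_space_distr[OF fm])
  have closed_le: "measure (distr \<mu> \<mu> f) C \<le> measure \<mu> C" if C: "closed C" for C
  proof (cases "C = {}")
    case False
    define U where "U n = {x. infdist x C \<le> 1 / real (Suc n)}" for n
    have U: "closed (U n)" for n
      unfolding U_def by (intro closed_Collect_le continuous_intros)
    have "(\<lambda>n. measure \<mu> (U n)) \<longlonglongrightarrow> measure \<mu> C"
      unfolding U_def
      by (rule measure_closed_neighbourhoods_tendsto[OF finite_measure_axioms sets_\<mu> C False])
    moreover have "measure (distr \<mu> \<mu> f) C \<le> measure \<mu> (U n)" for n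
    proof -
      obtain g where g: "g \<in> Iso" "\<rho> g f < 1 / real (Suc n)"
        using lim[of "1 / real (Suc n)"] by auto
      have gm: "g \<in> measurable \<mu> \<mu>" "distr \<mu> \<mu> g = \<mu>"
        using g(1) measurable_Isomp[OF g(1)] by (simp_all add: carrier_Isomp_iff[OF sets_\<mu>])
      have "measure (distr \<mu> \<mu> f) C = measure \<mu> (f -` C)"
        using C by (subst measure_distr[OF fm]) (simp_all add: sets_\<mu> space_\<mu>)
      also have "\<dots> \<le> measure \<mu> (g -` U n)"
      proof (rule finite_measure_mono)
        show "f -` C \<subseteq> g -` U n"
        proof
          fix x assume "x \<in> f -` C"
          then have "infdist (g x) C \<le> dist (g x) (f x)" by (intro infdist_le) simp
          also have "\<dots> \<le> 1 / real (Suc n)" using dist_le_\<rho>[of g x f] g(2) by linarith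
          finally show "x \<in> g -` U n" by (simp add: U_def)
        qed
        show "g -` U n \<in> sets \<mu>"
          using measurable_sets[OF gm(1), of "U n"] U[of n] by (simp add: sets_\<mu> space_\<mu>)
      qed
      also have "\<dots> = measure (distr \<mu> \<mu> g) (U n)"
        using U[of n] by (subst measure_distr[OF gm(1)]) (simp_all add: sets_\<mu> space_\<mu>)
      finally show ?thesis by (simp only: gm)
    qed
    ultimately show ?thesis by (intro LIMSEQ_le_const[of _ "measure \<mu> C"]) auto
  qed simp
  show ?thesis
    by (rule measure_eqI_closed_le[OF f.prob_space_axioms prob_space_axioms _ sets_\<mu> closed_le])
      (simp add: sets_\<mu>)
qed

text \<open>The topology is that of pointwise convergence. A limit point is an isometry and hence a
  uniform limit, so it preserves the measure; it is onto because its range is both compact and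
  dense.\<close>

lemma closed_Iso: "closed Iso"
proof -
  have "f \<in> Iso" if f: "f \<in> closure Iso" for f
  proof -
    have meets: "W \<inter> Iso \<noteq> {}" if "open W" "f \<in> W" for W
      using f that unfolding closure_iff_nhds_not_empty by blast
    have near: "\<exists>g\<in>Iso. dist (g x) (f x) < e \<and> dist (g y) (f y) < e" if "e > 0" for x y and e :: real
    proof -
      have "open ({u. u x \<in> ball (f x) e} \<inter> {u. u y \<in> ball (f y) e})"
        by (intro open_Int open_pointwise_ball)
      then show ?thesis using meets that by (fastforce simp: dist_commute)
    qed
    have iso: "dist (f x) (f y) = dist x y" for x y
    proof (rule ccontr)
      assume ne: "dist (f x) (f y) \<noteq> dist x y"
      \<comment> \<open>Half of the defect: two errors below \<open>e\<close> cannot add up to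
        it.\<close>
      define e where "e = \<bar>dist (f x) (f y) - dist x y\<bar> / 2"
      have "e > 0" using ne by (simp add: e_def)
      then obtain g where g: "g \<in> Iso" "dist (g x) (f x) < e" "dist (g y) (f y) < e"
        using near by blast
      have "\<bar>dist (f x) (f y) - dist (g x) (g y)\<bar> \<le> dist (g x) (f x) + dist (g y) (f y)"
        by (smt (verit) dist_commute dist_triangle)
      then show False using g by (simp add: dist_Iso e_def)
    qed
    have unif: "\<exists>g\<in>Iso. \<rho> g f < e" if e: "e > 0" for e
    proof -
      obtain W where "open W" "f \<in> W" "\<forall>u\<in>W \<inter> Iso. \<rho> u f < e"
        using pointwise_neighbourhood_uniform[OF iso e] by blast
      then show ?thesis using meets by blast
    qed
    have "surj f"
    proof -
      have "compact (range f)"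
        by (intro compact_continuous_image isometry_continuous iso compact_UNIV)
      then have "closed (range f)" by (rule compact_imp_closed)
      moreover have "y \<in> closure (range f)" for y
      proof (subst closure_approachable, intro allI impI)
        fix e :: real assume "e > 0"
        then obtain g where g: "g \<in> Iso" "\<rho> g f < e" using unif by blast
        obtain x where "g x = y" using surj_Iso[OF g(1)] by (metis surjD)
        then have "dist (f x) y < e"
          using dist_le_\<rho>[of g x f] g(2) by (simp add: dist_commute)
        then show "\<exists>z\<in>range f. dist z y < e" by blast
      qed
      ultimately show ?thesis by (auto simp: closure_closed)
    qed
    then show ?thesis
      using iso distr_eq_if_uniform_limit[OF iso unif] by (simp add: carrier_Isomp_iff[OF sets_\<mu>])
  qed
  then show ?thesis using closure_subset_eq by blast
qed

text \<open>By Tychonoff's theorem the closed set \<open>Iso\<close> is compact for pointwise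
  convergence, and by equicontinuity the identity from this topology to that of
  \<open>\<rho>\<close> is continuous.\<close>

lemma compact_space_Iso: "compact_space Iso.mtopology"
proof -
  have "compactin (product_topology (\<lambda>_. euclidean) UNIV) (PiE UNIV (\<lambda>_::'a. UNIV :: 'a set))"
    by (subst compactin_PiE) (simp add: compact_UNIV)
  then have "compact (UNIV :: ('a \<Rightarrow> 'a) set)"
    by (simp add: euclidean_product_topology PiE_UNIV_domain)
  then have cpt: "compactin (top_of_set Iso) Iso"
    using compact_Int_closed[OF _ closed_Iso, of UNIV] by (simp add: compactin_subtopology)
  have "continuous_map (top_of_set Iso) Iso.mtopology (\<lambda>g. g)"
    unfolding Iso.continuous_map_to_metric
  proof (intro ballI allI impI)
    fix g and e :: real assume "g \<in> topspace (top_of_set Iso)" and e: "e > 0"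
    then have g: "g \<in> Iso" by simp
    obtain W where W: "open W" "g \<in> W" "\<forall>u\<in>W \<inter> Iso. \<rho> u g < e"
      using pointwise_neighbourhood_uniform[OF dist_Iso[OF g] e] by blast
    then show "\<exists>U. openin (top_of_set Iso) U \<and> g \<in> U \<and> (\<forall>h\<in>U. h \<in> Iso.mball g e)"
      using g by (intro exI[of _ "Iso \<inter> W"]) (auto simp: openin_open Iso.commute)
  qed
  from image_compactin[OF cpt this] show ?thesis by (simp add: compact_space_def)
qed

lemma group_Iso: "group (Isomp \<mu>)"
  by (rule group_Isomp[OF sets_\<mu>])

lemma comp_Iso: "g \<in> Iso \<Longrightarrow> h \<in> Iso \<Longrightarrow> g \<circ> h \<in> Iso"
  by (rule comp_Isomp_mem[OF sets_\<mu>])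

lemma inv_Iso:
  assumes "g \<in> Iso"
  shows "inv_into UNIV g \<in> Iso" "inv_into UNIV g \<circ> g = id" "g \<circ> inv_into UNIV g = id"
proof -
  show "inv_into UNIV g \<in> Iso" by (rule inv_Isomp_mem[OF sets_\<mu> assms])
  have "inj g" using dist_Iso[OF assms] by (rule isometry_inj)
  then show "inv_into UNIV g \<circ> g = id" by simp
  show "g \<circ> inv_into UNIV g = id" using surj_Iso[OF assms] by (simp add: fun_eq_iff surj_f_inv_f)
qed

lemma bij_betw_translations:
  assumes k: "k \<in> Iso"
  shows "bij_betw (\<lambda>g. k \<circ> g) Iso Iso" "bij_betw (\<lambda>g. g \<circ> k) Iso Iso"
proof -
  note k' = inv_Iso[OF k]
  show "bij_betw (\<lambda>g. k \<circ> g) Iso Iso"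
  proof (rule bij_betwI[where g = "\<lambda>g. inv_into UNIV k \<circ> g"])
    fix g show "inv_into UNIV k \<circ> (k \<circ> g) = g" "k \<circ> (inv_into UNIV k \<circ> g) = g"
      by (simp_all only: comp_assoc[symmetric] k' id_comp)
  qed (use comp_Iso k k' in auto)
  show "bij_betw (\<lambda>g. g \<circ> k) Iso Iso"
  proof (rule bij_betwI[where g = "\<lambda>g. g \<circ> inv_into UNIV k"])
    fix g show "(g \<circ> k) \<circ> inv_into UNIV k = g" "(g \<circ> inv_into UNIV k) \<circ> k = g"
      by (simp_all only: comp_assoc k' comp_id)
  qed (use comp_Iso k k' in auto)
qed

lemma continuous_map_eval: "continuous_map Iso.mtopology euclidean (\<lambda>g. g x)"
proof -
  have "continuous_map Iso.mtopology Met_TC.mtopology (\<lambda>g. g x)"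
  proof (subst Iso.metric_continuous_map[OF Met_TC.Metric_space_axioms], intro conjI ballI allI impI)
    fix g and e :: real assume "g \<in> Iso" "e > 0"
    then show "\<exists>d>0. \<forall>h. h \<in> Iso \<and> \<rho> g h < d \<longrightarrow> dist (g x) (h x) < e"
      by (intro exI[of _ e]) (auto intro: le_less_trans[OF dist_le_\<rho>])
  qed simp
  then show ?thesis by simp
qed

lemma measurable_eval: "(\<lambda>g. g x) \<in> measurable (borel_sigma Iso.mtopology) borel"
  using measurable_borel_sigma_continuous_map[OF continuous_map_eval] by (simp add: borel_sigma_euclidean)

text \<open>Exchanging integrals requires measurability for the product of the two Borel
  sigma-algebras, so the preimage of an open set is exhibited as a countable union of measurable
  rectangles, indexed by a dense set and a sequence of radii. As each \<open>g\<close> is an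
  isometry, the same radius serves in the source and in the target.\<close>

lemma measurable_apply:
  "(\<lambda>(g, x). g x) \<in> measurable (borel_sigma Iso.mtopology \<Otimes>\<^sub>M borel) borel"
proof (rule borel_measurableI)
  fix S :: "'a set" assume S: "open S"
  let ?M = "borel_sigma Iso.mtopology \<Otimes>\<^sub>M (borel :: 'a measure)"
  obtain D :: "'a set" where D: "countable D" "\<And>X. open X \<Longrightarrow> X \<noteq> {} \<Longrightarrow> \<exists>q\<in>D. q \<in> X"
    using countable_dense_setE by metis
  define r where "r n = 1 / real (Suc n)" for n
  \<comment> \<open>The points whose ball of radius \<open>r n\<close> lies in \<open>S\<close>,
    written as a complement of open balls so that closedness is evident.\<close>
  define V where "V n = - (\<Union>z\<in>- S. ball z (r n))" for n
  have V: "ball y (r n) \<subseteq> S \<longleftrightarrow> y \<in> V n" for y n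
    by (auto simp: V_def subset_iff dist_commute)
  define E where "E q n = {g \<in> Iso. g q \<in> V n} \<times> ball q (r n)" for q n
  have "closed (V n)" for n by (auto simp: V_def)
  then have "{g \<in> Iso. g q \<in> V n} \<in> sets (borel_sigma Iso.mtopology)" for q n
    using measurable_sets[OF measurable_eval, of "V n" q]
    by (simp add: space_borel_sigma vimage_def Int_def conj_commute)
  then have E: "E q n \<in> sets ?M" for q n
    unfolding E_def by (intro pair_measureI) auto
  have "(\<lambda>(g, x). g x) -` S \<inter> space ?M = (\<Union>q\<in>D. \<Union>n. E q n)"
  proof (intro equalityI subsetI)
    fix p assume p: "p \<in> (\<lambda>(g, x). g x) -` S \<inter> space ?M"
    obtain g x where gx: "p = (g, x)" by fastforce
    with p have g: "g \<in> Iso" "g x \<in> S" by (auto simp: space_pair_measure space_borel_sigma)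
    obtain e where e: "e > 0" "ball (g x) e \<subseteq> S" using S g(2) by (auto simp: open_contains_ball)
    obtain n where n: "r n < e / 2" using nat_approx_posE[of "e/2"] e(1) unfolding r_def by auto
    have "r n > 0" by (simp add: r_def)
    then obtain q where q: "q \<in> D" "q \<in> ball x (r n)" using D(2)[of "ball x (r n)"] by auto
    have "ball (g q) (r n) \<subseteq> ball (g x) e"
    proof
      fix y assume "y \<in> ball (g q) (r n)"
      moreover have "dist (g x) (g q) < r n" using q g(1) by (simp add: dist_Iso)
      ultimately show "y \<in> ball (g x) e" using n dist_triangle[of "g x" y "g q"] by simp
    qed
    then have "g q \<in> V n" using e(2) V by blast
    then show "p \<in> (\<Union>q\<in>D. \<Union>n. E q n)"
      using q g(1) gx by (auto simp: E_def dist_commute)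
  next
    fix p assume "p \<in> (\<Union>q\<in>D. \<Union>n. E q n)"
    then obtain q n g x where *: "p = (g, x)" "g \<in> Iso" "g q \<in> V n" "dist q x < r n"
      by (auto simp: E_def)
    then have "g x \<in> ball (g q) (r n)" by (simp add: dist_Iso)
    then have "g x \<in> S" using V *(3) by blast
    then show "p \<in> (\<lambda>(g, x). g x) -` S \<inter> space ?M"
      using * by (auto simp: space_pair_measure space_borel_sigma)
  qed
  then show "(\<lambda>(g, x). g x) -` S \<inter> space ?M \<in> sets ?M"
    using D(1) E by (auto intro!: sets.countable_UN'' )
qed

text \<open>Averaging \<open>\<mu> A = \<mu> (g\<^sup>-\<^sup>1 A)\<close> over \<open>g\<close> and exchanging the integrals gives the average over
  \<open>x\<close> of the measure of \<open>{g. g x \<in> A}\<close>, which does not depend on \<open>x\<close> by right invariance.\<close>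

lemma distr_eval_eq:
  assumes h: "prob_space h" and sets_h: "sets h = sets (borel_sigma Iso.mtopology)"
    and right: "\<And>k A. k \<in> Iso \<Longrightarrow> A \<in> sets h \<Longrightarrow> emeasure h ((\<lambda>g. g \<circ> k) ` A) = emeasure h A"
  shows "distr h borel (\<lambda>g. g x\<^sub>0) = \<mu>"
proof (rule measure_eqI)
  show "sets (distr h borel (\<lambda>g. g x\<^sub>0)) = sets \<mu>" by (simp add: sets_\<mu>)
  fix A assume "A \<in> sets (distr h borel (\<lambda>g. g x\<^sub>0))"
  then have A: "A \<in> sets borel" by simp
  interpret h: prob_space h by fact
  interpret \<mu>: prob_space \<mu> by (rule mm_spaceD(2)[OF mm])
  interpret pair_sigma_finite h \<mu> ..
  have sp_h: "space h = Iso" using sets_eq_imp_space_eq[OF sets_h] by (simp add: space_borel_sigma)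
  have ev: "(\<lambda>g. g x) \<in> measurable h borel" for x
    using measurable_eval by (simp cong: measurable_cong_sets add: sets_h)
  define H where "H x = {g \<in> Iso. g x \<in> A}" for x
  have H: "H x \<in> sets h" for x
    using measurable_sets[OF ev A, of x] by (simp add: H_def sp_h vimage_def Int_def conj_commute)
  have const: "emeasure h (H x) = emeasure h (H x\<^sub>0)" for x
  proof -
    obtain k where k: "k \<in> Iso" "k x\<^sub>0 = x" using trans by blast
    \<comment> \<open>For \<open>k\<close> sending \<open>x\<^sub>0\<close> to \<open>x\<close>, the
      map \<open>g \<circ> k\<close> does to \<open>x\<^sub>0\<close> what \<open>g\<close> does to
      \<open>x\<close>.\<close>
    have "(\<lambda>g. g \<circ> k) ` H x = H x\<^sub>0"
    proof (intro equalityI subsetI)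
      fix u assume u: "u \<in> H x\<^sub>0"
      let ?v = "u \<circ> inv_into UNIV k"
      have "?v \<circ> k = u" using inv_Iso(2)[OF k(1)] by (simp add: comp_assoc)
      moreover have "?v \<in> Iso" using u k(1) by (auto simp: H_def intro!: comp_Iso inv_Iso)
      moreover have "?v x = u x\<^sub>0" using \<open>?v \<circ> k = u\<close> k(2) by (metis comp_apply)
      ultimately show "u \<in> (\<lambda>g. g \<circ> k) ` H x" using u by (intro image_eqI[of _ _ ?v]) (auto simp: H_def)
    qed (use k comp_Iso in \<open>auto simp: H_def\<close>)
    then show ?thesis using right[OF k(1) H[of x]] by simp
  qed
  have mp: "(\<lambda>(g, x). indicator A (g x) :: ennreal) \<in> borel_measurable (h \<Otimes>\<^sub>M \<mu>)"
  proof -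
    have "(\<lambda>(g, x). g x) \<in> measurable (h \<Otimes>\<^sub>M \<mu>) borel"
      using measurable_apply by (simp cong: measurable_cong_sets sets_pair_measure_cong add: sets_h sets_\<mu>)
    from measurable_compose[OF this borel_measurable_indicator[OF A]]
    show ?thesis by (simp add: case_prod_beta')
  qed
  have "emeasure \<mu> A = (\<integral>\<^sup>+g. emeasure \<mu> A \<partial>h)" by (simp add: h.emeasure_space_1)
  also have "\<dots> = (\<integral>\<^sup>+g. (\<integral>\<^sup>+x. indicator A (g x) \<partial>\<mu>) \<partial>h)"
  proof (rule nn_integral_cong)
    fix g assume "g \<in> space h"
    then have g: "g \<in> Iso" by (simp add: sp_h)
    have gm: "g \<in> measurable \<mu> \<mu>" "distr \<mu> \<mu> g = \<mu>"
      using measurable_Isomp[OF g] g by (simp_all add: carrier_Isomp_iff[OF sets_\<mu>])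
    have "emeasure \<mu> A = (\<integral>\<^sup>+x. indicator A x \<partial>distr \<mu> \<mu> g)" using A by (simp add: gm sets_\<mu>)
    also have "\<dots> = (\<integral>\<^sup>+x. indicator A (g x) \<partial>\<mu>)"
      using A by (intro nn_integral_distr gm borel_measurable_indicator) (simp add: sets_\<mu>)
    finally show "emeasure \<mu> A = (\<integral>\<^sup>+x. indicator A (g x) \<partial>\<mu>)" .
  qed
  also have "\<dots> = (\<integral>\<^sup>+x. (\<integral>\<^sup>+g. indicator A (g x) \<partial>h) \<partial>\<mu>)"
    by (rule Fubini'[OF mp, symmetric])
  also have "\<dots> = (\<integral>\<^sup>+x. emeasure h (H x) \<partial>\<mu>)"
  proof (rule nn_integral_cong)
    fix x
    have "(\<integral>\<^sup>+g. indicator A (g x) \<partial>h) = (\<integral>\<^sup>+g. indicator (H x) g \<partial>h)"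
      by (intro nn_integral_cong) (auto simp: H_def sp_h indicator_def)
    then show "(\<integral>\<^sup>+g. indicator A (g x) \<partial>h) = emeasure h (H x)" using H by simp
  qed
  also have "\<dots> = emeasure h (H x\<^sub>0)"
    by (subst const) (simp add: \<mu>.emeasure_space_1)
  also have "\<dots> = emeasure (distr h borel (\<lambda>g. g x\<^sub>0)) A"
    using A by (simp add: emeasure_distr[OF ev] H_def sp_h vimage_def Int_def conj_commute)
  finally show "emeasure (distr h borel (\<lambda>g. g x\<^sub>0)) A = emeasure \<mu> A" ..
qed

text \<open>Both continuity properties come from bi-invariance: the distance between two products is
  at most the sum of the distances between the factors, and inversion is an isometry.\<close>

lemma compact_topological_group_Iso: "compact_topological_group (Isomp \<mu>) Iso.mtopology"
proof -
  have "continuous_map (prod_topology Iso.mtopology Iso.mtopology) Iso.mtopology (\<lambda>(x, y). x \<otimes>\<^bsub>Isomp \<mu>\<^esub> y)"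
    unfolding Iso.continuous_map_to_metric
  proof (intro ballI allI impI)
    fix p and e :: real
    assume p: "p \<in> topspace (prod_topology Iso.mtopology Iso.mtopology)" and e: "e > 0"
    then obtain g h where gh: "p = (g, h)" "g \<in> Iso" "h \<in> Iso" by auto
    let ?U = "Iso.mball g (e/2) \<times> Iso.mball h (e/2)"
    have "(case q of (x, y) \<Rightarrow> x \<otimes>\<^bsub>Isomp \<mu>\<^esub> y) \<in> Iso.mball (case p of (x, y) \<Rightarrow> x \<otimes>\<^bsub>Isomp \<mu>\<^esub> y) e"
      if qU: "q \<in> ?U" for q
    proof -
      obtain g' h' where q: "q = (g', h')" "g' \<in> Iso" "h' \<in> Iso" "\<rho> g g' < e/2" "\<rho> h h' < e/2"
        using qU by (cases q) auto
      have "\<rho> (g \<circ> h) (g' \<circ> h') \<le> \<rho> (g \<circ> h) (g \<circ> h') + \<rho> (g \<circ> h') (g' \<circ> h')"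
        using gh q by (intro Iso.triangle comp_Iso)
      then have "\<rho> (g \<circ> h) (g' \<circ> h') < e" using gh q by (simp add: \<rho>_left \<rho>_right)
      then show ?thesis using gh q by (simp add: mult_Isomp comp_Iso)
    qed
    moreover have "openin (prod_topology Iso.mtopology Iso.mtopology) ?U"
      by (simp add: openin_prod_Times_iff)
    moreover have "p \<in> ?U" using gh e by simp
    ultimately show "\<exists>U. openin (prod_topology Iso.mtopology Iso.mtopology) U \<and> p \<in> U \<and>
        (\<forall>q\<in>U. (case q of (x, y) \<Rightarrow> x \<otimes>\<^bsub>Isomp \<mu>\<^esub> y) \<in> Iso.mball (case p of (x, y) \<Rightarrow> x \<otimes>\<^bsub>Isomp \<mu>\<^esub> y) e)"
      by blast
  qed
  moreover have "continuous_map Iso.mtopology Iso.mtopology (\<lambda>g. inv\<^bsub>Isomp \<mu>\<^esub> g)"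
  proof (subst Iso.metric_continuous_map[OF Iso.Metric_space_axioms], intro conjI ballI allI impI)
    show "(\<lambda>g. inv\<^bsub>Isomp \<mu>\<^esub> g) ` Iso \<subseteq> Iso"
      by (auto simp: inv_Isomp[OF sets_\<mu>] inv_Iso)
    fix g and e :: real assume g: "g \<in> Iso" and e: "e > 0"
    \<comment> \<open>Compose on the left with \<open>g\<close> and on the right with
      \<open>h\<close>.\<close>
    have "\<rho> (inv_into UNIV g) (inv_into UNIV h) = \<rho> g h" if h: "h \<in> Iso" for h
    proof -
      have "\<rho> (inv_into UNIV g) (inv_into UNIV h) = \<rho> (g \<circ> inv_into UNIV g) (g \<circ> inv_into UNIV h)"
        by (rule \<rho>_left[OF g, symmetric])
      also have "\<dots> = \<rho> id (g \<circ> inv_into UNIV h)" by (simp only: inv_Iso[OF g])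
      also have "\<dots> = \<rho> (id \<circ> h) (g \<circ> inv_into UNIV h \<circ> h)" by (rule \<rho>_right[OF h, symmetric])
      also have "\<dots> = \<rho> h g" by (simp only: comp_assoc inv_Iso[OF h] id_comp comp_id)
      finally show ?thesis by (simp add: Iso.commute)
    qed
    then show "\<exists>d>0. \<forall>h. h \<in> Iso \<and> \<rho> g h < d \<longrightarrow> \<rho> (inv\<^bsub>Isomp \<mu>\<^esub> g) (inv\<^bsub>Isomp \<mu>\<^esub> h) < e"
      using g e by (intro exI[of _ e]) (simp add: inv_Isomp[OF sets_\<mu>])
  qed
  ultimately show ?thesis
    unfolding compact_topological_group_def
    using group_Iso compact_space_Iso Iso.Hausdorff_space_mtopology by simp
qed

lemma id_Iso: "id \<in> Iso"
  using monoid.one_closed[OF group.is_monoid[OF group_Iso]] by (simp add: one_Isomp)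

text \<open>Translations on either side are isometries of the group. Right invariance is recorded
  separately because \<open>haar_probability\<close> speaks of left translations only, while the
  image under evaluation is computed from right ones.\<close>

lemma haar_probability_Iso:
  "\<exists>h. haar_probability (Isomp \<mu>) Iso.mtopology h \<and>
     (\<forall>k\<in>Iso. \<forall>A\<in>sets h. emeasure h ((\<lambda>g. g \<circ> k) ` A) = emeasure h A)"
proof (rule Iso.invariant_probability_exists[OF compact_space_Iso])
  show "Iso \<noteq> {}" using id_Iso by blast
  fix h assume h: "sets h = sets (borel_sigma Iso.mtopology)" "prob_space h"
    "\<And>f A. bij_betw f Iso Iso \<Longrightarrow> (\<And>x y. x \<in> Iso \<Longrightarrow> y \<in> Iso \<Longrightarrow> \<rho> (f x) (f y) = \<rho> x y) \<Longrightarrow> A \<in> sets h \<Longrightarrow>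
       f ` A \<in> sets h \<and> emeasure h (f ` A) = emeasure h A"
    "\<And>A. A \<in> sets h \<Longrightarrow> emeasure h A = (INF U\<in>{U. openin Iso.mtopology U \<and> A \<subseteq> U}. emeasure h U)"
    "\<And>U. openin Iso.mtopology U \<Longrightarrow>
       emeasure h U = (SUP C\<in>{C. compactin Iso.mtopology C \<and> C \<subseteq> U}. emeasure h C)"
  have sp_h: "space h = Iso" using sets_eq_imp_space_eq[OF h(1)] by (simp add: space_borel_sigma)
  have "haar_probability (Isomp \<mu>) Iso.mtopology h"
    unfolding haar_probability_def
  proof (intro conjI ballI allI impI)
    fix g A assume g: "g \<in> Iso" and A: "A \<in> sets h"
    have "A \<subseteq> Iso" using sets.sets_into_space[OF A] by (simp add: sp_h)
    then have "g \<otimes>\<^bsub>Isomp \<mu>\<^esub> u = g \<circ> u" if "u \<in> A" for u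
      using g that by (intro mult_Isomp) auto
    then have "g <#\<^bsub>Isomp \<mu>\<^esub> A = (\<lambda>u. g \<circ> u) ` A"
      by (simp add: l_coset_def UNION_singleton_eq_range cong: image_cong_simp)
    then show "emeasure h (g <#\<^bsub>Isomp \<mu>\<^esub> A) = emeasure h A"
      using h(3)[OF bij_betw_translations(1)[OF g] _ A] by (simp add: \<rho>_left[OF g])
  qed (fact h)+
  moreover have "emeasure h ((\<lambda>g. g \<circ> k) ` A) = emeasure h A" if "k \<in> Iso" "A \<in> sets h" for k A
    using h(3)[OF bij_betw_translations(2)[OF that(1)] _ that(2)] by (simp add: \<rho>_right[OF that(1)])
  ultimately show ?thesis by blast
qed

theorem compact_group_quotient_Iso: "compact_group_quotient TYPE('a \<Rightarrow> 'a) UNIV dist \<mu>"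
proof -
  interpret G: group "Isomp \<mu>" by (rule group_Iso)
  obtain h where haar: "haar_probability (Isomp \<mu>) Iso.mtopology h"
    and right: "\<And>k A. k \<in> Iso \<Longrightarrow> A \<in> sets h \<Longrightarrow> emeasure h ((\<lambda>g. g \<circ> k) ` A) = emeasure h A"
    using haar_probability_Iso by blast
  have sets_h: "sets h = sets (borel_sigma Iso.mtopology)" and prob_h: "prob_space h"
    using haar by (simp_all add: haar_probability_def)
  have sp_h: "space h = Iso" using sets_eq_imp_space_eq[OF sets_h] by (simp add: space_borel_sigma)
  define x\<^sub>0 :: 'a where "x\<^sub>0 = undefined"
  have push: "distr h borel (\<lambda>g. g x\<^sub>0) = \<mu>"
    by (rule distr_eval_eq[OF prob_h sets_h right])
  \<comment> \<open>\<open>f x\<close> turns out to be a left coset of the stabiliser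
    \<open>K\<close> of the base point, namely the isomorphisms moving the base point to
    \<open>x\<close>. The distance of the space is then copied to these cosets.\<close>
  define f where "f x = {g \<in> Iso. g x\<^sub>0 = x}" for x
  define K where "K = f x\<^sub>0"
  have K: "subgroup K (Isomp \<mu>)"
  proof (rule G.subgroupI)
    show "K \<noteq> {}" using id_Iso by (auto simp: K_def f_def)
    fix a assume a: "a \<in> K"
    then have "a \<in> Iso" "a x\<^sub>0 = x\<^sub>0" by (auto simp: K_def f_def)
    moreover have "inv_into UNIV a x\<^sub>0 = x\<^sub>0"
      using inv_Iso(2)[OF \<open>a \<in> Iso\<close>] \<open>a x\<^sub>0 = x\<^sub>0\<close> by (metis comp_apply id_apply)
    ultimately show "inv\<^bsub>Isomp \<mu>\<^esub> a \<in> K" by (simp add: K_def f_def inv_Isomp[OF sets_\<mu>] inv_Iso)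
    fix b assume "b \<in> K"
    then show "a \<otimes>\<^bsub>Isomp \<mu>\<^esub> b \<in> K" using a by (auto simp: K_def f_def mult_Isomp comp_Iso)
  qed (auto simp: K_def f_def)
  have "closedin Iso.mtopology {g \<in> topspace Iso.mtopology. g x\<^sub>0 \<in> {x\<^sub>0}}"
    by (rule closedin_continuous_map_preimage[OF continuous_map_eval]) simp
  then have Kclosed: "closedin Iso.mtopology K" by (simp add: K_def f_def)
  have coset: "g <#\<^bsub>Isomp \<mu>\<^esub> K = f (g x\<^sub>0)" if g: "g \<in> Iso" for g
  proof (intro equalityI subsetI)
    fix u assume "u \<in> f (g x\<^sub>0)"
    then have u: "u \<in> Iso" "u x\<^sub>0 = g x\<^sub>0" by (auto simp: f_def)
    let ?k = "inv_into UNIV g \<circ> u"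
    have "?k x\<^sub>0 = x\<^sub>0" using inv_Iso(2)[OF g] u(2) by (metis comp_apply id_apply)
    then have "?k \<in> K" using u g by (simp add: K_def f_def comp_Iso inv_Iso)
    moreover have "g \<circ> ?k = u" using inv_Iso(3)[OF g] by (simp flip: comp_assoc)
    then have "u = g \<otimes>\<^bsub>Isomp \<mu>\<^esub> ?k" using g \<open>?k \<in> K\<close> by (simp add: mult_Isomp K_def f_def)
    ultimately show "u \<in> g <#\<^bsub>Isomp \<mu>\<^esub> K" unfolding l_coset_def by blast
  qed (use g in \<open>auto simp: l_coset_def K_def f_def mult_Isomp comp_Iso\<close>)
  have lc: "lcosets\<^bsub>Isomp \<mu>\<^esub> K = range f"
  proof (intro equalityI subsetI)
    fix C assume "C \<in> range f"
    then obtain x where x: "C = f x" by blast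
    obtain g where "g \<in> Iso" "g x\<^sub>0 = x" using trans by blast
    then show "C \<in> lcosets\<^bsub>Isomp \<mu>\<^esub> K" using x coset[of g] by (auto simp: LCOSETS_def)
  qed (auto simp: LCOSETS_def coset)
  \<comment> \<open>Recovers \<open>x\<close> from \<open>f x\<close>: all elements of that coset
    take the same value at \<open>x\<^sub>0\<close>.\<close>
  define q where "q C = (SOME g. g \<in> C) x\<^sub>0" for C :: "('a \<Rightarrow> 'a) set"
  have q: "q (f x) = x" for x
  proof -
    have "\<exists>g. g \<in> f x" using trans[of x\<^sub>0 x] by (auto simp: f_def)
    then have "(SOME g. g \<in> f x) \<in> f x" by (rule someI_ex)
    then show ?thesis by (simp add: q_def f_def)
  qed
  define \<delta> where "\<delta> C D = dist (q C) (q D)" for C D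
  have \<delta>: "\<delta> (f x) (f y) = dist x y" for x y by (simp add: \<delta>_def q)
  have met: "Metric_space (range f) \<delta>"
    by unfold_locales (auto simp: \<delta>_def q dist_commute dist_triangle)
  define B where "B = borel_sigma (Metric_space.mtopology (range f) \<delta>)"
  define \<pi> where "\<pi> = (\<lambda>g. g <#\<^bsub>Isomp \<mu>\<^esub> K)"
  note im = mm_space_isometric_image[OF mm compact_UNIV met \<delta>, folded B_def]
  have ev: "(\<lambda>g. g x\<^sub>0) \<in> measurable h borel"
    using measurable_eval by (simp cong: measurable_cong_sets add: sets_h)
  have fB: "f \<in> measurable borel B" using im(1) by (simp cong: measurable_cong_sets add: sets_\<mu>)
  have \<pi>: "\<pi> g = f (g x\<^sub>0)" if "g \<in> space h" for g
    using that coset by (simp add: \<pi>_def sp_h)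
  have \<pi>B: "\<pi> \<in> measurable h B"
    using measurable_compose[OF ev fB] by (simp cong: measurable_cong add: \<pi>)
  have "distr h B \<pi> = distr h B (f \<circ> (\<lambda>g. g x\<^sub>0))"
    by (rule distr_cong) (simp_all add: \<pi>)
  also have "\<dots> = distr (distr h borel (\<lambda>g. g x\<^sub>0)) B f"
    by (rule distr_distr[OF fB ev, symmetric])
  finally have distr_\<pi>: "distr h B \<pi> = distr \<mu> B f" by (simp add: push)
  show ?thesis
    unfolding compact_group_quotient_def Let_def
    using compact_topological_group_Iso K Kclosed haar met \<pi>B im(2,3)
    by (intro exI[of _ "Isomp \<mu>"] exI[of _ "Iso.mtopology"] exI[of _ K] exI[of _ h] exI[of _ \<delta>])
      (auto simp: lc distr_\<pi>[unfolded B_def \<pi>_def] B_def \<pi>_def coset \<delta> mult_Isomp comp_Iso dist_Iso)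
qed

end

section \<open>Gromov reconstruction\<close>

text \<open>Matching the two sequences is uniformly continuous and extends to the closure.
  Completeness makes the range of the extension closed, and it contains the dense
  \<open>range t\<close>, which gives surjectivity.\<close>

lemma isometry_of_dense_sequences:
  fixes s t :: "nat \<Rightarrow> 'a::complete_space"
  assumes s: "closure (range s) = UNIV" and t: "closure (range t) = UNIV"
    and st: "\<And>i j. dist (s i) (s j) = dist (t i) (t j)"
  obtains g where "\<And>n. g (s n) = t n" "\<And>x y. dist (g x) (g y) = dist x y" "surj g"
proof -
  \<comment> \<open>A value may occur several times in \<open>s\<close>; any of its indices will do,
    since equal terms of \<open>s\<close> have distance 0 and so do the corresponding terms of
    \<open>t\<close>.\<close>
  define f where "f x = t (SOME n. s n = x)" for x
  have f: "f (s n) = t n" for n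
  proof -
    have "s (SOME m. s m = s n) = s n" by (rule someI[of "\<lambda>m. s m = s n"]) simp
    then have "dist (t (SOME m. s m = s n)) (t n) = 0" using st[of "SOME m. s m = s n" n] by simp
    then show ?thesis by (simp add: f_def)
  qed
  have "uniformly_continuous_on (range s) f"
    unfolding uniformly_continuous_on_def using st by (auto simp: f intro!: exI)
  from uniformly_continuous_on_extension_on_closure[OF this]
  obtain g where g: "uniformly_continuous_on (closure (range s)) g" "\<And>x. x \<in> range s \<Longrightarrow> f x = g x"
    by metis
  have gs: "g (s n) = t n" for n using g(2)[of "s n"] f by simp
  have cont: "continuous_on UNIV g" using uniformly_continuous_imp_continuous[OF g(1)] s by simp
  \<comment> \<open>The identity between distances is extended from the dense sequence one variable
    at a time.\<close>
  have closed1: "closed {x. dist (g x) (g y) = dist x y}" for y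
    by (intro closed_Collect_eq continuous_intros cont)
  have iso1: "dist (g x) (g (s m)) = dist x (s m)" for x m
  proof -
    have "range s \<subseteq> {x. dist (g x) (g (s m)) = dist x (s m)}" using st by (auto simp: gs)
    from closure_minimal[OF this closed1] show ?thesis using s by auto
  qed
  have iso: "dist (g x) (g y) = dist x y" for x y
  proof -
    have "range s \<subseteq> {x. dist (g x) (g y) = dist x y}" using iso1[of y] by (auto simp: dist_commute)
    from closure_minimal[OF this closed1] show ?thesis using s by auto
  qed
  have "closed (range g)"
    unfolding closed_sequential_limits
  proof (intro allI impI, elim conjE)
    fix u l assume u: "\<forall>n. u n \<in> range g" "u \<longlonglongrightarrow> l"
    then have "\<forall>n. \<exists>z. u n = g z" by auto
    then obtain v where v: "\<And>n. u n = g (v n)" by metis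
    have "Cauchy u" using u(2) by (rule LIMSEQ_imp_Cauchy)
    then have "Cauchy v" by (simp add: Cauchy_def v iso)
    then obtain m where "v \<longlonglongrightarrow> m" using Cauchy_convergent convergent_def by blast
    then have "(\<lambda>n. g (v n)) \<longlonglongrightarrow> g m"
      by (rule continuous_on_tendsto_compose[OF cont]) auto
    then have "u \<longlonglongrightarrow> g m" by (simp add: v[abs_def])
    then show "l \<in> range g" using u(2) LIMSEQ_unique by blast
  qed
  moreover have "range t \<subseteq> range g" using gs by (metis image_subsetI rangeI)
  ultimately have "surj g" using closure_minimal[of "range t" "range g"] t by auto
  with gs iso show thesis by (rule that)
qed

locale full_support_mm_space =
  fixes \<mu> :: "'a::polish_space measure"
  assumes mm: "mm_space UNIV dist \<mu>"
begin

lemmas sets_\<mu> = mm_spaceD(1)[OF mm]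

lemma space_\<mu>: "space \<mu> = UNIV"
  using sets_eq_imp_space_eq[OF sets_\<mu>] by simp

sublocale prob_\<mu>: prob_space \<mu>
  by (rule mm_spaceD(2)[OF mm])

sublocale sequence_space \<mu>
  by (unfold_locales)

lemma measure_open_pos: "open U \<Longrightarrow> U \<noteq> {} \<Longrightarrow> measure \<mu> U > 0"
  using mm_spaceD(3)[OF mm] by (simp add: prob_\<mu>.emeasure_eq_measure)

text \<open>Makes \<open>S\<close> a Borel measure on a Polish space, so that continuous functions
  of sequences are measurable and inner regularity by compact sets is available.\<close>

lemma sets_S: "sets S = sets borel"
proof -
  have "sets S = sets (PiM UNIV (\<lambda>_::nat. borel :: 'a measure))"
    by (rule sets_PiM_cong) (simp_all add: sets_\<mu>)
  then show ?thesis by (simp add: sets_PiM_equal_borel)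
qed

lemma space_S: "space S = UNIV"
  using sets_eq_imp_space_eq[OF sets_S] by simp

lemma indep_vars_component: "P.indep_vars (\<lambda>_. \<mu>) (\<lambda>i w. w i) UNIV"
proof (subst P.indep_vars_iff_distr_eq_PiM)
  have "distr S S (\<lambda>w. \<lambda>i\<in>UNIV. w i) = distr S S (\<lambda>w. w)" by (simp add: restrict_UNIV)
  then show "distr S S (\<lambda>w. \<lambda>i\<in>UNIV. w i) = PiM UNIV (\<lambda>i. distr S \<mu> (\<lambda>w. w i))"
    by (simp add: distr_id PiM_component)
qed auto

section \<open>Empirical frequencies and equidistribution\<close>

definition frequency :: "(nat \<Rightarrow> 'a) \<Rightarrow> 'a set \<Rightarrow> nat \<Rightarrow> real" where
  "frequency w A n = (\<Sum>m<n. indicator A (w m)) / real n"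

text \<open>Hoeffding's inequality for the indicators of \<open>A\<close>; what matters is that the
  bound is geometric in \<open>n\<close>, hence summable.\<close>

lemma frequency_deviation:
  assumes A: "A \<in> sets \<mu>" and e: "e > 0" and n: "n > 0"
  shows "{w \<in> space S. e \<le> \<bar>frequency w A n - measure \<mu> A\<bar>} \<in> sets S"
    "measure S {w \<in> space S. e \<le> \<bar>frequency w A n - measure \<mu> A\<bar>} \<le> 2 * exp (- 2 * e\<^sup>2) ^ n"
proof -
  let ?X = "\<lambda>m w. indicator A (w m) :: real"
  have [measurable]: "A \<in> sets \<mu>" by fact
  show "{w \<in> space S. e \<le> \<bar>frequency w A n - measure \<mu> A\<bar>} \<in> sets S"
    unfolding frequency_def by measurable
  have exp_X: "P.expectation (?X m) = measure \<mu> A" and distr_X: "distr S borel (?X m) = distr \<mu> borel (indicator A)" for m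
  proof -
    have "distr S borel (?X m) = distr (distr S \<mu> (\<lambda>w. w m)) borel (indicator A)"
      by (subst distr_distr) (auto simp: comp_def)
    then show eq: "distr S borel (?X m) = distr \<mu> borel (indicator A)" by (simp add: PiM_component)
    have "P.expectation (?X m) = integral\<^sup>L (distr S borel (?X m)) (\<lambda>x. x)"
      by (subst integral_distr) auto
    also have "\<dots> = measure \<mu> A" unfolding eq by (subst integral_distr) (auto simp: space_\<mu>)
    finally show "P.expectation (?X m) = measure \<mu> A" .
  qed
  have indep: "P.indep_vars (\<lambda>_. borel) ?X {..<n}"
    by (rule P.indep_vars_subset[OF P.indep_vars_compose2[OF indep_vars_component,
        where Y = "\<lambda>_. indicator A" and N = "\<lambda>_. borel"]]) simp_all
  interpret H: Hoeffding_ineq_iid S "{..<n}" ?X "?X 0" 0 1 "P.expectation (?X 0)"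
  proof unfold_locales
    show "finite {..<n}" by simp
    show "P.indep_vars (\<lambda>_. borel) ?X {..<n}" by (rule indep)
    show "distr S borel (?X i) = distr S borel (?X 0)" for i by (simp only: distr_X)
    show "?X 0 \<in> borel_measurable S" by measurable
    show "AE w in S. ?X 0 w \<in> {0..1}" by (intro AE_I2) (simp split: split_indicator)
  qed
  have "{..<n} \<noteq> {}" using n by auto
  from H.Hoeffding_ineq_abs_ge'[OF less_imp_le[OF e] _ this]
  have "measure S {w \<in> space S. e \<le> \<bar>frequency w A n - measure \<mu> A\<bar>} \<le> 2 * exp (- 2 * real n * e\<^sup>2)"
    by (simp add: exp_X frequency_def)
  also have "exp (- 2 * real n * e\<^sup>2) = exp (- 2 * e\<^sup>2) ^ n"
    by (simp add: exp_of_nat_mult[symmetric] mult_ac)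
  finally show "measure S {w \<in> space S. e \<le> \<bar>frequency w A n - measure \<mu> A\<bar>} \<le> 2 * exp (- 2 * e\<^sup>2) ^ n" .
qed

text \<open>Borel-Cantelli with the geometric deviation bounds, for the countably many tolerances
  \<open>1 / Suc j\<close>.\<close>

lemma strong_law_frequency:
  assumes A: "A \<in> sets \<mu>"
  shows "AE w in S. frequency w A \<longlonglongrightarrow> measure \<mu> A"
proof -
  have "AE w in S. \<forall>j::nat. eventually (\<lambda>n. \<bar>frequency w A n - measure \<mu> A\<bar> < 1 / Suc j) sequentially"
  proof (subst AE_all_countable, intro allI)
    fix j :: nat
    define e where "e = 1 / real (Suc j)"
    have e: "e > 0" by (simp add: e_def)
    \<comment> \<open>Shifted by one, since the deviation bound is stated for
      \<open>n > 0\<close>.\<close>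
    let ?B = "\<lambda>n. {w \<in> space S. e \<le> \<bar>frequency w A (Suc n) - measure \<mu> A\<bar>}"
    have "summable (\<lambda>n. 2 * exp (- 2 * e\<^sup>2) ^ Suc n)"
      using e by (intro summable_mult summable_ignore_initial_segment[of _ 1, simplified] summable_geometric) auto
    then have "summable (\<lambda>n. measure S (?B n))"
    proof (rule summable_comparison_test'[of _ 0])
      show "norm (measure S (?B n)) \<le> 2 * exp (- 2 * e\<^sup>2) ^ Suc n" for n
        using frequency_deviation(2)[OF A e, of "Suc n"] by simp
    qed
    then have "AE w in S. eventually (\<lambda>n. w \<in> space S - ?B n) sequentially"
    proof (rule borel_cantelli_AE1[rotated 2])
      show "?B n \<in> sets S" for n by (rule frequency_deviation(1)[OF A e]) simp
      show "emeasure S (?B n) < \<infinity>" for n by (simp add: P.emeasure_eq_measure)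
    qed
    then show "AE w in S. eventually (\<lambda>n. \<bar>frequency w A n - measure \<mu> A\<bar> < 1 / Suc j) sequentially"
    proof (rule AE_mp, intro AE_I2 impI)
      fix w assume "eventually (\<lambda>n. w \<in> space S - ?B n) sequentially"
      then have "eventually (\<lambda>n. \<bar>frequency w A (Suc n) - measure \<mu> A\<bar> < 1 / Suc j) sequentially"
        by (rule eventually_mono) (auto simp: e_def not_le)
      then show "eventually (\<lambda>n. \<bar>frequency w A n - measure \<mu> A\<bar> < 1 / Suc j) sequentially"
        by (subst (asm) eventually_sequentially_Suc)
    qed
  qed
  then show ?thesis
  proof (rule AE_mp, intro AE_I2 impI)
    fix w
    assume w: "\<forall>j::nat. eventually (\<lambda>n. \<bar>frequency w A n - measure \<mu> A\<bar> < 1 / Suc j) sequentially"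
    show "frequency w A \<longlonglongrightarrow> measure \<mu> A"
      unfolding tendsto_iff dist_real_def
    proof (intro allI impI)
      fix e :: real assume "e > 0"
      then obtain j where "1 / real (Suc j) < e" using nat_approx_posE by blast
      with w show "eventually (\<lambda>n. \<bar>frequency w A n - measure \<mu> A\<bar> < e) sequentially"
        by (auto elim!: allE[of _ j] eventually_mono)
    qed
  qed
qed

lemma frequency_mono: "A \<subseteq> B \<Longrightarrow> frequency w A n \<le> frequency w B n"
  unfolding frequency_def by (intro divide_right_mono sum_mono) (auto simp: indicator_def)

text \<open>Weak convergence of the empirical measures to \<open>\<mu>\<close>, in the form of the portmanteau theorem for
  open sets.\<close>

definition equidistributed :: "(nat \<Rightarrow> 'a) \<Rightarrow> bool" where
  "equidistributed w \<longleftrightarrow>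
     (\<forall>U c. open U \<longrightarrow> c < measure \<mu> U \<longrightarrow> eventually (\<lambda>n. c < frequency w U n) sequentially)"

text \<open>An open set is an increasing union of finite unions of basic sets. These are countably
  many, so a single null set serves for all of them, and monotonicity of the frequencies transfers
  the lower bound to the open set.\<close>

lemma AE_equidistributed: "AE w in S. equidistributed w"
proof -
  obtain B :: "'a set set" where B: "countable B" "topological_basis B"
    using ex_countable_basis by blast
  define F where "F = {\<Union>C |C. finite C \<and> C \<subseteq> B}"
  have "F = Union ` {C. finite C \<and> C \<subseteq> B}" by (auto simp: F_def)
  then have "countable F" using countable_Collect_finite_subset[OF B(1)] by simp
  moreover have "AE w in S. frequency w A \<longlonglongrightarrow> measure \<mu> A" if AF: "A \<in> F" for A
  proof (rule strong_law_frequency)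
    obtain C where "A = \<Union>C" "C \<subseteq> B" using AF by (auto simp: F_def)
    then have "open A" using topological_basis_open[OF B(2)] by (auto intro: open_Union)
    then show "A \<in> sets \<mu>" by (simp add: sets_\<mu>)
  qed
  ultimately have "AE w in S. \<forall>A\<in>F. frequency w A \<longlonglongrightarrow> measure \<mu> A"
    by (simp add: AE_ball_countable)
  then show ?thesis
  proof (rule AE_mp, intro AE_I2 impI)
    fix w assume w: "\<forall>A\<in>F. frequency w A \<longlonglongrightarrow> measure \<mu> A"
    show "equidistributed w"
      unfolding equidistributed_def
    proof (intro allI impI)
      fix U and c :: real assume U: "open U" and c: "c < measure \<mu> U"
      obtain B' where B': "B' \<subseteq> B" "\<Union>B' = U"
        using B(2) U unfolding topological_basis_def by blast
      \<comment> \<open>The empty set is inserted so that the family to be enumerated is nonempty;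
        the union does not change.\<close>
      define b where "b = from_nat_into (insert {} B')"
      have "countable (insert {} B')" using B(1) B'(1) countable_subset by auto
      then have rb: "range b = insert {} B'" unfolding b_def by (intro range_from_nat_into) auto
      define A where "A n = (\<Union>i<n. b i)" for n :: nat
      have bo: "open (b i)" for i
        using rb B'(1) topological_basis_open[OF B(2)] by (metis insertE open_empty rangeI subsetD)
      have "(\<lambda>n. measure \<mu> (A n)) \<longlonglongrightarrow> measure \<mu> (\<Union>n. A n)"
      proof (rule prob_\<mu>.finite_Lim_measure_incseq)
        show "range A \<subseteq> sets \<mu>" using bo by (auto simp: sets_\<mu> A_def)
        show "incseq A" by (force simp: incseq_def A_def)
      qed
      moreover have "(\<Union>n. A n) = U"
      proof -
        have "(\<Union>n. A n) = \<Union>(range b)" by (auto simp: A_def)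
        then show ?thesis using rb B'(2) by simp
      qed
      ultimately have "eventually (\<lambda>n. c < measure \<mu> (A n)) sequentially"
        using c by (intro order_tendstoD) auto
      then obtain n where n: "c < measure \<mu> (A n)" by (auto simp: eventually_sequentially)
      have "A n = \<Union>(b ` {..<n} - {{}})" by (auto simp: A_def)
      moreover have "b ` {..<n} - {{}} \<subseteq> B" using rb B'(1) by blast
      ultimately have "A n \<in> F" unfolding F_def by blast
      then have "frequency w (A n) \<longlonglongrightarrow> measure \<mu> (A n)" using w by blast
      then have "eventually (\<lambda>k. c < frequency w (A n) k) sequentially"
        using n by (rule order_tendstoD)
      moreover have "A n \<subseteq> U" using \<open>(\<Union>n. A n) = U\<close> by blast
      then have "frequency w (A n) k \<le> frequency w U k" for k by (rule frequency_mono)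
      ultimately show "eventually (\<lambda>k. c < frequency w U k) sequentially"
        by (elim eventually_mono less_le_trans)
    qed
  qed
qed

text \<open>Otherwise the complement of the closure is an open set of positive mass that is never
  visited.\<close>

lemma equidistributed_dense:
  assumes "equidistributed w"
  shows "closure (range w) = UNIV"
proof (rule ccontr)
  assume ne: "closure (range w) \<noteq> UNIV"
  let ?U = "- closure (range w)"
  have "measure \<mu> ?U > 0" using ne by (intro measure_open_pos) auto
  then have "eventually (\<lambda>n. 0 < frequency w ?U n) sequentially"
    using assms unfolding equidistributed_def by (metis closed_closure open_Compl)
  then obtain n where "0 < frequency w ?U n" by (auto simp: eventually_sequentially)
  moreover have "indicator ?U (w m) = (0 :: real)" for m
    using subsetD[OF closure_subset rangeI, of w m] by simp
  then have "frequency w ?U n = 0" by (simp only: frequency_def sum.neutral_const div_0)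
  ultimately show False by simp
qed

text \<open>The visits of \<open>s\<close> to the preimage of a set are the visits of
  \<open>t\<close> to the set itself. Equidistribution only gives lower bounds on open sets, so an
  upper bound for a closed set has to come from its complement.\<close>

lemma isometry_preserves_measure:
  assumes s: "equidistributed s" and t: "equidistributed t" and gs: "\<And>n. g (s n) = t n"
    and iso: "\<And>x y. dist (g x) (g y) = dist x y"
  shows "distr \<mu> \<mu> g = \<mu>"
proof -
  have cont: "continuous_on UNIV g" by (rule isometry_continuous) fact
  then have "g \<in> borel_measurable borel" by (rule borel_measurable_continuous_onI)
  then have gm: "g \<in> measurable \<mu> \<mu>" by (simp cong: measurable_cong_sets add: sets_\<mu>)
  interpret g: prob_space "distr \<mu> \<mu> g" by (rule prob_\<mu>.prob_space_distr[OF gm])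
  \<comment> \<open>\<open>U\<close> and the complement of \<open>C\<close> are disjoint open sets.
    If the claim failed, their frequencies along \<open>t\<close> would eventually exceed
    \<open>c\<close> and \<open>1 - c\<close>, although they add up to at most 1.\<close>
  have *: "measure (distr \<mu> \<mu> g) U \<le> measure \<mu> C" if U: "open U" and C: "closed C" and UC: "U \<subseteq> C" for U C
  proof (rule ccontr)
    assume "\<not> ?thesis"
    then obtain c where c: "measure \<mu> C < c" "c < measure (distr \<mu> \<mu> g) U" using dense by (auto simp: not_le)
    have "c < measure \<mu> (g -` U)" using c(2) U by (simp add: measure_distr[OF gm] sets_\<mu> space_\<mu>)
    moreover have "open (g -` U)" using cont U by (intro open_vimage)
    ultimately have "eventually (\<lambda>n. c < frequency s (g -` U) n) sequentially"
      using s unfolding equidistributed_def by blast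
    moreover have "frequency s (g -` U) n = frequency t U n" for n
      by (simp add: frequency_def indicator_def gs)
    moreover have "measure \<mu> (- C) = 1 - measure \<mu> C"
      using prob_\<mu>.prob_compl[of C] C by (simp add: sets_\<mu> space_\<mu> Compl_eq_Diff_UNIV)
    then have "1 - c < measure \<mu> (- C)" using c(1) by simp
    then have "eventually (\<lambda>n. 1 - c < frequency t (- C) n) sequentially"
      using t C unfolding equidistributed_def by (metis open_Compl)
    ultimately have "eventually (\<lambda>n. c < frequency t U n \<and> 1 - c < frequency t (- C) n \<and> 0 < n) sequentially"
      using eventually_gt_at_top[of 0] by (simp add: eventually_conj_iff)
    then obtain n where n: "c < frequency t U n" "1 - c < frequency t (- C) n" "0 < n"
      by (auto simp: eventually_sequentially)
    have "frequency t U n + frequency t (- C) n \<le> frequency t UNIV n"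
      unfolding frequency_def add_divide_distrib[symmetric] sum.distrib[symmetric]
      using UC by (intro divide_right_mono sum_mono) (auto simp: indicator_def)
    then show False using n by (simp add: frequency_def)
  qed
  show ?thesis
  proof (rule measure_eqI_closed_le[OF g.prob_space_axioms prob_\<mu>.prob_space_axioms _ sets_\<mu>])
    show "sets (distr \<mu> \<mu> g) = sets borel" by (simp add: sets_\<mu>)
    fix C :: "'a set" assume C: "closed C"
    show "measure (distr \<mu> \<mu> g) C \<le> measure \<mu> C"
    proof (cases "C = {}")
      case False
      have "(\<lambda>n. measure \<mu> {x. infdist x C \<le> 1 / real (Suc n)}) \<longlonglongrightarrow> measure \<mu> C"
        by (rule measure_closed_neighbourhoods_tendsto[OF prob_\<mu>.finite_measure_axioms sets_\<mu> C False])
      moreover have "measure (distr \<mu> \<mu> g) C \<le> measure \<mu> {x. infdist x C \<le> 1 / real (Suc n)}" for n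
      proof -
        have "open {x. infdist x C < 1 / real (Suc n)}" by (intro open_Collect_less continuous_intros)
        moreover have "closed {x. infdist x C \<le> 1 / real (Suc n)}" by (intro closed_Collect_le continuous_intros)
        moreover have "measure (distr \<mu> \<mu> g) C \<le> measure (distr \<mu> \<mu> g) {x. infdist x C < 1 / real (Suc n)}"
          using calculation(1) by (intro g.finite_measure_mono) (auto simp: sets_\<mu>)
        ultimately show ?thesis
          using *[of "{x. infdist x C < 1 / real (Suc n)}" "{x. infdist x C \<le> 1 / real (Suc n)}"] by force
      qed
      ultimately show ?thesis by (intro LIMSEQ_le_const[of _ "measure \<mu> C"]) auto
    qed simp
  qed
qed

text \<open>Unlike in \<open>dist_matrix\<close>, the base point has index 0 and all pairs of
  indices are filled in, so the matrix is an element of a full function type with its product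
  topology.\<close>

definition pointed_matrix :: "'a \<Rightarrow> (nat \<Rightarrow> 'a) \<Rightarrow> nat \<times> nat \<Rightarrow> real" where
  "pointed_matrix x w = (\<lambda>(i, j). dist (case_nat x w i) (case_nat x w j))"

lemma continuous_on_pointed_matrix: "continuous_on UNIV (pointed_matrix x)"
proof (rule continuous_on_coordinatewise_then_product)
  fix p :: "nat \<times> nat"
  have "continuous_on UNIV (\<lambda>w :: nat \<Rightarrow> 'a. case_nat x w i)" for i
    by (cases i) (auto intro: continuous_on_product_coordinates)
  then show "continuous_on UNIV (\<lambda>w. pointed_matrix x w p)"
    unfolding pointed_matrix_def by (cases p) (auto intro: continuous_on_dist)
qed

lemma measurable_pointed_matrix: "pointed_matrix x \<in> borel_measurable S"
  using borel_measurable_continuous_onI[OF continuous_on_pointed_matrix]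
  by (simp cong: measurable_cong_sets add: sets_S)

text \<open>By inner regularity, most equidistributed sequences lie in a compact set. Two compact sets of
  matrices of probability more than one half each must meet, which yields two equidistributed
  sequences with the same matrix; the images of Borel sets need not be measurable.\<close>

lemma equal_pointed_matrices:
  assumes law: "distr S borel (pointed_matrix x) = distr S borel (pointed_matrix y)"
  obtains s t where "equidistributed s" "equidistributed t" "pointed_matrix x s = pointed_matrix y t"
proof -
  obtain N where N: "{w \<in> space S. \<not> equidistributed w} \<subseteq> N" "emeasure S N = 0" "N \<in> sets S"
    using AE_E[OF AE_equidistributed] by blast
  \<comment> \<open>Working with the complement of a null set avoids the question whether the
    equidistributed sequences form a measurable set.\<close>
  define E where "E = UNIV - N"
  have E: "E \<in> sets borel" using N(3) sets_S by (auto simp: E_def)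
  have "emeasure S E = 1"
    using P.prob_compl[OF N(3)] N(2) by (simp add: E_def space_S P.emeasure_eq_measure)
  then have "(SUP K\<in>{K. K \<subseteq> E \<and> compact K}. emeasure S K) = 1"
    using inner_regular[OF sets_S _ E] by simp
  moreover have "ennreal (1/2) < 1" by (subst ennreal_less_one_iff) simp
  ultimately have "ennreal (1/2) < (SUP K\<in>{K. K \<subseteq> E \<and> compact K}. emeasure S K)" by (simp only:)
  then obtain K where K: "K \<subseteq> E" "compact K" "ennreal (1/2) < emeasure S K"
    by (auto simp: less_SUP_iff)
  define Q where "Q z = pointed_matrix z ` K" for z
  have cQ: "compact (Q z)" for z
    unfolding Q_def by (intro compact_continuous_image K continuous_on_subset[OF continuous_on_pointed_matrix]) simp
  then have mQ: "Q z \<in> sets borel" for z by (simp add: compact_imp_closed)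
  interpret L: prob_space "distr S borel (pointed_matrix x)"
    by (rule P.prob_space_distr[OF measurable_pointed_matrix])
  have half: "1/2 < measure (distr S borel (pointed_matrix z)) (Q z)" for z
  proof -
    have "1/2 < measure S K" using K(3) unfolding P.emeasure_eq_measure by (subst (asm) ennreal_less_iff) auto
    also have "\<dots> \<le> measure S (pointed_matrix z -` Q z \<inter> space S)"
      using measurable_sets[OF measurable_pointed_matrix mQ]
      by (intro P.finite_measure_mono) (auto simp: Q_def space_S)
    also have "\<dots> = measure (distr S borel (pointed_matrix z)) (Q z)"
      using mQ by (simp add: measure_distr[OF measurable_pointed_matrix])
    finally show ?thesis .
  qed
  have "Q x \<inter> Q y \<noteq> {}"
  proof
    assume "Q x \<inter> Q y = {}"
    then have "L.prob (Q x \<union> Q y) = L.prob (Q x) + L.prob (Q y)"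
      using mQ by (intro L.finite_measure_Union) auto
    moreover have "L.prob (Q x \<union> Q y) \<le> 1" by (rule L.prob_le_1)
    ultimately show False using half[of x] half[of y] by (simp add: law)
  qed
  then obtain s t where "s \<in> K" "t \<in> K" "pointed_matrix x s = pointed_matrix y t"
    unfolding Q_def by blast
  moreover have "equidistributed w" if "w \<in> K" for w
    using that K(1) N(1) by (auto simp: E_def space_S)
  ultimately show thesis using that by blast
qed

text \<open>The points \<open>g x\<close> and \<open>y\<close> have the same distances to all terms
  of the dense sequence \<open>t\<close>, so the isometry that matches the two sequences also sends
  \<open>x\<close> to \<open>y\<close>.\<close>

theorem isomorphism_of_equal_laws:
  assumes law: "distr S borel (pointed_matrix x) = distr S borel (pointed_matrix y)"
  shows "\<exists>g\<in>carrier (Isomp \<mu>). g x = y"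
proof -
  obtain s t where st: "equidistributed s" "equidistributed t" "pointed_matrix x s = pointed_matrix y t"
    by (rule equal_pointed_matrices[OF law])
  have eq: "dist (case_nat x s i) (case_nat x s j) = dist (case_nat y t i) (case_nat y t j)" for i j
    using fun_cong[OF st(3), of "(i, j)"] by (simp add: pointed_matrix_def)
  have ss: "dist (s i) (s j) = dist (t i) (t j)" for i j using eq[of "Suc i" "Suc j"] by simp
  have xs: "dist x (s j) = dist y (t j)" for j using eq[of 0 "Suc j"] by simp
  have dense: "closure (range s) = UNIV" "closure (range t) = UNIV"
    by (rule equidistributed_dense[OF st(1)], rule equidistributed_dense[OF st(2)])
  obtain g where g: "\<And>n. g (s n) = t n" "\<And>x y. dist (g x) (g y) = dist x y" "surj g"
    using isometry_of_dense_sequences[OF dense ss] by metis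
  have "closed {z. dist (g x) z = dist y z}" by (intro closed_Collect_eq continuous_intros)
  moreover have "range t \<subseteq> {z. dist (g x) z = dist y z}"
    using g(2)[of x "s _"] xs by (auto simp: g(1))
  ultimately have "closure (range t) \<subseteq> {z. dist (g x) z = dist y z}" by (rule closure_minimal[rotated])
  \<comment> \<open>By density the distances to \<open>g x\<close> and to \<open>y\<close> agree at
    every point, in particular at \<open>y\<close> itself.\<close>
  then have "dist (g x) y = dist y y" unfolding dense(2) by blast
  then have "g x = y" by simp
  moreover have "distr \<mu> \<mu> g = \<mu>" by (rule isometry_preserves_measure[OF st(1,2) g(1,2)])
  ultimately show ?thesis using g by (intro bexI[of _ g]) (simp_all add: carrier_Isomp_iff[OF sets_\<mu>])
qed

section \<open>Laws of pointed matrices under isomorphisms\<close>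

abbreviation law :: "'a \<Rightarrow> (nat \<times> nat \<Rightarrow> real) measure" where
  "law x \<equiv> distr S borel (pointed_matrix x)"

text \<open>Applying \<open>g\<close> in each coordinate leaves the coordinates independent with law
  \<open>\<mu>\<close>, and this determines the law of the sequence.\<close>

lemma distr_Isomp_sequence:
  assumes g: "g \<in> carrier (Isomp \<mu>)"
  shows "distr S S (\<lambda>w n. g (w n)) = S"
proof -
  have gm: "g \<in> measurable \<mu> \<mu>" "distr \<mu> \<mu> g = \<mu>"
    using measurable_Isomp[OF g] g by (simp_all add: carrier_Isomp_iff[OF sets_\<mu>])
  have indep: "P.indep_vars (\<lambda>_. \<mu>) (\<lambda>i w. g (w i)) UNIV"
    by (rule P.indep_vars_compose2[OF indep_vars_component, where Y = "\<lambda>_. g" and N = "\<lambda>_. \<mu>"]) (rule gm)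
  have m: "(\<lambda>w. g (w i)) \<in> measurable S \<mu>" for i
    by (rule measurable_compose[OF _ gm(1)]) simp
  have "distr S \<mu> (\<lambda>w. g (w i)) = \<mu>" for i
  proof -
    have "distr S \<mu> (\<lambda>w. g (w i)) = distr (distr S \<mu> (\<lambda>w. w i)) \<mu> g"
      by (subst distr_distr[OF gm(1)]) (simp_all add: comp_def)
    then show ?thesis by (simp add: PiM_component gm)
  qed
  then show ?thesis
    using indep P.indep_vars_iff_distr_eq_PiM[where I = UNIV and M' = "\<lambda>_. \<mu>" and X = "\<lambda>i w. g (w i)"] m
    by (simp add: restrict_UNIV)
qed

text \<open>Moving the base point and the whole sequence by \<open>g\<close> changes neither the
  distances nor the law of the sequence.\<close>

lemma law_Isomp:
  assumes g: "g \<in> carrier (Isomp \<mu>)"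
  shows "law (g x) = law x"
proof -
  have gm: "g \<in> measurable \<mu> \<mu>" and iso: "\<And>u v. dist (g u) (g v) = dist u v"
    using measurable_Isomp[OF g] g by (simp_all add: carrier_Isomp_iff[OF sets_\<mu>])
  have m: "(\<lambda>w n. g (w n)) \<in> measurable S S"
    by (rule measurable_PiM_single') (auto intro: measurable_compose[OF _ gm] simp: space_\<mu>)
  have "case_nat (g x) (\<lambda>n. g (w n)) i = g (case_nat x w i)" for w i
    by (cases i) simp_all
  then have eq: "pointed_matrix (g x) (\<lambda>n. g (w n)) = pointed_matrix x w" for w
    by (simp add: pointed_matrix_def iso)
  have "law (g x) = distr (distr S S (\<lambda>w n. g (w n))) borel (pointed_matrix (g x))"
    by (simp only: distr_Isomp_sequence[OF g])
  also have "\<dots> = distr S borel (pointed_matrix (g x) \<circ> (\<lambda>w n. g (w n)))"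
    by (rule distr_distr[OF measurable_pointed_matrix m])
  also have "pointed_matrix (g x) \<circ> (\<lambda>w n. g (w n)) = pointed_matrix x"
    by (simp add: fun_eq_iff eq)
  finally show ?thesis .
qed

theorem transitive_iff_law_constant:
  "(\<forall>x y. \<exists>g\<in>carrier (Isomp \<mu>). g x = y) \<longleftrightarrow> (\<forall>x y. law x = law y)"
  using law_Isomp isomorphism_of_equal_laws by metis

lemma measurable_head_tail: "(\<lambda>w. (w 0, \<lambda>n. w (Suc n))) \<in> measurable S (\<mu> \<Otimes>\<^sub>M S)"
  by (intro measurable_Pair measurable_PiM_single') (auto simp: space_\<mu>)

text \<open>Splitting off the first term inverts the map that prepends an independent term, whose
  image measure is known to be \<open>S\<close>.\<close>

lemma distr_head_tail: "distr S (\<mu> \<Otimes>\<^sub>M S) (\<lambda>w. (w 0, \<lambda>n. w (Suc n))) = \<mu> \<Otimes>\<^sub>M S"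
proof -
  have "distr S (\<mu> \<Otimes>\<^sub>M S) (\<lambda>w. (w 0, \<lambda>n. w (Suc n))) =
      distr (distr (\<mu> \<Otimes>\<^sub>M S) S (\<lambda>(s, w). case_nat s w)) (\<mu> \<Otimes>\<^sub>M S) (\<lambda>w. (w 0, \<lambda>n. w (Suc n)))"
    by (simp only: PiM_iter)
  also have "\<dots> = distr (\<mu> \<Otimes>\<^sub>M S) (\<mu> \<Otimes>\<^sub>M S) ((\<lambda>w. (w 0, \<lambda>n. w (Suc n))) \<circ> (\<lambda>(s, w). case_nat s w))"
    by (rule distr_distr[OF measurable_head_tail]) measurable
  also have "(\<lambda>w. (w 0, \<lambda>n. w (Suc n))) \<circ> (\<lambda>(s, w). case_nat s w) = (\<lambda>p :: 'a \<times> (nat \<Rightarrow> 'a). p)"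
    by (auto simp: fun_eq_iff)
  finally show ?thesis by (simp add: distr_id)
qed

lemma distr_shift_sequence: "distr S S (\<lambda>w n. w (Suc n)) = S"
  using distr_PiM_reindex[of UNIV "\<lambda>_. \<mu>" Suc UNIV] prob_\<mu>.prob_space_axioms
  by (simp add: restrict_UNIV)

lemma measurable_pointed_matrix_pair:
  "(\<lambda>(x, w). pointed_matrix x w) \<in> borel_measurable (\<mu> \<Otimes>\<^sub>M S)"
proof (rule measurable_coordinatewise_then_product)
  fix p :: "nat \<times> nat"
  have c: "(\<lambda>q. case_nat (fst q) (snd q) i) \<in> borel_measurable (\<mu> \<Otimes>\<^sub>M S)" for i
  proof -
    have "(\<lambda>q. case_nat (fst q) (snd q) i) \<in> measurable (\<mu> \<Otimes>\<^sub>M S) \<mu>"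
      by (rule measurable_case_nat) simp_all
    then show ?thesis by (simp cong: measurable_cong_sets add: sets_\<mu>)
  qed
  show "(\<lambda>q. (case q of (x, w) \<Rightarrow> pointed_matrix x w) p) \<in> borel_measurable (\<mu> \<Otimes>\<^sub>M S)"
    using borel_measurable_dist[OF c c, of "fst p" "snd p"]
    by (simp add: pointed_matrix_def case_prod_beta')
qed

section \<open>Conditional means and their variance\<close>

definition mean :: "((nat \<times> nat \<Rightarrow> real) \<Rightarrow> real) \<Rightarrow> 'a \<Rightarrow> real" where
  "mean \<Phi> x = (\<integral>w. \<Phi> (pointed_matrix x w) \<partial>S)"

context
  fixes \<Phi> :: "(nat \<times> nat \<Rightarrow> real) \<Rightarrow> real" and B :: real
  assumes cont: "continuous_on UNIV \<Phi>" and bounded: "\<And>D. \<bar>\<Phi> D\<bar> \<le> B"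
begin

lemma measurable_\<Phi>: "\<Phi> \<in> borel_measurable borel"
  by (rule borel_measurable_continuous_onI[OF cont])

lemma mean_eq_integral_law: "mean \<Phi> x = integral\<^sup>L (law x) \<Phi>"
  unfolding mean_def by (rule integral_distr[OF measurable_pointed_matrix measurable_\<Phi>, symmetric])

lemma integrable_\<Phi>: "integrable S (\<lambda>w. \<Phi> (pointed_matrix x w))"
  using measurable_compose[OF measurable_pointed_matrix measurable_\<Phi>] bounded
  by (intro P.integrable_const_bound[of _ B]) auto

lemma abs_mean_le: "\<bar>mean \<Phi> x\<bar> \<le> B"
proof -
  have "\<bar>mean \<Phi> x\<bar> \<le> (\<integral>w. \<bar>\<Phi> (pointed_matrix x w)\<bar> \<partial>S)"
    unfolding mean_def by (rule integral_abs_bound)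
  also have "\<dots> \<le> B"
    using bounded integrable_\<Phi> by (intro P.integral_le_const) auto
  finally show ?thesis .
qed

text \<open>For a fixed sequence the pointed matrix is continuous in the base point, and the bound
  on \<Phi> allows dominated convergence. Continuity later turns an almost sure statement about the
  mean into one about every point.\<close>

lemma continuous_on_mean: "continuous_on UNIV (mean \<Phi>)"
proof (rule continuous_on_sequentiallyI)
  fix u :: "nat \<Rightarrow> 'a" and a assume u: "u \<longlonglongrightarrow> a"
  show "(\<lambda>n. mean \<Phi> (u n)) \<longlonglongrightarrow> mean \<Phi> a"
    unfolding mean_def
  proof (rule integral_dominated_convergence[where w = "\<lambda>_. B"])
    show "(\<lambda>w. \<Phi> (pointed_matrix a w)) \<in> borel_measurable S"
      "(\<lambda>w. \<Phi> (pointed_matrix (u n) w)) \<in> borel_measurable S" for n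
      using integrable_\<Phi> by (auto dest: borel_measurable_integrable)
    show "AE w in S. (\<lambda>n. \<Phi> (pointed_matrix (u n) w)) \<longlonglongrightarrow> \<Phi> (pointed_matrix a w)"
    proof (rule AE_I2)
      fix w
      have "continuous_on UNIV (\<lambda>x. pointed_matrix x w)"
      proof (rule continuous_on_coordinatewise_then_product)
        fix p :: "nat \<times> nat"
        have "continuous_on UNIV (\<lambda>x. case_nat x w i)" for i by (cases i) simp_all
        then show "continuous_on UNIV (\<lambda>x. pointed_matrix x w p)"
          unfolding pointed_matrix_def by (cases p) (auto intro: continuous_on_dist)
      qed
      then have "continuous_on UNIV (\<lambda>x. \<Phi> (pointed_matrix x w))"
        using continuous_on_compose2[OF cont] by blast
      then show "(\<lambda>n. \<Phi> (pointed_matrix (u n) w)) \<longlonglongrightarrow> \<Phi> (pointed_matrix a w)"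
        using u by (rule continuous_on_tendsto_compose) simp_all
    qed
  qed (use bounded in auto)
qed

lemma measurable_mean: "mean \<Phi> \<in> borel_measurable \<mu>"
  using borel_measurable_continuous_onI[OF continuous_on_mean]
  by (simp cong: measurable_cong_sets add: sets_\<mu>)

lemma variance_mean_eq_0_iff:
  fixes m :: real
  shows "(\<integral>x. (mean \<Phi> x - m)\<^sup>2 \<partial>\<mu>) = 0 \<longleftrightarrow> (\<forall>x. mean \<Phi> x = m)"
proof
  assume z: "(\<integral>x. (mean \<Phi> x - m)\<^sup>2 \<partial>\<mu>) = 0"
  have "integrable \<mu> (\<lambda>x. (mean \<Phi> x - m)\<^sup>2)"
  proof (rule prob_\<mu>.integrable_const_bound[of _ "(B + \<bar>m\<bar>)\<^sup>2"])
    show "AE x in \<mu>. norm ((mean \<Phi> x - m)\<^sup>2) \<le> (B + \<bar>m\<bar>)\<^sup>2"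
    proof (rule AE_I2)
      fix x
      have "\<bar>mean \<Phi> x - m\<bar> \<le> B + \<bar>m\<bar>" using abs_mean_le[of x] by linarith
      then have "\<bar>mean \<Phi> x - m\<bar>\<^sup>2 \<le> (B + \<bar>m\<bar>)\<^sup>2" by (rule power_mono) simp
      then show "norm ((mean \<Phi> x - m)\<^sup>2) \<le> (B + \<bar>m\<bar>)\<^sup>2" by simp
    qed
    show "(\<lambda>x. (mean \<Phi> x - m)\<^sup>2) \<in> borel_measurable \<mu>"
      using measurable_mean by simp
  qed
  then have "AE x in \<mu>. mean \<Phi> x = m"
    using z by (subst (asm) integral_nonneg_eq_0_iff_AE) auto
  show "\<forall>x. mean \<Phi> x = m"
  proof (rule ccontr)
    assume "\<not> ?thesis"
    then have ne: "{x. mean \<Phi> x \<noteq> m} \<noteq> {}" by blast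
    \<comment> \<open>The exceptional set is open and null, hence empty by full support.\<close>
    have op: "open {x. mean \<Phi> x \<noteq> m}"
      by (intro open_Collect_neq continuous_on_mean continuous_on_const)
    have "measure \<mu> {x. mean \<Phi> x \<noteq> m} = 0"
      using \<open>AE x in \<mu>. mean \<Phi> x = m\<close> op
      by (subst prob_\<mu>.prob_eq_0) (auto simp: sets_\<mu>)
    then show False using measure_open_pos[OF op ne] by simp
  qed
qed simp

text \<open>A point of \<open>Q\<close> is a common first point with two independent tails. Given
  the first point, the two factors are independent with the same mean, so their product integrates
  to a square.\<close>

lemma integral_head_tails:
  fixes m :: real
  defines "Q \<equiv> (\<mu> \<Otimes>\<^sub>M S) \<Otimes>\<^sub>M S"
  shows "(\<integral>q. \<Phi> (pointed_matrix (fst (fst q)) (snd (fst q))) \<partial>Q) = integral\<^sup>L \<mu> (mean \<Phi>)"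
    "(\<integral>q. \<Phi> (pointed_matrix (fst (fst q)) (snd q)) \<partial>Q) = integral\<^sup>L \<mu> (mean \<Phi>)"
    "(\<integral>q. (\<Phi> (pointed_matrix (fst (fst q)) (snd (fst q))) - m) * (\<Phi> (pointed_matrix (fst (fst q)) (snd q)) - m) \<partial>Q) =
       (\<integral>x. (mean \<Phi> x - m)\<^sup>2 \<partial>\<mu>)"
proof -
  interpret MS: pair_prob_space \<mu> S ..
  interpret Q: pair_prob_space "\<mu> \<Otimes>\<^sub>M S" S ..
  let ?\<psi> = "\<lambda>x w. \<Phi> (pointed_matrix x w)"
  have \<psi>: "(\<lambda>p. ?\<psi> (fst p) (snd p)) \<in> borel_measurable (\<mu> \<Otimes>\<^sub>M S)"
    using measurable_compose[OF measurable_pointed_matrix_pair measurable_\<Phi>] by (simp add: case_prod_beta')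
  have \<psi>1 [measurable]: "(\<lambda>q. ?\<psi> (fst (fst q)) (snd (fst q))) \<in> borel_measurable ((\<mu> \<Otimes>\<^sub>M S) \<Otimes>\<^sub>M S)"
    by (rule measurable_compose[OF measurable_fst \<psi>])
  have \<psi>2 [measurable]: "(\<lambda>q. ?\<psi> (fst (fst q)) (snd q)) \<in> borel_measurable ((\<mu> \<Otimes>\<^sub>M S) \<Otimes>\<^sub>M S)"
    using measurable_compose[of "\<lambda>q. (fst (fst q), snd q)" "(\<mu> \<Otimes>\<^sub>M S) \<Otimes>\<^sub>M S" "\<mu> \<Otimes>\<^sub>M S", OF _ \<psi>] by simp
  have "B \<ge> 0" using bounded[of undefined] by linarith
  have bd: "\<bar>\<Phi> D - c\<bar> \<le> B + \<bar>c\<bar>" for D c using bounded[of D] by linarith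
  have i\<psi>: "integrable (\<mu> \<Otimes>\<^sub>M S) (\<lambda>p. (?\<psi> (fst p) (snd p) - c) * h (fst p))"
    if h: "h \<in> borel_measurable \<mu>" "\<And>x. \<bar>h x\<bar> \<le> C" for c h C
  proof (rule MS.integrable_const_bound[of _ "(B + \<bar>c\<bar>) * C"])
    show "(\<lambda>p. (?\<psi> (fst p) (snd p) - c) * h (fst p)) \<in> borel_measurable (\<mu> \<Otimes>\<^sub>M S)"
      using \<psi> measurable_compose[OF measurable_fst h(1), of S] by simp
    show "AE p in \<mu> \<Otimes>\<^sub>M S. norm ((?\<psi> (fst p) (snd p) - c) * h (fst p)) \<le> (B + \<bar>c\<bar>) * C"
      using bd h(2) \<open>B \<ge> 0\<close> by (intro AE_I2) (auto simp: abs_mult intro!: mult_mono)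
  qed
  \<comment> \<open>Integrates out the first tail next to a weight \<open>h\<close> of the first
    point: with \<open>h = 1\<close> this is the plain mean, and for the product \<open>h\<close> is
    the centred conditional mean left over by the second tail.\<close>
  have fst_integral: "(\<integral>p. (?\<psi> (fst p) (snd p) - c) * h (fst p) \<partial>(\<mu> \<Otimes>\<^sub>M S)) = (\<integral>x. (mean \<Phi> x - c) * h x \<partial>\<mu>)"
    if h: "h \<in> borel_measurable \<mu>" "\<And>x. \<bar>h x\<bar> \<le> C" for c h C
  proof -
    have "(\<integral>p. (?\<psi> (fst p) (snd p) - c) * h (fst p) \<partial>(\<mu> \<Otimes>\<^sub>M S)) =
        (\<integral>x. (\<integral>w. (?\<psi> x w - c) * h x \<partial>S) \<partial>\<mu>)"
      using MS.integral_fst'[OF i\<psi>[OF h]] by simp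
    also have "\<dots> = (\<integral>x. (mean \<Phi> x - c) * h x \<partial>\<mu>)"
      using integrable_\<Phi> by (simp add: mean_def P.prob_space)
    finally show ?thesis .
  qed
  have m1: "mean \<Phi> \<in> borel_measurable \<mu>" by (rule measurable_mean)
  have one: "(\<lambda>_. 1 :: real) \<in> borel_measurable \<mu>" "\<And>x. \<bar>1 :: real\<bar> \<le> 1" by simp_all
  have i1: "integrable ((\<mu> \<Otimes>\<^sub>M S) \<Otimes>\<^sub>M S) (\<lambda>q. ?\<psi> (fst (fst q)) (snd (fst q)))"
    using bounded by (intro Q.integrable_const_bound[of _ B]) auto
  have "(\<integral>q. ?\<psi> (fst (fst q)) (snd (fst q)) \<partial>((\<mu> \<Otimes>\<^sub>M S) \<Otimes>\<^sub>M S)) = (\<integral>p. ?\<psi> (fst p) (snd p) \<partial>(\<mu> \<Otimes>\<^sub>M S))"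
    using Q.integral_fst'[OF i1] by (simp add: P.prob_space)
  also have "\<dots> = integral\<^sup>L \<mu> (mean \<Phi>)" using fst_integral[OF one, of 0] by simp
  finally show "(\<integral>q. ?\<psi> (fst (fst q)) (snd (fst q)) \<partial>Q) = integral\<^sup>L \<mu> (mean \<Phi>)"
    by (simp add: Q_def)
  have mf: "(\<lambda>p. mean \<Phi> (fst p)) \<in> borel_measurable (\<mu> \<Otimes>\<^sub>M S)"
    by (rule measurable_compose[OF measurable_fst m1])
  have fst_only: "(\<integral>p. mean \<Phi> (fst p) \<partial>(\<mu> \<Otimes>\<^sub>M S)) = integral\<^sup>L \<mu> (mean \<Phi>)"
  proof -
    have "integrable (\<mu> \<Otimes>\<^sub>M S) (\<lambda>p. mean \<Phi> (fst p))"
      using mf abs_mean_le by (intro MS.integrable_const_bound[of _ B]) auto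
    from MS.integral_fst'[OF this] show ?thesis by (simp add: P.prob_space)
  qed
  have i2: "integrable ((\<mu> \<Otimes>\<^sub>M S) \<Otimes>\<^sub>M S) (\<lambda>q. ?\<psi> (fst (fst q)) (snd q))"
    using bounded by (intro Q.integrable_const_bound[of _ B]) auto
  have "(\<integral>q. ?\<psi> (fst (fst q)) (snd q) \<partial>((\<mu> \<Otimes>\<^sub>M S) \<Otimes>\<^sub>M S)) = (\<integral>p. mean \<Phi> (fst p) \<partial>(\<mu> \<Otimes>\<^sub>M S))"
    using Q.integral_fst'[OF i2] by (simp add: mean_def)
  then show "(\<integral>q. ?\<psi> (fst (fst q)) (snd q) \<partial>Q) = integral\<^sup>L \<mu> (mean \<Phi>)"
    by (simp add: Q_def fst_only)
  let ?f = "\<lambda>q. (?\<psi> (fst (fst q)) (snd (fst q)) - m) * (?\<psi> (fst (fst q)) (snd q) - m)"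
  have i3: "integrable ((\<mu> \<Otimes>\<^sub>M S) \<Otimes>\<^sub>M S) ?f"
  proof (rule Q.integrable_const_bound[of _ "(B + \<bar>m\<bar>) * (B + \<bar>m\<bar>)"])
    show "AE q in (\<mu> \<Otimes>\<^sub>M S) \<Otimes>\<^sub>M S. norm (?f q) \<le> (B + \<bar>m\<bar>) * (B + \<bar>m\<bar>)"
      using bd \<open>B \<ge> 0\<close> by (intro AE_I2) (auto simp: abs_mult intro!: mult_mono)
  qed measurable
  have "(\<integral>q. ?f q \<partial>((\<mu> \<Otimes>\<^sub>M S) \<Otimes>\<^sub>M S)) =
      (\<integral>p. (\<integral>w. (?\<psi> (fst p) (snd p) - m) * (?\<psi> (fst p) w - m) \<partial>S) \<partial>(\<mu> \<Otimes>\<^sub>M S))"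
    using Q.integral_fst'[OF i3] by simp
  also have "\<dots> = (\<integral>p. (?\<psi> (fst p) (snd p) - m) * (mean \<Phi> (fst p) - m) \<partial>(\<mu> \<Otimes>\<^sub>M S))"
    using integrable_\<Phi> by (simp add: mean_def P.prob_space)
  also have "\<dots> = (\<integral>x. (mean \<Phi> x - m) * (mean \<Phi> x - m) \<partial>\<mu>)"
  proof (rule fst_integral)
    show "(\<lambda>x. mean \<Phi> x - m) \<in> borel_measurable \<mu>" using m1 by simp
    show "\<bar>mean \<Phi> x - m\<bar> \<le> B + \<bar>m\<bar>" for x using abs_mean_le[of x] by linarith
  qed
  finally show "(\<integral>q. ?f q \<partial>Q) = (\<integral>x. (mean \<Phi> x - m)\<^sup>2 \<partial>\<mu>)"
    by (simp add: Q_def power2_eq_square)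
qed

end

end

section \<open>Distance matrices and covariances\<close>

text \<open>The passage from pointed matrices, indexed from 0, to the triangular matrices of the
  definitions, indexed from 1.\<close>

definition index_shift :: "(nat \<times> nat) set \<Rightarrow> (nat \<times> nat \<Rightarrow> real) \<Rightarrow> nat \<times> nat \<Rightarrow> real" where
  "index_shift I D = (\<lambda>(a, b)\<in>I. D (a - 1, b - 1))"

text \<open>The way back, by symmetry and a zero diagonal; entries whose larger index violates
  \<open>P\<close> are set to 0. \<open>P\<close> is \<open>\<lambda>j. j < p\<close> for finite
  matrices, which then appear as truncations, and constantly true for infinite ones.\<close>

definition symmetric_extension :: "(nat \<Rightarrow> bool) \<Rightarrow> (nat \<times> nat \<Rightarrow> real) \<Rightarrow> nat \<times> nat \<Rightarrow> real" where
  "symmetric_extension P E = (\<lambda>(i, j). if i < j \<and> P j then E (Suc i, Suc j)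
     else if j < i \<and> P i then E (Suc j, Suc i) else 0)"

lemma continuous_map_index_shift:
  "continuous_map euclidean (powertop_real I) (index_shift I)"
proof (subst continuous_map_componentwise, intro conjI ballI)
  fix k
  have "continuous_on UNIV (\<lambda>D :: nat \<times> nat \<Rightarrow> real. index_shift I D k)"
    by (cases "k \<in> I") (auto simp: index_shift_def case_prod_beta' intro: continuous_on_product_coordinates)
  then show "continuous_map euclidean euclideanreal (\<lambda>D. index_shift I D k)" by simp
qed (auto simp: index_shift_def)

lemma continuous_map_symmetric_extension:
  "continuous_map (powertop_real (index_pairs p)) euclidean (symmetric_extension (\<lambda>j. j < p))"
proof -
  have "continuous_map (powertop_real (index_pairs p)) (product_topology (\<lambda>_. euclideanreal) UNIV)
      (symmetric_extension (\<lambda>j. j < p))"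
  proof (subst continuous_map_componentwise_UNIV, intro allI)
    fix k :: "nat \<times> nat"
    obtain i j where k: "k = (i, j)" by fastforce
    show "continuous_map (powertop_real (index_pairs p)) euclideanreal
        (\<lambda>E. symmetric_extension (\<lambda>j. j < p) E k)"
      unfolding k symmetric_extension_def prod.case
      by (cases "i < j \<and> j < p"; cases "j < i \<and> i < p")
        (auto simp: index_pairs_def intro!: continuous_map_product_projection)
  qed
  then show ?thesis by (simp add: euclidean_product_topology)
qed

context full_support_mm_space
begin

lemma dist_matrix_eq_index_shift:
  assumes "\<And>a b. (a, b) \<in> I \<Longrightarrow> 1 \<le> a \<and> 1 \<le> b"
  shows "dist_matrix I s = index_shift I (pointed_matrix (s 1) (\<lambda>n. s (Suc (Suc n))))"
proof -
  have "case_nat (s 1) (\<lambda>n. s (Suc (Suc n))) (a - 1) = s a" if "1 \<le> a" for a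
    using that by (cases a) (auto split: nat.split)
  with assms show ?thesis
    unfolding dist_matrix_def index_shift_def pointed_matrix_def
    by (intro restrict_ext) (auto split: prod.split)
qed

lemma symmetric_extension_index_shift:
  "symmetric_extension P (index_shift {(a, b). 1 \<le> a \<and> a < b \<and> P (b - 1)} (pointed_matrix x w)) (i, j) =
     (if P (max i j) then pointed_matrix x w (i, j) else 0)"
  by (auto simp: symmetric_extension_def index_shift_def pointed_matrix_def max_def dist_commute)

text \<open>Turns a test function of triangular matrices into one of pointed matrices, to which the
  results on \<open>mean\<close> apply.\<close>

lemma continuous_bounded_index_shift:
  assumes \<phi>: "continuous_map (powertop_real I) euclideanreal \<phi>"
    and bd: "bounded (\<phi> ` topspace (powertop_real I))"
  obtains B where "continuous_on UNIV (\<lambda>D. \<phi> (index_shift I D))" "\<And>D. \<bar>\<phi> (index_shift I D)\<bar> \<le> B"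
proof -
  obtain B where B: "\<And>E. E \<in> topspace (powertop_real I) \<Longrightarrow> \<bar>\<phi> E\<bar> \<le> B"
    using bd by (auto simp: bounded_iff)
  have "continuous_on UNIV (\<lambda>D. \<phi> (index_shift I D))"
    using continuous_map_compose[OF continuous_map_index_shift \<phi>] by (simp add: comp_def)
  moreover have "\<bar>\<phi> (index_shift I D)\<bar> \<le> B" for D
    by (rule B) (auto simp: index_shift_def)
  ultimately show thesis by (rule that)
qed

text \<open>A bounded continuous function of the whole matrix is the pointwise limit of its values
  at truncated matrices, which depend on finitely many entries; dominated convergence carries the
  equality of the means over to it.\<close>

lemma law_eqI:
  assumes eq: "\<And>p \<phi>. 1 \<le> p \<Longrightarrow> continuous_map (powertop_real (index_pairs p)) euclideanreal \<phi> \<Longrightarrow>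
      bounded (\<phi> ` topspace (powertop_real (index_pairs p))) \<Longrightarrow>
      mean (\<lambda>D. \<phi> (index_shift (index_pairs p) D)) x = mean (\<lambda>D. \<phi> (index_shift (index_pairs p) D)) y"
  shows "law x = law y"
proof (rule measure_eqI_integral_bounded_continuous)
  show "prob_space (law x)" "prob_space (law y)"
    by (rule P.prob_space_distr[OF measurable_pointed_matrix])+
  fix f :: "(nat \<times> nat \<Rightarrow> real) \<Rightarrow> real"
  assume f: "continuous_on UNIV f" "\<And>D. \<bar>f D\<bar> \<le> 1"
  define \<phi> where "\<phi> p E = f (symmetric_extension (\<lambda>j. j < p) E)" for p :: nat and E
  define \<Phi> where "\<Phi> p D = \<phi> p (index_shift (index_pairs p) D)" for p D
  have \<phi>: "continuous_map (powertop_real (index_pairs p)) euclideanreal (\<phi> p)"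
    "bounded (\<phi> p ` topspace (powertop_real (index_pairs p)))" for p
  proof -
    have "continuous_map euclidean euclideanreal f" using f(1) by simp
    then have "continuous_map (powertop_real (index_pairs p)) euclideanreal (f \<circ> symmetric_extension (\<lambda>j. j < p))"
      by (rule continuous_map_compose[OF continuous_map_symmetric_extension])
    then show "continuous_map (powertop_real (index_pairs p)) euclideanreal (\<phi> p)"
      by (simp only: \<phi>_def[abs_def] comp_def)
    show "bounded (\<phi> p ` topspace (powertop_real (index_pairs p)))"
      using f(2) by (auto simp: bounded_iff \<phi>_def)
  qed
  \<comment> \<open>\<open>Suc p\<close>, because the hypothesis speaks of
    \<open>1 \<le> p\<close>.\<close>
  have lim: "(\<lambda>p. mean (\<Phi> (Suc p)) z) \<longlonglongrightarrow> integral\<^sup>L (law z) f" for z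
  proof -
    have "(\<lambda>p. \<integral>w. \<Phi> (Suc p) (pointed_matrix z w) \<partial>S) \<longlonglongrightarrow> (\<integral>w. f (pointed_matrix z w) \<partial>S)"
    proof (rule integral_dominated_convergence[where w = "\<lambda>_. 1"])
      show "(\<lambda>w. f (pointed_matrix z w)) \<in> borel_measurable S"
        by (rule measurable_compose[OF measurable_pointed_matrix borel_measurable_continuous_onI[OF f(1)]])
      show "(\<lambda>w. \<Phi> (Suc p) (pointed_matrix z w)) \<in> borel_measurable S" for p
      proof -
        have "continuous_on UNIV (\<Phi> (Suc p))"
          unfolding \<Phi>_def[abs_def] by (rule continuous_bounded_index_shift[OF \<phi>])
        then show ?thesis
          by (intro measurable_compose[OF measurable_pointed_matrix] borel_measurable_continuous_onI)
      qed
      show "AE w in S. norm (\<Phi> (Suc p) (pointed_matrix z w)) \<le> 1" for p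
        using f(2) by (simp add: \<Phi>_def \<phi>_def)
      show "AE w in S. (\<lambda>p. \<Phi> (Suc p) (pointed_matrix z w)) \<longlonglongrightarrow> f (pointed_matrix z w)"
      proof (rule AE_I2)
        fix w
        let ?D = "\<lambda>p. symmetric_extension (\<lambda>j. j < Suc p) (index_shift (index_pairs (Suc p)) (pointed_matrix z w))"
        have I: "index_pairs (Suc p) = {(a, b). 1 \<le> a \<and> a < b \<and> b - 1 < Suc p}" for p
          by (auto simp: index_pairs_def)
        have D: "?D p (i, j) = (if max i j < Suc p then pointed_matrix z w (i, j) else 0)" for p i j
          unfolding I by (rule symmetric_extension_index_shift)
        have "limitin (product_topology (\<lambda>_. euclidean) UNIV) ?D (pointed_matrix z w) sequentially"
        proof (subst limitin_componentwise, intro conjI ballI)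
          fix k :: "nat \<times> nat"
          obtain i j where k: "k = (i, j)" by fastforce
          \<comment> \<open>An entry is no longer cut off once \<open>p\<close> exceeds both of its
            indices.\<close>
          have "eventually (\<lambda>p. pointed_matrix z w k = ?D p k) sequentially"
            using eventually_gt_at_top[of "max i j"]
          proof (rule eventually_mono)
            fix q assume "max i j < q"
            then have "max i j < Suc q" by (rule less_SucI)
            then show "pointed_matrix z w k = ?D q k" by (simp only: k D if_True)
          qed
          then have "(\<lambda>p. ?D p k) \<longlonglongrightarrow> pointed_matrix z w k"
            by (rule Lim_transform_eventually[OF tendsto_const])
          then show "limitin euclidean (\<lambda>p. ?D p k) (pointed_matrix z w k) sequentially" by simp
        qed auto
        then have "?D \<longlonglongrightarrow> pointed_matrix z w" by (simp add: euclidean_product_topology)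
        then show "(\<lambda>p. \<Phi> (Suc p) (pointed_matrix z w)) \<longlonglongrightarrow> f (pointed_matrix z w)"
          unfolding \<Phi>_def \<phi>_def by (rule continuous_on_tendsto_compose[OF f(1)]) simp_all
      qed
    qed simp
    then show ?thesis
      by (simp add: mean_def mean_eq_integral_law[OF f, symmetric])
  qed
  have "mean (\<Phi> (Suc p)) x = mean (\<Phi> (Suc p)) y" for p
    unfolding \<Phi>_def[abs_def] by (intro eq \<phi>) simp
  then show "integral\<^sup>L (law x) f = integral\<^sup>L (law y) f"
    using lim[of x] lim[of y] LIMSEQ_unique by fastforce
qed simp_all

section \<open>Transfer from an arbitrary probability space to the sequence space\<close>

lemma measurable_shift_sequence:
  "(\<lambda>w n. w (Suc n)) \<in> measurable (PiM {1..} (\<lambda>_. borel)) S"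
proof (rule measurable_PiM_single')
  have "(\<lambda>w. w (Suc i)) \<in> measurable (PiM {1..} (\<lambda>_. borel :: 'a measure)) borel" for i
    by (rule measurable_component_singleton) simp
  then show "(\<lambda>w. w (Suc i)) \<in> measurable (PiM {1..} (\<lambda>_. borel)) \<mu>" for i
    by (simp cong: measurable_cong_sets add: sets_\<mu>)
qed (auto simp: space_\<mu>)

text \<open>Independence gives the joint law over the indices from 1 as a product measure, and
  reindexing by \<open>Suc\<close> turns it into \<open>S\<close>. Statements about the given random
  variables thus become statements about \<open>S\<close>.\<close>

lemma iid_sequence_law:
  fixes X :: "nat \<Rightarrow> 'w \<Rightarrow> 'a"
  assumes \<Omega>: "prob_space \<Omega>" and X: "prob_space.indep_vars \<Omega> (\<lambda>_. borel) X {1..}"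
    and law_X: "\<And>n. n \<ge> 1 \<Longrightarrow> distr \<Omega> borel (X n) = \<mu>"
  shows "(\<lambda>\<omega> n. X (Suc n) \<omega>) \<in> measurable \<Omega> S" "distr \<Omega> S (\<lambda>\<omega> n. X (Suc n) \<omega>) = S"
proof -
  interpret \<Omega>: prob_space \<Omega> by fact
  have rv: "X n \<in> borel_measurable \<Omega>" if "n \<in> {1..}" for n
    using X that by (auto simp: \<Omega>.indep_vars_def2)
  have rv': "X (Suc n) \<in> measurable \<Omega> \<mu>" for n
    using rv[of "Suc n"] by (simp cong: measurable_cong_sets add: sets_\<mu>)
  then show "(\<lambda>\<omega> n. X (Suc n) \<omega>) \<in> measurable \<Omega> S"
    by (intro measurable_PiM_single') (auto simp: space_\<mu>)
  let ?K = "{1::nat..}"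
  let ?r = "\<lambda>w::nat \<Rightarrow> 'a. \<lambda>n. w (Suc n)"
  note r = measurable_shift_sequence
  have m: "(\<lambda>\<omega>. \<lambda>n\<in>?K. X n \<omega>) \<in> measurable \<Omega> (PiM ?K (\<lambda>_. borel))"
    using rv by (intro measurable_restrict) auto
  have "distr \<Omega> (PiM ?K (\<lambda>_. borel)) (\<lambda>\<omega>. \<lambda>n\<in>?K. X n \<omega>) = PiM ?K (\<lambda>n. distr \<Omega> borel (X n))"
    using X rv by (subst (asm) \<Omega>.indep_vars_iff_distr_eq_PiM') auto
  also have "\<dots> = PiM ?K (\<lambda>_. \<mu>)" by (rule PiM_cong) (simp_all add: law_X)
  finally have eq: "distr \<Omega> (PiM ?K (\<lambda>_. borel)) (\<lambda>\<omega>. \<lambda>n\<in>?K. X n \<omega>) = PiM ?K (\<lambda>_. \<mu>)" .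
  have "distr \<Omega> S (\<lambda>\<omega> n. X (Suc n) \<omega>) = distr (distr \<Omega> (PiM ?K (\<lambda>_. borel)) (\<lambda>\<omega>. \<lambda>n\<in>?K. X n \<omega>)) S ?r"
    by (subst distr_distr[OF r m]) (simp add: comp_def)
  also have "\<dots> = S"
    unfolding eq using distr_PiM_reindex[of ?K "\<lambda>_. \<mu>" Suc UNIV] prob_\<mu>.prob_space_axioms
    by (simp add: restrict_UNIV)
  finally show "distr \<Omega> S (\<lambda>\<omega> n. X (Suc n) \<omega>) = S" .
qed

text \<open>The triangular and the square matrix determine each other measurably:
  \<open>index_shift\<close> drops the redundant entries and \<open>symmetric_extension\<close>
  restores them.\<close>

lemma pointed_matrix_distribution_constant_iff:
  fixes X :: "nat \<Rightarrow> 'w \<Rightarrow> 'a"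
  assumes \<Omega>: "prob_space \<Omega>" and X: "prob_space.indep_vars \<Omega> (\<lambda>_. borel) X {1..}"
    and law_X: "\<And>n. n \<ge> 1 \<Longrightarrow> distr \<Omega> borel (X n) = \<mu>"
  shows "pointed_matrix_distribution \<Omega> X x = pointed_matrix_distribution \<Omega> X y \<longleftrightarrow> law x = law y"
proof -
  let ?I = index_pairs_inf
  let ?N = "PiM ?I (\<lambda>_. borel :: real measure)"
  define Y where "Y = (\<lambda>\<omega> n. X (Suc n) \<omega>)"
  have Y: "Y \<in> measurable \<Omega> S" "distr \<Omega> S Y = S"
    unfolding Y_def by (rule iid_sequence_law[OF \<Omega> X law_X]; assumption)+
  define F where "F z = (\<lambda>\<omega>. index_shift ?I (pointed_matrix z (Y \<omega>)))" for z
  have shift: "dist_matrix ?I (\<lambda>i. if i = 1 then z else X (i - 1) \<omega>) = F z \<omega>" for z \<omega>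
    by (subst dist_matrix_eq_index_shift) (auto simp: index_pairs_inf_def F_def Y_def)
  have pmd: "pointed_matrix_distribution \<Omega> X z = distr \<Omega> Rmet_sigma (F z)" for z
    unfolding pointed_matrix_distribution_def shift ..
  have R: "index_shift ?I \<in> measurable borel ?N"
    unfolding index_shift_def case_prod_beta'
    by (rule measurable_restrict) (auto intro!: borel_measurable_continuous_onI continuous_on_product_coordinates)
  have law_Y: "law z = distr \<Omega> borel (\<lambda>\<omega>. pointed_matrix z (Y \<omega>))" for z
    using distr_distr[OF measurable_pointed_matrix Y(1), of z] by (simp add: Y(2) comp_def)
  have mY: "(\<lambda>\<omega>. pointed_matrix z (Y \<omega>)) \<in> borel_measurable \<Omega>" for z
    by (rule measurable_compose[OF Y(1) measurable_pointed_matrix])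
  have FN: "F z \<in> measurable \<Omega> ?N" for z
    unfolding F_def by (rule measurable_compose[OF mY R])
  have F: "F z \<in> measurable \<Omega> Rmet_sigma" for z
    unfolding Rmet_sigma_def
  proof (rule measurable_restrict_space2[OF _ FN])
    have "dist_matrix ?I s \<in> Rmet" for s :: "nat \<Rightarrow> 'a"
      by (auto simp: Rmet_def dist_matrix_def index_pairs_inf_def intro: dist_triangle dist_triangle2 dist_triangle3)
    then show "F z \<in> space \<Omega> \<rightarrow> Rmet" by (auto simp flip: shift)
  qed
  have distr_N: "distr \<Omega> ?N (F z) = distr (law z) ?N (index_shift ?I)" for z
    unfolding law_Y F_def by (subst distr_distr[OF R mY]) (simp add: comp_def)
  show ?thesis
  proof
    assume eq: "law x = law y"
    show "pointed_matrix_distribution \<Omega> X x = pointed_matrix_distribution \<Omega> X y"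
      unfolding pmd
    proof (rule measure_eqI)
      fix A assume "A \<in> sets (distr \<Omega> Rmet_sigma (F x))"
      then have A: "A \<in> sets Rmet_sigma" by simp
      \<comment> \<open>The sets of \<open>Rmet_sigma\<close> are traces on \<open>Rmet\<close>,
        where \<open>F\<close> takes its values, so they can be replaced by sets of the full
        product.\<close>
      then obtain B where B: "B \<in> sets ?N" "A = Rmet \<inter> B"
        by (auto simp: Rmet_sigma_def sets_restrict_space)
      have "emeasure (distr \<Omega> Rmet_sigma (F z)) A = emeasure (distr \<Omega> ?N (F z)) B" for z
      proof -
        have "F z \<omega> \<in> Rmet" if "\<omega> \<in> space \<Omega>" for \<omega>
          using measurable_space[OF F that, of z] by (simp add: Rmet_sigma_def space_restrict_space)
        then have "F z -` A \<inter> space \<Omega> = F z -` B \<inter> space \<Omega>" using B(2) by auto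
        then show ?thesis using A B(1) by (simp add: emeasure_distr[OF F] emeasure_distr[OF FN])
      qed
      then show "emeasure (distr \<Omega> Rmet_sigma (F x)) A = emeasure (distr \<Omega> Rmet_sigma (F y)) A"
        by (simp add: distr_N eq)
    qed simp
  next
    assume eq: "pointed_matrix_distribution \<Omega> X x = pointed_matrix_distribution \<Omega> X y"
    \<comment> \<open>Nothing is truncated here: the whole pointed matrix is recovered from its
      triangular half.\<close>
    let ?E = "symmetric_extension (\<lambda>_. True)"
    have E: "?E \<in> borel_measurable Rmet_sigma"
    proof (rule measurable_coordinatewise_then_product)
      fix k :: "nat \<times> nat"
      obtain i j where k: "k = (i, j)" by fastforce
      have c: "(\<lambda>D. D (Suc i, Suc j)) \<in> borel_measurable Rmet_sigma" if "i < j" for i j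
        unfolding Rmet_sigma_def using that
        by (intro measurable_restrict_space1 measurable_component_singleton) (auto simp: index_pairs_inf_def)
      show "(\<lambda>D. ?E D k) \<in> borel_measurable Rmet_sigma"
        unfolding k symmetric_extension_def prod.case using c by (cases i j rule: linorder_cases) auto
    qed
    have EF: "?E (F z \<omega>) = pointed_matrix z (Y \<omega>)" for z \<omega>
    proof
      fix k :: "nat \<times> nat"
      obtain i j where k: "k = (i, j)" by fastforce
      have "?I = {(a, b). 1 \<le> a \<and> a < b \<and> True}" by (simp add: index_pairs_inf_def)
      then show "?E (F z \<omega>) k = pointed_matrix z (Y \<omega>) k"
        using symmetric_extension_index_shift[of "\<lambda>_. True" z "Y \<omega>" i j] by (simp add: F_def k)
    qed
    have "law z = distr (distr \<Omega> Rmet_sigma (F z)) borel ?E" for z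
      unfolding law_Y by (subst distr_distr[OF E F]) (simp add: comp_def EF)
    then show "law x = law y" using eq by (simp add: pmd)
  qed
qed

text \<open>The first sequence, split into its first point and its tail, and the tail of the second
  sequence have joint law \<open>(\<mu> \<Otimes>\<^sub>M S) \<Otimes>\<^sub>M S\<close>, which
  reduces the covariance to \<open>integral_head_tails\<close>.\<close>

lemma covariance_eq_variance_mean:
  fixes X X' :: "nat \<Rightarrow> 'w \<Rightarrow> 'a"
  assumes \<Omega>: "prob_space \<Omega>"
    and X: "prob_space.indep_vars \<Omega> (\<lambda>_. borel) X {1..}" "\<And>n. n \<ge> 1 \<Longrightarrow> distr \<Omega> borel (X n) = \<mu>"
    and X': "prob_space.indep_vars \<Omega> (\<lambda>_. borel) X' {1..}" "\<And>n. n \<ge> 1 \<Longrightarrow> distr \<Omega> borel (X' n) = \<mu>"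
    and XX': "prob_space.indep_var \<Omega>
           (PiM {1..} (\<lambda>_. borel)) (\<lambda>\<omega>. \<lambda>n\<in>{1..}. X n \<omega>)
           (PiM {1..} (\<lambda>_. borel)) (\<lambda>\<omega>. \<lambda>n\<in>{1..}. X' n \<omega>)"
    and \<Phi>: "continuous_on UNIV \<Phi>" "\<And>D. \<bar>\<Phi> D\<bar> \<le> B"
  defines "m \<equiv> integral\<^sup>L \<mu> (mean \<Phi>)"
  shows "covariance \<Omega> (\<lambda>\<omega>. \<Phi> (pointed_matrix (X 1 \<omega>) (\<lambda>n. X (Suc (Suc n)) \<omega>)))
      (\<lambda>\<omega>. \<Phi> (pointed_matrix (X 1 \<omega>) (\<lambda>n. X' (Suc (Suc n)) \<omega>))) =
    (\<integral>x. (mean \<Phi> x - m)\<^sup>2 \<partial>\<mu>)"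
proof -
  interpret \<Omega>: prob_space \<Omega> by fact
  let ?Q = "(\<mu> \<Otimes>\<^sub>M S) \<Otimes>\<^sub>M S"
  define Y where "Y = (\<lambda>\<omega> n. X (Suc n) \<omega>)"
  have Y: "Y \<in> measurable \<Omega> S" "distr \<Omega> S Y = S"
    unfolding Y_def by (rule iid_sequence_law[OF \<Omega> X]; assumption)+
  define Y' where "Y' = (\<lambda>\<omega> n. X' (Suc n) \<omega>)"
  have Y': "Y' \<in> measurable \<Omega> S" "distr \<Omega> S Y' = S"
    unfolding Y'_def by (rule iid_sequence_law[OF \<Omega> X']; assumption)+
  let ?r = "\<lambda>w::nat \<Rightarrow> 'a. \<lambda>n. w (Suc n)"
  let ?ht = "\<lambda>w::nat \<Rightarrow> 'a. (w 0, \<lambda>n. w (Suc n))"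
  note r = measurable_shift_sequence
  note ht = measurable_head_tail
  have r': "?r \<in> measurable S S"
    by (intro measurable_PiM_single') (auto simp: space_\<mu>)
  \<comment> \<open>\<open>Z\<close> is the pair of \<open>X 1\<close> and the tail of the first
    sequence; \<open>W\<close> is the second sequence without \<open>X' 1\<close>, whose place is
    taken by \<open>X 1\<close>.\<close>
  define Z where "Z = (\<lambda>\<omega>. ?ht (Y \<omega>))"
  define W where "W = (\<lambda>\<omega>. ?r (Y' \<omega>))"
  have "\<Omega>.indep_var S (?r \<circ> (\<lambda>\<omega>. \<lambda>n\<in>{1..}. X n \<omega>)) S (?r \<circ> (\<lambda>\<omega>. \<lambda>n\<in>{1..}. X' n \<omega>))"
    by (rule \<Omega>.indep_var_compose[OF XX' r r])
  then have "\<Omega>.indep_var S Y S Y'"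
    by (simp add: Y_def Y'_def comp_def)
  then have joint: "distr \<Omega> (S \<Otimes>\<^sub>M S) (\<lambda>\<omega>. (Y \<omega>, Y' \<omega>)) = S \<Otimes>\<^sub>M S"
    using Y(2) Y'(2) by (simp add: \<Omega>.indep_var_distribution_eq)
  have YY: "(\<lambda>\<omega>. (Y \<omega>, Y' \<omega>)) \<in> measurable \<Omega> (S \<Otimes>\<^sub>M S)" using Y(1) Y'(1) by (rule measurable_Pair)
  have htr: "(\<lambda>(w, w'). (?ht w, ?r w')) \<in> measurable (S \<Otimes>\<^sub>M S) ?Q"
    unfolding case_prod_beta'
    by (intro measurable_Pair measurable_compose[OF measurable_fst ht, simplified]
        measurable_compose[OF measurable_snd r'] measurable_compose[OF measurable_fst ht])
  have m: "(\<lambda>\<omega>. (Z \<omega>, W \<omega>)) \<in> measurable \<Omega> ?Q"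
    using measurable_compose[OF YY htr] by (simp add: Z_def W_def)
  have "distr \<Omega> ?Q (\<lambda>\<omega>. (Z \<omega>, W \<omega>)) = distr (S \<Otimes>\<^sub>M S) ?Q (\<lambda>(w, w'). (?ht w, ?r w'))"
    using distr_distr[OF htr YY] by (simp add: joint Z_def W_def comp_def)
  also have "\<dots> = distr S (\<mu> \<Otimes>\<^sub>M S) ?ht \<Otimes>\<^sub>M distr S S ?r"
    using ht r' by (rule pair_measure_distr[symmetric]) (simp add: distr_shift_sequence P.sigma_finite_measure_axioms)
  finally have Q: "distr \<Omega> ?Q (\<lambda>\<omega>. (Z \<omega>, W \<omega>)) = ?Q"
    by (simp only: distr_head_tail distr_shift_sequence)
  have transfer: "(\<integral>\<omega>. h (Z \<omega>, W \<omega>) \<partial>\<Omega>) = (\<integral>q. h q \<partial>?Q)" if "h \<in> borel_measurable ?Q" for h :: "_ \<Rightarrow> real"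
    using integral_distr[OF m that] by (simp add: Q)
  have \<psi>: "(\<lambda>p. \<Phi> (pointed_matrix (fst p) (snd p))) \<in> borel_measurable (\<mu> \<Otimes>\<^sub>M S)"
    using measurable_compose[OF measurable_pointed_matrix_pair borel_measurable_continuous_onI[OF \<Phi>(1)]]
    by (simp add: case_prod_beta')
  have \<psi>1 [measurable]: "(\<lambda>q. \<Phi> (pointed_matrix (fst (fst q)) (snd (fst q)))) \<in> borel_measurable ?Q"
    by (rule measurable_compose[OF measurable_fst \<psi>])
  have \<psi>2 [measurable]: "(\<lambda>q. \<Phi> (pointed_matrix (fst (fst q)) (snd q))) \<in> borel_measurable ?Q"
    using measurable_compose[of "\<lambda>q. (fst (fst q), snd q)" ?Q "\<mu> \<Otimes>\<^sub>M S", OF _ \<psi>] by simp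
  let ?U = "\<lambda>\<omega>. \<Phi> (pointed_matrix (fst (Z \<omega>)) (snd (Z \<omega>)))"
  let ?V = "\<lambda>\<omega>. \<Phi> (pointed_matrix (fst (Z \<omega>)) (W \<omega>))"
  have "(\<integral>\<omega>. ?U \<omega> \<partial>\<Omega>) = m" "(\<integral>\<omega>. ?V \<omega> \<partial>\<Omega>) = m"
    using transfer[OF \<psi>1] transfer[OF \<psi>2] integral_head_tails(1,2)[OF \<Phi>] by (simp_all add: m_def)
  then have "covariance \<Omega> ?U ?V = (\<integral>\<omega>. (?U \<omega> - m) * (?V \<omega> - m) \<partial>\<Omega>)"
    by (simp add: covariance_def)
  also have "\<dots> = (\<integral>q. (\<Phi> (pointed_matrix (fst (fst q)) (snd (fst q))) - m) *
      (\<Phi> (pointed_matrix (fst (fst q)) (snd q)) - m) \<partial>?Q)"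
    using transfer[of "\<lambda>q. (\<Phi> (pointed_matrix (fst (fst q)) (snd (fst q))) - m) *
      (\<Phi> (pointed_matrix (fst (fst q)) (snd q)) - m)"] by simp
  also have "\<dots> = (\<integral>x. (mean \<Phi> x - m)\<^sup>2 \<partial>\<mu>)" by (rule integral_head_tails(3)[OF \<Phi>])
  finally show ?thesis by (simp add: Z_def W_def Y_def Y'_def)
qed

end

text \<open>The existence of a group in the fourth assertion ranges over all types of group
  elements. It is split accordingly: a group is provided over the fixed type
  \<open>'a \<Rightarrow> 'a\<close> of self-maps of the space, and the converse is proved for
  groups over an arbitrary type \<open>'g\<close>.\<close>

theorem theorem5p1:
  fixes \<mu> :: "'a::polish_space measure"
    and \<Omega> :: "'w measure"
    and X X' :: "nat \<Rightarrow> 'w \<Rightarrow> 'a"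
  assumes "mm_space UNIV dist \<mu>"
    and "prob_space \<Omega>"
    and "prob_space.indep_vars \<Omega> (\<lambda>_. borel) X {1..}"
    and "\<And>n. n \<ge> 1 \<Longrightarrow> distr \<Omega> borel (X n) = \<mu>"
    and "prob_space.indep_vars \<Omega> (\<lambda>_. borel) X' {1..}"
    and "\<And>n. n \<ge> 1 \<Longrightarrow> distr \<Omega> borel (X' n) = \<mu>"
    and "prob_space.indep_var \<Omega>
           (PiM {1..} (\<lambda>_. borel)) (\<lambda>\<omega>. \<lambda>n\<in>{1..}. X n \<omega>)
           (PiM {1..} (\<lambda>_. borel)) (\<lambda>\<omega>. \<lambda>n\<in>{1..}. X' n \<omega>)"
  defines "assertion1 \<equiv>
      (\<forall>p\<ge>1. \<forall>\<phi>. continuous_map (powertop_real (index_pairs p)) euclideanreal \<phi> \<and>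
                  bounded (\<phi> ` topspace (powertop_real (index_pairs p))) \<longrightarrow>
         covariance \<Omega>
           (\<lambda>\<omega>. \<phi> (dist_matrix (index_pairs p) (\<lambda>n. X n \<omega>)))
           (\<lambda>\<omega>. \<phi> (dist_matrix (index_pairs p) (\<lambda>n. if n = 1 then X 1 \<omega> else X' n \<omega>))) = 0)"
    and "assertion2 \<equiv> pointed_matrix_distribution \<Omega> X constant_on UNIV"
    and "assertion3 \<equiv> transitive_action (Isomp \<mu>) UNIV (\<lambda>g. g)"
  shows "(assertion1 \<longleftrightarrow> assertion2) \<and>
         (assertion2 \<longleftrightarrow> assertion3) \<and>
         (assertion3 \<longleftrightarrow> compact_group_quotient TYPE('a \<Rightarrow> 'a) UNIV dist \<mu>) \<and>
         (compact_group_quotient TYPE('g) UNIV dist \<mu> \<longrightarrow> assertion3)"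
proof -
  interpret full_support_mm_space \<mu> by unfold_locales fact
  have a2: "assertion2 \<longleftrightarrow> (\<forall>x y. law x = law y)"
    unfolding assertion2_def constant_on_def
    using pointed_matrix_distribution_constant_iff[OF assms(2-4)] by (metis UNIV_I)
  have a3: "assertion3 \<longleftrightarrow> (\<forall>x y. \<exists>g\<in>carrier (Isomp \<mu>). g x = y)"
    unfolding assertion3_def by (rule transitive_action_Isomp_iff[OF sets_\<mu>])
  let ?\<Phi> = "\<lambda>p \<phi> D. \<phi> (index_shift (index_pairs p) D) :: real"
  let ?m = "\<lambda>\<Phi>. integral\<^sup>L \<mu> (mean \<Phi>)"
  have cov: "covariance \<Omega>
           (\<lambda>\<omega>. \<phi> (dist_matrix (index_pairs p) (\<lambda>n. X n \<omega>)))
           (\<lambda>\<omega>. \<phi> (dist_matrix (index_pairs p) (\<lambda>n. if n = 1 then X 1 \<omega> else X' n \<omega>))) = 0 \<longleftrightarrow>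
      (\<forall>x. mean (?\<Phi> p \<phi>) x = ?m (?\<Phi> p \<phi>))"
    if \<phi>: "continuous_map (powertop_real (index_pairs p)) euclideanreal \<phi>"
      "bounded (\<phi> ` topspace (powertop_real (index_pairs p)))" for p \<phi>
  proof -
    obtain B where B: "continuous_on UNIV (?\<Phi> p \<phi>)" "\<And>D. \<bar>?\<Phi> p \<phi> D\<bar> \<le> B"
      using continuous_bounded_index_shift[OF \<phi>] by metis
    have shift: "dist_matrix (index_pairs p) s =
        index_shift (index_pairs p) (pointed_matrix (s 1) (\<lambda>n. s (Suc (Suc n))))" for s
      by (rule dist_matrix_eq_index_shift) (auto simp: index_pairs_def)
    show ?thesis
      using covariance_eq_variance_mean[OF assms(2-7) B] variance_mean_eq_0_iff[OF B]
      by (simp add: shift)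
  qed
  have a12: "assertion1 \<longleftrightarrow> (\<forall>x y. law x = law y)"
  proof
    assume a1: "assertion1"
    show "\<forall>x y. law x = law y"
    proof (intro allI law_eqI)
      fix x y p \<phi>
      assume p: "1 \<le> p" and \<phi>: "continuous_map (powertop_real (index_pairs p)) euclideanreal \<phi>"
        "bounded (\<phi> ` topspace (powertop_real (index_pairs p)))"
      have "\<forall>x. mean (?\<Phi> p \<phi>) x = ?m (?\<Phi> p \<phi>)"
        using a1 p \<phi> cov[OF \<phi>] unfolding assertion1_def by blast
      then show "mean (?\<Phi> p \<phi>) x = mean (?\<Phi> p \<phi>) y" by simp
    qed
  next
    assume law: "\<forall>x y. law x = law y"
    show assertion1
      unfolding assertion1_def
    proof (intro allI impI, elim conjE)
      fix p :: nat and \<phi>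
      assume \<phi>: "continuous_map (powertop_real (index_pairs p)) euclideanreal \<phi>"
        "bounded (\<phi> ` topspace (powertop_real (index_pairs p)))"
      obtain B where B: "continuous_on UNIV (?\<Phi> p \<phi>)" "\<And>D. \<bar>?\<Phi> p \<phi> D\<bar> \<le> B"
        using continuous_bounded_index_shift[OF \<phi>] by metis
      have "mean (?\<Phi> p \<phi>) x = mean (?\<Phi> p \<phi>) y" for x y
        by (simp only: mean_eq_integral_law[OF B] law[rule_format, of x y])
      \<comment> \<open>A constant conditional mean equals its own average \<open>?m\<close>,
        because \<open>\<mu>\<close> has total mass 1; hence the variance vanishes.\<close>
      then have c: "mean (?\<Phi> p \<phi>) = (\<lambda>_. mean (?\<Phi> p \<phi>) undefined)" by blast
      have "?m (?\<Phi> p \<phi>) = mean (?\<Phi> p \<phi>) undefined"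
        by (subst c) (simp add: prob_\<mu>.prob_space)
      then have "\<forall>x. mean (?\<Phi> p \<phi>) x = ?m (?\<Phi> p \<phi>)" using c by metis
      then show "covariance \<Omega>
           (\<lambda>\<omega>. \<phi> (dist_matrix (index_pairs p) (\<lambda>n. X n \<omega>)))
           (\<lambda>\<omega>. \<phi> (dist_matrix (index_pairs p) (\<lambda>n. if n = 1 then X 1 \<omega> else X' n \<omega>))) = 0"
        using cov[OF \<phi>] by blast
    qed
  qed
  have "compact_group_quotient TYPE('a \<Rightarrow> 'a) UNIV dist \<mu>" if "assertion3"
  proof -
    interpret homogeneous_mm_space \<mu>
      by unfold_locales (use assms(1) that a3 in auto)
    show ?thesis by (rule compact_group_quotient_Iso)
  qed
  moreover have "assertion3" if "compact_group_quotient TYPE('a \<Rightarrow> 'a) UNIV dist \<mu>"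
    using compact_group_quotient_imp_transitive[OF assms(1) that] a3 by blast
  moreover have "assertion3" if "compact_group_quotient TYPE('g) UNIV dist \<mu>"
    using compact_group_quotient_imp_transitive[OF assms(1) that] a3 by blast
  ultimately show ?thesis
    using a2 a3 a12 transitive_iff_law_constant by blast
qed

end
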